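(* Let $\Omega\subset\mathbb R^n$ be a domain. The following conditions are equivalent: (1) $\Omega$ satisfies the measure density condition: there is a constant $c_m>0$ such that $|\Omega\cap B(x,r)|\ge c_m|B(x,r)|$ for all $x\in\Omega$ and $0<r\le 1$; (2) $\Omega$ is a $B^s_{p,q}$-extension domain for all $0<s<1$, $0<p<\infty$ and $0<q\le\infty$; (3) $\Omega$ is a $B^s_{p,q}$-extension domain for some $0<s<1$, $0<p<\infty$ and $0<q\le\infty$.
   Context: $|A|$ denotes the Lebesgue measure of $A\subset\mathbb R^n$; a domain is an open connected set. For a measurable set $S\subset\mathbb R^n$, $h\in\mathbb R^n$ and $t>0$, let $S_h=S\cap(S-h)$, where $S-h=\{z-h: z\in S\}$, and $$\omega(u,S,t)_p=\sup_{|h|\le t}\Big(\int_{S_h}|u(x+h)-u(x)|^p\,dx\Big)^{1/p}.$$ The Besov space $B^s_{p,q}(S)$ consists of the measurable functions $u$ on $S$ for which the (quasi)norm $$\|u\|_{B^s_{p,q}(S)}=\|u\|_{L^p(S)}+\Big(\int_0^1\big(t^{-s}\omega(u,S,t)_p\big)^q\,\frac{dt}{t}\Big)^{1/q}$$ is finite (with the integral replaced by $\sup_{0<t<1}t^{-s}\omega(u,S,t)_p$ when $q=\infty$). For $S=\mathbb R^n$ this is the classical Besov space $B^s_{p,q}(\mathbb R^n)$. A domain $\Omega\subset\mathbb R^n$ is a $B^s_{p,q}$-extension domain if there is a bounded extension operator $E\colon B^s_{p,q}(\Omega)\to B^s_{p,q}(\mathbb R^n)$, i.e. a (not necessarily linear)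 map with $Eu|_\Omega=u$ for all $u$ and $\|Eu\|_{B^s_{p,q}(\mathbb R^n)}\le C\|u\|_{B^s_{p,q}(\Omega)}$ for all $u$, with $C$ independent of $u$. *)

theory Defs
  imports "HOL-Analysis.Analysis"
begin

text \<open>Functions on a set \<open>S\<close> are represented by total functions, of which only the values on \<open>S\<close>
  are used. Norms take values in \<^typ>\<open>ennreal\<close>, so that suprema and integrals of nonnegative
  functions always exist and finiteness of the norm is a genuine condition.\<close>

text \<open>The library has no real power on \<^typ>\<open>ennreal\<close>; this is used for exponents \<open>a > 0\<close> only,
  where \<open>0\<^sup>a = 0\<close> and \<open>\<infinity>\<^sup>a = \<infinity>\<close>.\<close>

definition ennreal_power :: "ennreal \<Rightarrow> real \<Rightarrow> ennreal" where
  "ennreal_power x a = (if x = \<infinity> then \<infinity> else ennreal (enn2real x powr a))"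

definition lp_norm :: "real \<Rightarrow> (real^'n) set \<Rightarrow> (real^'n \<Rightarrow> real) \<Rightarrow> ennreal" where
  "lp_norm p S u =
     ennreal_power (\<integral>\<^sup>+x\<in>S. ennreal (\<bar>u x\<bar> powr p) \<partial>lebesgue) (1 / p)"

definition shift_inter :: "(real^'n) set \<Rightarrow> real^'n \<Rightarrow> (real^'n) set" where
  "shift_inter S h = S \<inter> (\<lambda>z. z - h) ` S"

definition smoothness_modulus ::
  "real \<Rightarrow> (real^'n) set \<Rightarrow> (real^'n \<Rightarrow> real) \<Rightarrow> real \<Rightarrow> ennreal" where
  "smoothness_modulus p S u t =
     (SUP h\<in>{h. norm h \<le> t}.
        ennreal_power
          (\<integral>\<^sup>+x\<in>shift_inter S h. ennreal (\<bar>u (x + h) - u x\<bar> powr p) \<partial>lebesgue) (1 / p))"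

definition besov_seminorm ::
  "real \<Rightarrow> real \<Rightarrow> ennreal \<Rightarrow> (real^'n) set \<Rightarrow> (real^'n \<Rightarrow> real) \<Rightarrow> ennreal" where
  "besov_seminorm s p q S u =
     (if q = \<infinity>
      then (SUP t\<in>{0<..<1}. ennreal (t powr (- s)) * smoothness_modulus p S u t)
      else ennreal_power
             (\<integral>\<^sup>+t\<in>{0<..<1}.
                ennreal_power (ennreal (t powr (- s)) * smoothness_modulus p S u t) (enn2real q)
                  * ennreal (1 / t) \<partial>lborel)
             (1 / enn2real q))"

definition besov_norm ::
  "real \<Rightarrow> real \<Rightarrow> ennreal \<Rightarrow> (real^'n) set \<Rightarrow> (real^'n \<Rightarrow> real) \<Rightarrow> ennreal" where
  "besov_norm s p q S u = lp_norm p S u + besov_seminorm s p q S u"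

definition besov_space ::
  "real \<Rightarrow> real \<Rightarrow> ennreal \<Rightarrow> (real^'n) set \<Rightarrow> (real^'n \<Rightarrow> real) set" where
  "besov_space s p q S =
     {u. u \<in> borel_measurable (lebesgue_on S) \<and> besov_norm s p q S u < \<infinity>}"

text \<open>Elements of a Besov space are identified when they agree almost everywhere. Hence \<open>E\<close> is
  required to respect this identification, and \<open>E u\<close> to extend \<open>u\<close> almost everywhere on \<open>\<Omega>\<close>.\<close>

definition bounded_extension_operator ::
  "real \<Rightarrow> real \<Rightarrow> ennreal \<Rightarrow> (real^'n) set
     \<Rightarrow> ((real^'n \<Rightarrow> real) \<Rightarrow> (real^'n \<Rightarrow> real)) \<Rightarrow> bool" where
  "bounded_extension_operator s p q \<Omega> E \<longleftrightarrow>
     (\<forall>u\<in>besov_space s p q \<Omega>. E u \<in> besov_space s p q UNIV) \<and>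
     (\<forall>u\<in>besov_space s p q \<Omega>. \<forall>v\<in>besov_space s p q \<Omega>.
        (AE x in lebesgue_on \<Omega>. u x = v x) \<longrightarrow> (AE x in lebesgue. E u x = E v x)) \<and>
     (\<forall>u\<in>besov_space s p q \<Omega>. AE x in lebesgue_on \<Omega>. E u x = u x) \<and>
     (\<exists>C::real. C \<ge> 0 \<and>
        (\<forall>u\<in>besov_space s p q \<Omega>.
           besov_norm s p q UNIV (E u) \<le> ennreal C * besov_norm s p q \<Omega> u))"

definition besov_extension_domain ::
  "real \<Rightarrow> real \<Rightarrow> ennreal \<Rightarrow> (real^'n) set \<Rightarrow> bool" where
  "besov_extension_domain s p q \<Omega> \<longleftrightarrow>
     open \<Omega> \<and> connected \<Omega> \<and> (\<exists>E. bounded_extension_operator s p q \<Omega> E)"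

definition measure_density_condition :: "(real^'n) set \<Rightarrow> bool" where
  "measure_density_condition \<Omega> \<longleftrightarrow>
     (\<exists>c>0. \<forall>x\<in>\<Omega>. \<forall>r. 0 < r \<and> r \<le> 1 \<longrightarrow>
        measure lebesgue (\<Omega> \<inter> ball x r) \<ge> c * measure lebesgue (ball x r))"

end

theory Submission
  imports Defs
begin

text \<open>Write \<open>\<omega>(t)\<close> for the \<open>p\<close>-modulus of smoothness and \<open>n\<close> for the dimension. Only two facts about the
Besov norm are used in either direction: it is comparable to a weighted sequence norm of the dyadic
values \<open>\<omega>(2\<^sup>-\<^sup>k)\<close> (\<open>seq_norm_dyadic_energy_le\<close>, \<open>besov_norm_le_seq_norm\<close>), and \<open>t\<^sup>n \<omega>(t)\<^sup>p\<close> dominates the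
double integral of \<open>|u(x) - u(y)|\<^sup>p\<close> over pairs of points at distance less than \<open>t\<close>
(\<open>double_integral_le_modulus\<close>). Everything is stated for \<open>p\<close>-th powers, so that \<open>p < 1\<close> and \<open>p \<ge> 1\<close> are
treated alike.

Extension implies density. Suppose that \<open>v\<close> equals 1 on a set \<open>A\<close> and 0 on a set \<open>Z\<close>, both lying in a
ball of radius \<open>r\<close> and both of measure at least a fraction \<open>\<delta>\<close> of that ball. Looking at \<open>v\<close> at a single
intermediate scale shows that \<open>v\<close> is nearly 1 on half of a small ball near \<open>A\<close> and nearly 0 on half
of a small ball near \<open>Z\<close>, unless its modulus at the small scale is already large. This bounds the
smoothness of \<open>v\<close> from below by a power \<open>\<delta>\<^sup>1\<^sup>-\<^sup>\<theta>\<close> with \<open>\<theta> > 0\<close> (\<open>density_ratio_bound\<close>), for all \<open>s\<close> and \<open>p\<close>, and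
takes the role of the Sobolev, exponential and Hoelder embeddings. Applied to the extension of a Lipschitz
cutoff between two concentric balls, it bounds the density of \<open>\<Omega>\<close> in the smaller ball by a power
greater than 1 of its density in the larger one. If the density were tiny, a De Giorgi iteration over
shrinking balls would make it tend to 0 (\<open>de_giorgi_lower_bound\<close>), but the limiting ball meets the open
set \<open>\<Omega>\<close> in positive measure. Connectedness supplies the second set \<open>Z\<close>.

Density implies extension. Outside \<open>\<Omega>\<close> the extension at \<open>x\<close> is an average of \<open>u\<close> over the part of \<open>\<Omega>\<close> in a
ball around \<open>x\<close> of radius comparable to the distance from \<open>x\<close> to \<open>\<Omega>\<close>, multiplied by a cutoff. Since
\<open>u\<close> need not be integrable when \<open>p < 1\<close>, the average is a trimmed mean: the mean of the quantiles of
\<open>u\<close> between the lower and the upper quarter. It deviates from any constant \<open>c\<close> by at most a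
multiple of the \<open>p\<close>-mean of \<open>|u - c|\<close> (\<open>trimmed_mean_error\<close>), and it depends in a Lipschitz way on the distribution of
\<open>u\<close> (\<open>trimmed_mean_diff\<close>); as the ball moves continuously with \<open>x\<close>, this takes the place of a Whitney
decomposition with a partition of unity. Trimmed means at consecutive scales differ by a local oscillation of
\<open>u\<close>. Summing these differences (\<open>mean_chain\<close>, \<open>mean_near\<close>) controls the extension near \<open>\<Omega>\<close>, while
the Lipschitz dependence controls it far from \<open>\<Omega>\<close> (\<open>mean_far\<close>). The modulus of the extension at
scale \<open>2\<^sup>-\<^sup>k\<close> is thus bounded by a sum of moduli of \<open>u\<close> with weights that decay geometrically after
multiplication by \<open>2\<^sup>k\<^sup>s\<^sup>p\<close> (\<open>extension_modulus\<close>), and a discrete Young inequality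
(\<open>seq_norm_geom_kernel_le\<close>) finishes the estimate.\<close>

abbreviation epow :: "real \<Rightarrow> real \<Rightarrow> ennreal" where
  "epow p t \<equiv> ennreal (\<bar>t\<bar> powr p)"

abbreviation dyadic :: "nat \<Rightarrow> real" where
  "dyadic l \<equiv> 2 powr (- real l)"

section \<open>Powers of extended nonnegative reals\<close>

lemma ennreal_power_ennreal: "x \<ge> 0 \<Longrightarrow> ennreal_power (ennreal x) a = ennreal (x powr a)"
  by (simp add: ennreal_power_def)

lemma ennreal_power_top [simp]: "ennreal_power top a = top"
  by (simp add: ennreal_power_def)

lemma ennreal_power_0 [simp]: "ennreal_power 0 a = 0"
  by (simp add: ennreal_power_def)

lemma ennreal_power_eq_top_iff [simp]: "ennreal_power x a = top \<longleftrightarrow> x = top"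
  by (simp add: ennreal_power_def)

lemma ennreal_power_mono:
  assumes "x \<le> y" "a \<ge> 0" shows "ennreal_power x a \<le> ennreal_power y a"
proof (cases "y = top")
  case False
  with assms obtain r t where "x = ennreal r" "y = ennreal t" "r \<ge> 0" "t \<ge> 0" "r \<le> t"
    by (metis enn2real_nonneg ennreal_enn2real_if ennreal_le_iff top.extremum_unique)
  then show ?thesis using assms by (simp add: ennreal_power_ennreal powr_mono2 ennreal_leI)
qed auto

lemma ennreal_power_mult:
  assumes "a > 0" shows "ennreal_power (x * y) a = ennreal_power x a * ennreal_power y a"
proof (cases "x = 0 \<or> y = 0 \<or> x = top \<or> y = top")
  case True
  then show ?thesis
    by (cases "x = 0"; cases "y = 0"; cases "x = top"; cases "y = top")
      (use assms in \<open>auto simp: ennreal_mult_eq_top_iff ennreal_power_def ennreal_mult_top ennreal_top_mult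
         enn2real_eq_0_iff\<close>)
next
  case False
  then obtain r t where "x = ennreal r" "y = ennreal t" "r \<ge> 0" "t \<ge> 0"
    by (metis enn2real_nonneg ennreal_enn2real_if)
  then show ?thesis
    by (simp add: ennreal_power_ennreal powr_mult flip: ennreal_mult)
qed

lemma ennreal_power_power: "ennreal_power (ennreal_power x a) b = ennreal_power x (a * b)"
  by (simp add: ennreal_power_def powr_powr)

lemma ennreal_power_one [simp]: "ennreal_power x 1 = x"
  by (cases x) (simp_all add: ennreal_power_ennreal)

lemma ennreal_power_le_iff:
  assumes "a > 0"
  shows "ennreal_power x a \<le> y \<longleftrightarrow> x \<le> ennreal_power y (1 / a)"
proof
  assume "ennreal_power x a \<le> y"
  from ennreal_power_mono[OF this, of "1 / a"] show "x \<le> ennreal_power y (1 / a)"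
    using assms by (simp add: ennreal_power_power)
next
  assume "x \<le> ennreal_power y (1 / a)"
  from ennreal_power_mono[OF this, of a] show "ennreal_power x a \<le> y"
    using assms by (simp add: ennreal_power_power)
qed

lemma ennreal_power_add_le:
  assumes "a \<ge> 0"
  shows "ennreal_power (x + y) a \<le> ennreal (2 powr a) * (ennreal_power x a + ennreal_power y a)"
proof (cases "a = 0")
  case True
  then show ?thesis
    by (cases x; cases y) (auto simp: ennreal_power_def ennreal_mult_top)
next
  case False
  have *: "ennreal_power (x + y) a \<le> ennreal (2 powr a) * (ennreal_power x a + ennreal_power y a)"
    if "x \<le> y" for x y
  proof -
    have "x + y \<le> ennreal 2 * y"
      using that by (metis add_right_mono ennreal_numeral mult_2)
    then have "ennreal_power (x + y) a \<le> ennreal (2 powr a) * ennreal_power y a"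
      using ennreal_power_mono[of "x + y" "ennreal 2 * y" a] False assms
      by (simp add: ennreal_power_mult ennreal_power_ennreal del: ennreal_numeral)
    then show ?thesis
      by (rule order_trans) (auto intro!: mult_left_mono)
  qed
  show ?thesis
    using *[of x y] *[of y x] by (cases "x \<le> y") (auto simp: add.commute)
qed

text \<open>Positive powers are increasing bijections, hence commute with suprema.\<close>

lemma ennreal_power_SUP:
  assumes "a > 0" "I \<noteq> {}"
  shows "ennreal_power (SUP i\<in>I. f i) a = (SUP i\<in>I. ennreal_power (f i) a)"
proof (rule antisym)
  show "ennreal_power (SUP i\<in>I. f i) a \<le> (SUP i\<in>I. ennreal_power (f i) a)"
    unfolding ennreal_power_le_iff[OF assms(1)]
    by (intro SUP_least) (auto simp: ennreal_power_le_iff[OF assms(1), symmetric] intro!: SUP_upper)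
  show "(SUP i\<in>I. ennreal_power (f i) a) \<le> ennreal_power (SUP i\<in>I. f i) a"
    using assms by (intro SUP_least ennreal_power_mono SUP_upper) auto
qed

lemma powr_abs_add_le:
  fixes x y :: real assumes "p > 0"
  shows "\<bar>x + y\<bar> powr p \<le> 2 powr p * (\<bar>x\<bar> powr p + \<bar>y\<bar> powr p)"
proof -
  have "\<bar>x + y\<bar> powr p \<le> (2 * max \<bar>x\<bar> \<bar>y\<bar>) powr p"
    using assms by (intro powr_mono2) auto
  also have "\<dots> = 2 powr p * max \<bar>x\<bar> \<bar>y\<bar> powr p"
    by (simp add: powr_mult)
  also have "\<dots> \<le> 2 powr p * (\<bar>x\<bar> powr p + \<bar>y\<bar> powr p)"
    by (intro mult_left_mono) (auto simp: max_def)
  finally show ?thesis .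
qed

lemma ennreal_powr_add_le:
  fixes x y :: real assumes "p > 0"
  shows "epow p (x + y) \<le> ennreal (2 powr p) * (epow p (x) + epow p (y))"
  using ennreal_leI[OF powr_abs_add_le[OF assms, of x y]]
  by (simp add: ennreal_mult ennreal_plus)

lemma ennreal_powr_triangle:
  fixes x y z :: real assumes "p > 0"
  shows "epow p (x - z)
     \<le> ennreal (2 powr p) * (epow p (x - y) + epow p (y - z))"
  using ennreal_powr_add_le[OF assms, of "x - y" "y - z"] by simp

lemma suminf_swap_ennreal:
  fixes f :: "nat \<Rightarrow> nat \<Rightarrow> ennreal"
  shows "(\<Sum>i. \<Sum>j. f i j) = (\<Sum>j. \<Sum>i. f i j)"
proof -
  have "(\<Sum>i. \<Sum>j. f i j) = (\<integral>\<^sup>+i. (\<Sum>j. f i j) \<partial>count_space UNIV)"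
    by (simp add: nn_integral_count_space_nat)
  also have "\<dots> = (\<Sum>j. \<integral>\<^sup>+i. f i j \<partial>count_space UNIV)"
    by (rule nn_integral_suminf) auto
  finally show ?thesis by (simp add: nn_integral_count_space_nat)
qed

lemma suminf_ge_term_ennreal: "f (i::nat) \<le> (\<Sum>l. f l :: ennreal)"
  using sum_le_suminf[OF summableI, of "{i}" f] by simp

section \<open>Geometrically decaying kernels on dyadic scales\<close>

text \<open>The influence of the scale \<open>2\<^sup>-\<^sup>l\<close> on the scale \<open>2\<^sup>-\<^sup>k\<close>: all estimates between scales are reduced to this
kernel.\<close>

definition geom_kernel :: "real \<Rightarrow> nat \<Rightarrow> nat \<Rightarrow> real" where
  "geom_kernel \<eta> k l = 2 powr (- \<eta> * \<bar>real k - real l\<bar>)"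

lemma geom_kernel_pos [simp]: "geom_kernel \<eta> k l > 0" and geom_kernel_nonneg [simp]: "geom_kernel \<eta> k l \<ge> 0"
  by (auto simp: geom_kernel_def)

lemma geom_kernel_commute: "geom_kernel \<eta> k l = geom_kernel \<eta> l k"
  by (simp add: geom_kernel_def abs_minus_commute)

lemma two_powr_neg_le_one: "a \<ge> 0 \<Longrightarrow> 2 powr (- a) \<le> (1::real)"
  using powr_mono[of "-a" 0 2] by simp

lemma two_powr_neg_Suc: "dyadic (Suc l) = dyadic l / (2::real)"
proof -
  have "- real (Suc l) = - real l - 1" by simp
  then show ?thesis by (simp only: powr_diff) simp
qed

lemma suminf_geom_kernel_le:
  assumes "\<eta> > 0"
  shows "(\<Sum>l. ennreal (geom_kernel \<eta> k l)) \<le> ennreal (2 / (1 - 2 powr (-\<eta>)))"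
proof -
  define x where "x = 2 powr (- \<eta>)"
  have x: "0 < x" "x < 1" using assms by (auto simp: x_def powr_less_one)
  have pow: "2 powr (- \<eta> * real m) = x ^ m" for m
    by (simp add: x_def powr_realpow[symmetric] powr_powr)
  have eq: "geom_kernel \<eta> k l = (if l < k then x ^ (k - l) else x ^ (l - k))" for l
    using pow[of "k - l"] pow[of "l - k"] by (auto simp: geom_kernel_def of_nat_diff abs_if)
  have 1: "(\<Sum>l<k. geom_kernel \<eta> k l) \<le> 1 / (1 - x)"
  proof -
    have "(\<Sum>l<k. geom_kernel \<eta> k l) = (\<Sum>l<k. x ^ (k - l))" by (simp add: eq)
    also have "\<dots> = (\<Sum>l<k. x ^ Suc l)"
      by (subst sum.nat_diff_reindex[symmetric]) (auto intro!: sum.cong simp: Suc_diff_Suc)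
    also have "\<dots> \<le> (\<Sum>l<k. x ^ l)"
      using x by (intro sum_mono power_decreasing) auto
    also have "\<dots> \<le> (\<Sum>l. x ^ l)"
      using x by (intro sum_le_suminf summable_geometric) auto
    finally show ?thesis using x by (simp add: suminf_geometric)
  qed
  have "(\<Sum>l. ennreal (geom_kernel \<eta> k l))
      = (\<Sum>l. ennreal (geom_kernel \<eta> k (l + k))) + (\<Sum>l<k. ennreal (geom_kernel \<eta> k l))"
    by (rule suminf_offset) (rule summableI)
  also have "(\<Sum>l. ennreal (geom_kernel \<eta> k (l + k))) = (\<Sum>l. ennreal (x ^ l))" by (simp add: eq)
  also have "\<dots> = ennreal (1 / (1 - x))"
    using x by (subst suminf_ennreal2) (auto simp: suminf_geometric summable_geometric)
  also have "(\<Sum>l<k. ennreal (geom_kernel \<eta> k l)) = ennreal (\<Sum>l<k. geom_kernel \<eta> k l)"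
    by (simp add: sum_ennreal)
  also have "ennreal (1 / (1 - x)) + ennreal (\<Sum>l<k. geom_kernel \<eta> k l) \<le> ennreal (1/(1-x)) + ennreal (1/(1-x))"
    using 1 by (intro add_left_mono ennreal_leI)
  also have "\<dots> = ennreal (2 / (1 - x))"
    using x by (subst ennreal_plus[symmetric]) auto
  finally show ?thesis unfolding x_def .
qed

lemma suminf_geom_kernel_le':
  assumes "\<eta> > 0"
  shows "(\<Sum>l. ennreal (geom_kernel \<eta> l k)) \<le> ennreal (2 / (1 - 2 powr (-\<eta>)))"
proof -
  have "(\<lambda>l. ennreal (geom_kernel \<eta> l k)) = (\<lambda>l. ennreal (geom_kernel \<eta> k l))"
    by (rule ext) (rule arg_cong[OF geom_kernel_commute])
  then show ?thesis using suminf_geom_kernel_le[OF assms, of k] by simp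
qed

text \<open>Half of the decay of the kernel bounds every term by the \<open>r\<close>-th root of the sum on the right, and the
other half is a convergent geometric series. The argument is the same for \<open>r < 1\<close> and \<open>r \<ge> 1\<close>.\<close>

lemma ennreal_power_suminf_geom_kernel_le:
  assumes "\<eta> > 0" "r > 0"
  shows "ennreal_power (\<Sum>l. ennreal (geom_kernel \<eta> k l) * Y l) r
     \<le> ennreal ((2 / (1 - 2 powr (- (\<eta>/2)))) powr r)
        * (\<Sum>l. ennreal (geom_kernel (\<eta> * r / 2) k l) * ennreal_power (Y l) r)"
proof -
  define Z where "Z = (\<Sum>l. ennreal (geom_kernel (\<eta> * r / 2) k l) * ennreal_power (Y l) r)"
  define G where "G = 2 / (1 - 2 powr (- (\<eta>/2)))"
  have G: "G \<ge> 0" using assms by (simp add: G_def two_powr_neg_le_one)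
  have split: "geom_kernel \<eta> k l = geom_kernel (\<eta>/2) k l * geom_kernel (\<eta>/2) k l" for l
    by (simp add: geom_kernel_def flip: powr_add)
  have "ennreal (geom_kernel (\<eta>/2) k l) * Y l \<le> ennreal_power Z (1 / r)" for l
  proof -
    have "geom_kernel (\<eta> * r / 2) k l = geom_kernel (\<eta>/2) k l powr r"
      by (simp add: geom_kernel_def powr_powr mult_ac)
    then have "ennreal_power (ennreal (geom_kernel (\<eta>/2) k l) * Y l) r
      = ennreal (geom_kernel (\<eta> * r / 2) k l) * ennreal_power (Y l) r"
      using assms by (simp add: ennreal_power_mult ennreal_power_ennreal)
    also have "\<dots> \<le> Z" unfolding Z_def by (rule suminf_ge_term_ennreal)
    finally show ?thesis using ennreal_power_le_iff[OF assms(2)] by simp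
  qed
  then have "ennreal (geom_kernel \<eta> k l) * Y l \<le> ennreal (geom_kernel (\<eta>/2) k l) * ennreal_power Z (1 / r)" for l
    by (simp add: split ennreal_mult mult.assoc mult_left_mono)
  then have "(\<Sum>l. ennreal (geom_kernel \<eta> k l) * Y l)
     \<le> (\<Sum>l. ennreal (geom_kernel (\<eta>/2) k l) * ennreal_power Z (1 / r))"
    by (intro suminf_le) (auto intro: summableI)
  also have "\<dots> = (\<Sum>l. ennreal (geom_kernel (\<eta>/2) k l)) * ennreal_power Z (1 / r)" by simp
  also have "\<dots> \<le> ennreal G * ennreal_power Z (1 / r)"
    unfolding G_def using assms by (intro mult_right_mono suminf_geom_kernel_le) simp_all
  finally have "ennreal_power (\<Sum>l. ennreal (geom_kernel \<eta> k l) * Y l) r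
      \<le> ennreal_power (ennreal G * ennreal_power Z (1 / r)) r"
    using assms by (intro ennreal_power_mono) auto
  also have "\<dots> = ennreal (G powr r) * Z"
    using assms G by (simp add: ennreal_power_mult ennreal_power_ennreal ennreal_power_power)
  finally show ?thesis unfolding G_def Z_def .
qed

text \<open>The entries of \<open>Y\<close> are \<open>p\<close>-th powers. The result is the \<open>\<ell>\<^sup>q\<close> quasinorm of the \<open>p\<close>-th roots, so that it is
homogeneous of degree 1 in the function from which \<open>Y\<close> is built.\<close>

definition seq_norm :: "real \<Rightarrow> ennreal \<Rightarrow> (nat \<Rightarrow> ennreal) \<Rightarrow> ennreal" where
  "seq_norm p q Y = (if q = \<infinity> then (SUP l. ennreal_power (Y l) (1 / p))
     else ennreal_power (\<Sum>l. ennreal_power (Y l) (enn2real q / p)) (1 / enn2real q))"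

lemma seq_norm_ge_term:
  assumes "p > 0" "q > 0"
  shows "Y l \<le> ennreal_power (seq_norm p q Y) p"
proof (cases "q = \<infinity>")
  case True
  have "ennreal_power (Y l) (1/p) \<le> seq_norm p q Y"
    unfolding seq_norm_def using True by (auto intro!: SUP_upper)
  then show ?thesis using assms ennreal_power_le_iff[of "1/p"] by simp
next
  case False
  then have q: "enn2real q > 0" using assms by (simp add: enn2real_positive_iff top.not_eq_extremum)
  have "ennreal_power (Y l) (enn2real q / p) \<le> (\<Sum>l. ennreal_power (Y l) (enn2real q / p))"
    by (rule suminf_ge_term_ennreal)
  then show ?thesis using False assms q
    by (simp add: seq_norm_def ennreal_power_le_iff ennreal_power_power)
qed

lemma seq_norm_single:
  assumes "p > 0" "q > 0"
  shows "seq_norm p q (\<lambda>l. if l = N then A else 0) = ennreal_power A (1 / p)"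
proof (cases "q = \<infinity>")
  case True
  have "(SUP l. ennreal_power (if l = N then A else 0) (1 / p)) = ennreal_power A (1/p)"
    by (rule antisym) (auto intro!: SUP_least SUP_upper2[of N])
  then show ?thesis using True by (simp add: seq_norm_def)
next
  case False
  then have q: "enn2real q > 0" using assms by (simp add: enn2real_positive_iff top.not_eq_extremum)
  have "(\<Sum>l. ennreal_power (if l = N then A else 0) (enn2real q / p)) = ennreal_power A (enn2real q / p)"
    by (subst suminf_finite[of "{N}"]) auto
  then show ?thesis using False q assms by (simp add: seq_norm_def ennreal_power_power)
qed

text \<open>A discrete Young inequality for all \<open>q\<close>; the constant depends on \<open>p\<close>, \<open>q\<close> and \<open>\<eta>\<close> only.\<close>

lemma seq_norm_geom_kernel_le:
  assumes "p > 0" "q > 0" "\<eta> > 0"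
  obtains C where "C \<ge> 0"
    "\<And>X Y. (\<And>k. X k \<le> (\<Sum>l. ennreal (geom_kernel \<eta> k l) * Y l)) \<Longrightarrow> seq_norm p q X \<le> ennreal C * seq_norm p q Y"
proof (cases "q = \<infinity>")
  case True
  define G where "G = 2 / (1 - 2 powr (-\<eta>))"
  have G: "G \<ge> 0" using assms by (simp add: G_def two_powr_neg_le_one)
  have "seq_norm p q X \<le> ennreal (G powr (1/p)) * seq_norm p q Y"
    if X: "\<And>k. X k \<le> (\<Sum>l. ennreal (geom_kernel \<eta> k l) * Y l)" for X Y
  proof -
    have "ennreal_power (X k) (1/p) \<le> ennreal (G powr (1/p)) * seq_norm p q Y" for k
    proof -
      have "X k \<le> (\<Sum>l. ennreal (geom_kernel \<eta> k l) * Y l)" by (rule X)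
      also have "\<dots> \<le> (\<Sum>l. ennreal (geom_kernel \<eta> k l) * ennreal_power (seq_norm p q Y) p)"
        using assms by (intro suminf_le mult_left_mono seq_norm_ge_term) (auto intro: summableI)
      also have "\<dots> = (\<Sum>l. ennreal (geom_kernel \<eta> k l)) * ennreal_power (seq_norm p q Y) p" by simp
      also have "\<dots> \<le> ennreal G * ennreal_power (seq_norm p q Y) p"
        unfolding G_def using assms by (intro mult_right_mono suminf_geom_kernel_le) simp_all
      finally have "ennreal_power (X k) (1/p) \<le> ennreal_power (ennreal G * ennreal_power (seq_norm p q Y) p) (1/p)"
        using assms by (intro ennreal_power_mono) auto
      then show ?thesis using assms G
        by (simp add: ennreal_power_mult ennreal_power_ennreal ennreal_power_power)
    qed
    then show ?thesis by (subst seq_norm_def) (auto simp: True intro!: SUP_least)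
  qed
  then show thesis by (intro that[of "G powr (1/p)"]) auto
next
  case False
  define r where "r = enn2real q / p"
  have q: "enn2real q > 0" using assms False by (simp add: enn2real_positive_iff top.not_eq_extremum)
  have r: "r > 0" using q assms by (simp add: r_def)
  define G1 where "G1 = (2 / (1 - 2 powr (- (\<eta>/2)))) powr r"
  define G2 where "G2 = 2 / (1 - 2 powr (-(\<eta>*r/2)))"
  have G: "G1 \<ge> 0" "G2 \<ge> 0" using assms r by (auto simp: G1_def G2_def two_powr_neg_le_one)
  have "seq_norm p q X \<le> ennreal ((G1 * G2) powr (1/enn2real q)) * seq_norm p q Y"
    if X: "\<And>k. X k \<le> (\<Sum>l. ennreal (geom_kernel \<eta> k l) * Y l)" for X Y
  proof -
    have "(\<Sum>k. ennreal_power (X k) r)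
      \<le> (\<Sum>k. ennreal G1 * (\<Sum>l. ennreal (geom_kernel (\<eta> * r / 2) k l) * ennreal_power (Y l) r))"
    proof (intro suminf_le summableI)
      fix k
      have "ennreal_power (X k) r \<le> ennreal_power (\<Sum>l. ennreal (geom_kernel \<eta> k l) * Y l) r"
        using X r by (intro ennreal_power_mono) auto
      also have "\<dots> \<le> ennreal G1 * (\<Sum>l. ennreal (geom_kernel (\<eta> * r / 2) k l) * ennreal_power (Y l) r)"
        unfolding G1_def using assms r by (intro ennreal_power_suminf_geom_kernel_le) auto
      finally show "ennreal_power (X k) r
         \<le> ennreal G1 * (\<Sum>l. ennreal (geom_kernel (\<eta> * r / 2) k l) * ennreal_power (Y l) r)" .
    qed
    also have "\<dots> = ennreal G1 * (\<Sum>k. \<Sum>l. ennreal (geom_kernel (\<eta> * r / 2) k l) * ennreal_power (Y l) r)"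
      by simp
    also have "(\<Sum>k. \<Sum>l. ennreal (geom_kernel (\<eta> * r / 2) k l) * ennreal_power (Y l) r)
       = (\<Sum>l. \<Sum>k. ennreal (geom_kernel (\<eta> * r / 2) k l) * ennreal_power (Y l) r)"
      by (rule suminf_swap_ennreal)
    also have "\<dots> = (\<Sum>l. (\<Sum>k. ennreal (geom_kernel (\<eta> * r / 2) k l)) * ennreal_power (Y l) r)"
      by simp
    also have "\<dots> \<le> (\<Sum>l. ennreal G2 * ennreal_power (Y l) r)"
      unfolding G2_def using assms r
      by (intro suminf_le summableI mult_right_mono suminf_geom_kernel_le') simp_all
    finally have "(\<Sum>k. ennreal_power (X k) r) \<le> ennreal (G1 * G2) * (\<Sum>l. ennreal_power (Y l) r)"
      using G by (simp add: ennreal_mult mult.assoc mult_left_mono)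
    then have "seq_norm p q X \<le> ennreal_power (ennreal (G1 * G2) * (\<Sum>l. ennreal_power (Y l) r)) (1 / enn2real q)"
      using False q by (simp add: seq_norm_def r_def ennreal_power_mono)
    also have "\<dots> = ennreal ((G1 * G2) powr (1/enn2real q)) * seq_norm p q Y"
      using False q G by (simp add: seq_norm_def r_def ennreal_power_mult ennreal_power_ennreal)
    finally show ?thesis .
  qed
  then show thesis by (intro that[of "(G1 * G2) powr (1/enn2real q)"]) auto
qed

section \<open>The Besov norm in dyadic form\<close>

text \<open>Norms are replaced by their \<open>p\<close>-th powers: these are plain integrals, and they satisfy a triangle
inequality up to the factor \<open>2\<^sup>p\<close> for every \<open>p > 0\<close>.\<close>

definition increment_energy :: "real \<Rightarrow> (real^'n) set \<Rightarrow> (real^'n \<Rightarrow> real) \<Rightarrow> real^'n \<Rightarrow> ennreal" where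
  "increment_energy p S u h =
     (\<integral>\<^sup>+x\<in>shift_inter S h. epow p (u (x + h) - u x) \<partial>lebesgue)"

definition modulus_power :: "real \<Rightarrow> (real^'n) set \<Rightarrow> (real^'n \<Rightarrow> real) \<Rightarrow> real \<Rightarrow> ennreal" where
  "modulus_power p S u t = (SUP h\<in>{h. norm h \<le> t}. increment_energy p S u h)"

definition lp_energy :: "real \<Rightarrow> (real^'n) set \<Rightarrow> (real^'n \<Rightarrow> real) \<Rightarrow> ennreal" where
  "lp_energy p S u = (\<integral>\<^sup>+x\<in>S. epow p (u x) \<partial>lebesgue)"

lemma mem_shift_inter [simp]: "x \<in> shift_inter S h \<longleftrightarrow> x \<in> S \<and> x + h \<in> S"
  by (force simp: shift_inter_def image_iff algebra_simps)

lemma increment_energy_le_modulus: "norm h \<le> t \<Longrightarrow> increment_energy p S u h \<le> modulus_power p S u t"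
  unfolding modulus_power_def by (rule SUP_upper) simp

lemma modulus_power_mono: "t \<le> t' \<Longrightarrow> modulus_power p S u t \<le> modulus_power p S u t'"
  unfolding modulus_power_def by (rule SUP_subset_mono) auto

lemma smoothness_modulus_eq:
  assumes "p > 0" "t \<ge> 0"
  shows "smoothness_modulus p S u t = ennreal_power (modulus_power p S u t) (1 / p)"
  unfolding smoothness_modulus_def modulus_power_def increment_energy_def
  using assms by (subst ennreal_power_SUP) (auto intro!: exI[of _ 0])

lemma lp_norm_eq: "lp_norm p S u = ennreal_power (lp_energy p S u) (1 / p)"
  by (simp add: lp_norm_def lp_energy_def)

text \<open>Translations preserve null sets.\<close>

lemma AE_lebesgue_translate:
  fixes P :: "'a::euclidean_space \<Rightarrow> bool"
  assumes "AE x in lebesgue. P x"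
  shows "AE x in lebesgue. P (x + h)"
proof -
  from assms obtain N where N: "{x. \<not> P x} \<subseteq> N" "N \<in> null_sets lebesgue"
    by (auto simp: eventually_ae_filter)
  then have "negligible ((+) (-h) ` N)"
    by (intro negligible_translation) (simp add: negligible_iff_null_sets)
  moreover have "{x. \<not> P (x + h)} \<subseteq> (+) (-h) ` N"
  proof
    fix x assume "x \<in> {x. \<not> P (x + h)}"
    then have "x + h \<in> N" using N by auto
    then have "- h + (x + h) \<in> (+) (-h) ` N" by blast
    then show "x \<in> (+) (-h) ` N" by simp
  qed
  ultimately show ?thesis
    by (auto simp: eventually_ae_filter negligible_iff_null_sets)
qed

lemma increment_energy_cong_AE:
  assumes "AE x in lebesgue. x \<in> S \<longrightarrow> u x = v x"
  shows "increment_energy p S u h = increment_energy p S v h"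
  unfolding increment_energy_def
  using assms AE_lebesgue_translate[OF assms, of h]
  by (intro nn_integral_cong_AE) (auto simp: indicator_def)

lemma lp_energy_cong_AE:
  assumes "AE x in lebesgue. x \<in> S \<longrightarrow> u x = v x"
  shows "lp_energy p S u = lp_energy p S v"
  unfolding lp_energy_def using assms
  by (intro nn_integral_cong_AE) (auto simp: indicator_def)

lemma besov_norm_cong_AE:
  assumes "AE x in lebesgue. x \<in> S \<longrightarrow> u x = v x"
  shows "besov_norm s p q S u = besov_norm s p q S v"
proof -
  have "smoothness_modulus p S u = smoothness_modulus p S v"
    unfolding smoothness_modulus_def increment_energy_def[symmetric]
      increment_energy_cong_AE[OF assms] ..
  then show ?thesis
    by (simp add: besov_norm_def besov_seminorm_def lp_norm_eq lp_energy_cong_AE[OF assms])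
qed

lemma dyadic_scale_le:
  assumes "0 < t" "t \<le> dyadic l0"
  obtains l where "l \<ge> l0" "dyadic (Suc l) < t" "t \<le> dyadic l"
proof -
  define l where "l = nat \<lfloor>- log 2 t\<rfloor>"
  have "log 2 t \<le> - real l0" using assms by (subst log_le_iff) auto
  then have "l \<ge> l0" "real l \<le> - log 2 t" "- log 2 t < real l + 1"
    unfolding l_def by linarith+
  then show thesis
    using assms by (intro that[of l]) (auto simp: powr_le_iff powr_less_iff le_log_iff[symmetric] less_log_iff[symmetric] log_le_iff[symmetric] log_less_iff[symmetric])
qed

lemma dyadic_scale_less:
  assumes "0 < t" "t < (1::real)"
  obtains l where "dyadic (Suc l) \<le> t" "t < dyadic l"
proof -
  define l where "l = nat \<lceil>- log 2 t\<rceil> - 1"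
  have "log 2 t < 0" using assms by simp
  then have "real l < - log 2 t" "- log 2 t \<le> real l + 1"
    unfolding l_def by linarith+
  then show thesis
    using assms by (intro that[of l]) (auto simp: le_log_iff[symmetric] less_log_iff[symmetric] log_le_iff[symmetric] log_less_iff[symmetric])
qed

text \<open>The half-open intervals between consecutive dyadic scales are disjoint, so that a step function on
them is a series with at most one nonzero term.\<close>

lemma suminf_dyadic_indicator:
  fixes c :: "nat \<Rightarrow> ennreal"
  assumes "dyadic (Suc l) \<le> t" "t < dyadic l"
  shows "(\<Sum>l. c l * indicator {dyadic (Suc l)..<dyadic l} t) = c l"
proof -
  have "indicator {dyadic (Suc i)..<dyadic i} t = (0::ennreal)" if "i \<noteq> l" for i
  proof -
    have "\<not> (dyadic (Suc i) \<le> t \<and> t < dyadic i)"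
    proof
      assume *: "dyadic (Suc i) \<le> t \<and> t < dyadic i"
      then have "dyadic (Suc i) < dyadic l" "dyadic (Suc l) < dyadic i"
        using assms by linarith+
      then have "real (Suc i) > real l" "real (Suc l) > real i" by simp_all
      then show False using that by linarith
    qed
    then show ?thesis by (auto simp: indicator_def)
  qed
  then have "(\<Sum>l. c l * indicator {dyadic (Suc l)..<dyadic l} t)
    = (\<Sum>i\<in>{l}. c i * indicator {dyadic (Suc i)..<dyadic i} t)"
    by (intro suminf_finite) auto
  then show ?thesis using assms by (simp add: indicator_def)
qed

lemma nn_integral_dyadic:
  "(\<integral>\<^sup>+t. (\<Sum>l. c l * indicator {dyadic (Suc l)..<dyadic l} t) \<partial>lborel)
    = (\<Sum>l. c l * ennreal (dyadic (Suc l)))"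
proof -
  have "dyadic l - dyadic (Suc l) = dyadic (Suc l)" for l
    by (simp add: powr_diff powr_minus field_simps powr_add)
  moreover have "dyadic (Suc l) \<le> dyadic l" for l by simp
  ultimately show ?thesis
    by (subst nn_integral_suminf) (simp_all add: nn_integral_cmult_indicator)
qed

text \<open>Monotonicity of the nonnegative integral, applied to a step function on the dyadic intervals.\<close>

lemma dyadic_integral_ge:
  assumes "\<And>l t. dyadic (Suc l) \<le> t \<Longrightarrow> t < dyadic l \<Longrightarrow> c l \<le> f t"
  shows "(\<Sum>l. c l * ennreal (dyadic (Suc l))) \<le> (\<integral>\<^sup>+t\<in>{0<..<1}. f t \<partial>lborel)"
  unfolding nn_integral_dyadic[symmetric]
proof (rule nn_integral_mono)
  fix t :: real
  show "(\<Sum>l. c l * indicator {dyadic (Suc l)..<dyadic l} t) \<le> f t * indicator {0<..<1} t"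
  proof (cases "t \<in> {0<..<1}")
    case True
    then obtain l where "dyadic (Suc l) \<le> t" "t < dyadic l"
      using dyadic_scale_less[of t] by auto
    with suminf_dyadic_indicator[OF this, of c] assms[OF this] True show ?thesis by simp
  next
    case False
    have "indicator {dyadic (Suc l)..<dyadic l} t = (0::ennreal)" for l
    proof -
      have "(0::real) < dyadic (Suc l)" "dyadic l \<le> (1::real)"
        using two_powr_neg_le_one[of "real l"] by auto
      then have "\<not> (dyadic (Suc l) \<le> t \<and> t < dyadic l)"
        using False unfolding greaterThanLessThan_iff by linarith
      then show ?thesis by (auto simp: indicator_def)
    qed
    then show ?thesis by simp
  qed
qed

lemma dyadic_integral_le:
  assumes "\<And>l t. dyadic (Suc l) \<le> t \<Longrightarrow> t < dyadic l \<Longrightarrow> f t \<le> c l"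
  shows "(\<integral>\<^sup>+t\<in>{0<..<1}. f t \<partial>lborel) \<le> (\<Sum>l. c l * ennreal (dyadic (Suc l)))"
  unfolding nn_integral_dyadic[symmetric]
proof (rule nn_integral_mono)
  fix t :: real
  show "f t * indicator {0<..<1} t \<le> (\<Sum>l. c l * indicator {dyadic (Suc l)..<dyadic l} t)"
  proof (cases "t \<in> {0<..<1}")
    case True
    then obtain l where "dyadic (Suc l) \<le> t" "t < dyadic l"
      using dyadic_scale_less[of t] by auto
    with suminf_dyadic_indicator[OF this, of c] assms[OF this] True show ?thesis by simp
  qed simp
qed

text \<open>The dyadic coefficients of the Besov norm. Only scales \<open>2\<^sup>-\<^sup>l < 1\<close> enter the seminorm, and the free slot
\<open>l = 0\<close> stores the \<open>L\<^sup>p\<close> part.\<close>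

definition dyadic_energy :: "real \<Rightarrow> real \<Rightarrow> (real^'n) set \<Rightarrow> (real^'n \<Rightarrow> real) \<Rightarrow> nat \<Rightarrow> ennreal" where
  "dyadic_energy s p S u l = (if l = 0 then lp_energy p S u
     else ennreal (2 powr (real l * s * p)) * modulus_power p S u (dyadic l))"

text \<open>On \<open>[2\<^sup>-\<^sup>l\<^sup>-\<^sup>1, 2\<^sup>-\<^sup>l)\<close> the increasing function \<open>\<omega>\<close> is at least its value at the left end, and the other factors
of the integrand vary by a bounded factor; so the integral dominates the dyadic sum.\<close>

lemma seq_norm_dyadic_energy_le:
  assumes "s > 0" "p > 0" "q > 0"
  obtains C where "C \<ge> 0"
    "\<And>S (u::real^'n \<Rightarrow> real). seq_norm p q (dyadic_energy s p S u) \<le> ennreal C * besov_norm s p q S u"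
proof (cases "q = \<infinity>")
  case True
  have "seq_norm p q (dyadic_energy s p S u) \<le> ennreal 1 * besov_norm s p q S u" for S and u :: "real^'n \<Rightarrow> real"
  proof -
    have "ennreal_power (dyadic_energy s p S u l) (1/p) \<le> besov_norm s p q S u" for l
    proof (cases "l = 0")
      case True
      then show ?thesis by (simp add: dyadic_energy_def besov_norm_def lp_norm_eq)
    next
      case False
      define t where "t = dyadic l"
      have t: "0 < t" "t < 1" using False by (auto simp: t_def powr_less_one)
      have "t powr (- s) = (2 powr (real l * s * p)) powr (1/p)"
        using assms by (simp add: t_def powr_powr)
      then have "ennreal_power (dyadic_energy s p S u l) (1/p) = ennreal (t powr (- s)) * smoothness_modulus p S u t"
        using False assms t
        by (simp add: dyadic_energy_def ennreal_power_mult ennreal_power_ennreal smoothness_modulus_eq t_def)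
      also have "\<dots> \<le> besov_seminorm s p q S u"
        unfolding besov_seminorm_def using True t by (auto intro!: SUP_upper)
      finally show ?thesis by (simp add: besov_norm_def add_increasing)
    qed
    then show ?thesis by (simp add: seq_norm_def True SUP_least)
  qed
  then show thesis by (intro that[of 1]) auto
next
  case False
  define Q where "Q = enn2real q"
  have Q: "Q > 0" using assms False by (simp add: Q_def enn2real_positive_iff top.not_eq_extremum)
  define D where "D = 2 powr (s * Q + 1)"
  define C where "C = 2 powr (1 / Q) * max 1 (D powr (1/Q))"
  have "seq_norm p q (dyadic_energy s p S u) \<le> ennreal C * besov_norm s p q S u" for S and u :: "real^'n \<Rightarrow> real"
  proof -
    define Y where "Y = dyadic_energy s p S u"
    define f where "f t = ennreal_power (ennreal (t powr (- s)) * smoothness_modulus p S u t) Q * ennreal (1 / t)" for t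
    define I where "I = (\<integral>\<^sup>+t\<in>{0<..<1}. f t \<partial>lborel)"
    define c where "c l = ennreal (2 powr (real l * s * Q + real l)) * ennreal_power (modulus_power p S u (dyadic (Suc l))) (Q / p)" for l
    have "(\<Sum>l. c l * ennreal (dyadic (Suc l))) \<le> I"
      unfolding I_def
    proof (rule dyadic_integral_ge)
      fix l t assume t: "dyadic (Suc l) \<le> t" "t < dyadic l"
      have t0: "t > 0" using t(1) by (rule less_le_trans[rotated]) simp
      have "2 powr (real l * s) \<le> t powr (- s)"
      proof -
        have "(dyadic l) powr (- s) \<le> t powr (- s)"
          using t t0 assms by (intro powr_mono2') auto
        then show ?thesis by (simp add: powr_powr)
      qed
      then have "(2 powr (real l * s)) powr Q \<le> (t powr (- s)) powr Q"
        using Q by (intro powr_mono2) auto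
      then have 1: "2 powr (real l * s * Q) \<le> (t powr (- s)) powr Q" by (simp add: powr_powr)
      have 2: "2 powr (real l) \<le> 1 / t"
      proof -
        have "t \<le> dyadic l" using t by simp
        then show ?thesis using t0 by (simp add: powr_minus field_simps)
      qed
      have "c l = (ennreal (2 powr (real l * s * Q)) * ennreal_power (modulus_power p S u (dyadic (Suc l))) (Q / p)) * ennreal (2 powr real l)"
        by (simp add: c_def powr_add ennreal_mult mult_ac)
      also have "\<dots> \<le> (ennreal ((t powr (- s)) powr Q) * ennreal_power (modulus_power p S u t) (Q / p)) * ennreal (1 / t)"
        using 1 2 Q assms t by (intro mult_mono ennreal_leI ennreal_power_mono modulus_power_mono) auto
      also have "\<dots> = f t"
        using Q assms t0 by (simp add: f_def smoothness_modulus_eq ennreal_power_mult ennreal_power_power ennreal_power_ennreal)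
      finally show "c l \<le> f t" .
    qed
    moreover have "c l * ennreal (dyadic (Suc l)) = ennreal (1 / D) * ennreal_power (Y (Suc l)) (Q / p)" for l
    proof -
      have "2 powr (real l * s * Q + real l) * dyadic (Suc l) = 1 / D * (2 powr (real (Suc l) * s * p)) powr (Q / p)"
        using assms unfolding D_def
        by (simp add: powr_powr powr_minus_divide[symmetric] powr_add[symmetric]) (simp add: algebra_simps)
      then have *: "ennreal (2 powr (real l * s * Q + real l)) * ennreal (dyadic (Suc l))
          = ennreal (1 / D) * ennreal ((2 powr (real (Suc l) * s * p)) powr (Q / p))"
        by (simp only: ennreal_mult[symmetric] powr_ge_zero D_def divide_nonneg_nonneg zero_le_one)
      have "ennreal_power (Y (Suc l)) (Q / p) = ennreal ((2 powr (real (Suc l) * s * p)) powr (Q / p))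
         * ennreal_power (modulus_power p S u (dyadic (Suc l))) (Q / p)"
        using Q assms unfolding Y_def dyadic_energy_def
        by (simp only: ennreal_power_mult ennreal_power_ennreal divide_pos_pos powr_ge_zero nat.distinct if_False)
      moreover have "a * M * b = d * (e * M)" if "a * b = d * e" for a b d e M :: ennreal
        using that by (metis mult.assoc mult.commute)
      ultimately show ?thesis
        unfolding c_def using * by presburger
    qed
    ultimately have "ennreal (1 / D) * (\<Sum>l. ennreal_power (Y (Suc l)) (Q / p)) \<le> I" by simp
    then have "ennreal D * (ennreal (1 / D) * (\<Sum>l. ennreal_power (Y (Suc l)) (Q / p))) \<le> ennreal D * I"
      by (rule mult_left_mono) simp
    moreover have "ennreal D * ennreal (1 / D) = 1"
      by (simp add: D_def flip: ennreal_mult)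
    ultimately have sum: "(\<Sum>l. ennreal_power (Y (Suc l)) (Q / p)) \<le> ennreal D * I"
      by (metis mult.assoc mult_1)
    have "(\<Sum>l. ennreal_power (Y l) (Q / p)) = (\<Sum>l. ennreal_power (Y (l + 1)) (Q / p)) + (\<Sum>l<1. ennreal_power (Y l) (Q / p))"
      by (rule suminf_offset) (rule summableI)
    also have "\<dots> \<le> ennreal D * I + ennreal_power (lp_energy p S u) (Q / p)"
      using sum by (simp add: Y_def dyadic_energy_def add_right_mono)
    finally have "ennreal_power (\<Sum>l. ennreal_power (Y l) (Q / p)) (1 / Q)
       \<le> ennreal_power (ennreal D * I + ennreal_power (lp_energy p S u) (Q / p)) (1 / Q)"
      using Q by (intro ennreal_power_mono) auto
    also have "\<dots> \<le> ennreal (2 powr (1/Q)) * (ennreal_power (ennreal D * I) (1/Q) + ennreal_power (ennreal_power (lp_energy p S u) (Q / p)) (1/Q))"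
      using Q by (intro ennreal_power_add_le) auto
    also have "\<dots> = ennreal (2 powr (1/Q)) * (ennreal (D powr (1/Q)) * besov_seminorm s p q S u + lp_norm p S u)"
      using Q assms False by (simp add: ennreal_power_mult ennreal_power_ennreal ennreal_power_power D_def
          besov_seminorm_def I_def f_def Q_def lp_norm_eq)
    also have "\<dots> \<le> ennreal (2 powr (1/Q)) * (ennreal (max 1 (D powr (1/Q))) * besov_seminorm s p q S u + ennreal (max 1 (D powr (1/Q))) * lp_norm p S u)"
    proof (intro mult_left_mono add_mono mult_right_mono ennreal_leI)
      have "1 * lp_norm p S u \<le> ennreal (max 1 (D powr (1/Q))) * lp_norm p S u"
        by (intro mult_right_mono) (auto simp: ennreal_1[symmetric] simp del: ennreal_1 intro!: ennreal_leI)
      then show "lp_norm p S u \<le> ennreal (max 1 (D powr (1/Q))) * lp_norm p S u" by simp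
    qed auto
    also have "\<dots> = ennreal C * besov_norm s p q S u"
      by (simp add: C_def besov_norm_def ennreal_mult distrib_left mult_ac add.commute)
    finally show ?thesis using False by (simp add: seq_norm_def Q_def Y_def)
  qed
  then show thesis by (intro that[of C]) (auto simp: C_def)
qed

text \<open>The reverse comparison uses the value of \<open>\<omega>\<close> at the right end of each dyadic interval; this is why the
scale \<open>2\<^sup>0 = 1\<close> appears.\<close>

lemma besov_seminorm_le_seq_norm:
  assumes "s > 0" "p > 0" "q > 0"
  shows "besov_seminorm s p q S u
    \<le> ennreal (2 powr s) * seq_norm p q (\<lambda>k. ennreal (2 powr (real k * s * p)) * modulus_power p S u (dyadic k))"
    (is "_ \<le> _ * seq_norm p q ?X")
proof -
  have scale: "t powr (- s) \<le> 2 powr s * 2 powr (real l * s)" if "dyadic (Suc l) \<le> t" for t l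
  proof -
    have "t powr (- s) \<le> (dyadic (Suc l)) powr (- s)"
      using that assms by (intro powr_mono2') auto
    also have "\<dots> = 2 powr s * 2 powr (real l * s)"
      by (simp add: powr_powr powr_add[symmetric] algebra_simps)
    finally show ?thesis .
  qed
  show ?thesis
  proof (cases "q = \<infinity>")
    case True
    have "ennreal (t powr (- s)) * smoothness_modulus p S u t \<le> ennreal (2 powr s) * seq_norm p q ?X"
      if t: "t \<in> {0<..<1}" for t
    proof -
      obtain l where l: "dyadic (Suc l) \<le> t" "t < dyadic l"
        using dyadic_scale_less[of t] t by auto
      have "ennreal (t powr (- s)) * smoothness_modulus p S u t
        \<le> ennreal (2 powr s * 2 powr (real l * s)) * ennreal_power (modulus_power p S u (dyadic l)) (1/p)"
        using l scale[OF l(1)] t assms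
        by (auto simp: smoothness_modulus_eq intro!: mult_mono ennreal_leI ennreal_power_mono modulus_power_mono)
      also have "\<dots> = ennreal (2 powr s) * ennreal_power (?X l) (1/p)"
        using assms by (simp add: ennreal_power_mult ennreal_power_ennreal powr_powr ennreal_mult mult.assoc)
      also have "\<dots> \<le> ennreal (2 powr s) * seq_norm p q ?X"
        unfolding seq_norm_def using True by (auto intro!: mult_left_mono SUP_upper)
      finally show ?thesis .
    qed
    then show ?thesis using True by (subst besov_seminorm_def) (auto intro!: SUP_least)
  next
    case False
    define Q where "Q = enn2real q"
    have Q: "Q > 0" using assms False by (simp add: Q_def enn2real_positive_iff top.not_eq_extremum)
    define f where "f t = ennreal_power (ennreal (t powr (- s)) * smoothness_modulus p S u t) Q * ennreal (1 / t)" for t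
    define c where "c l = (ennreal (2 powr (s * Q)) * ennreal_power (?X l) (Q / p)) * ennreal (2 powr real (Suc l))" for l
    have "(\<integral>\<^sup>+t\<in>{0<..<1}. f t \<partial>lborel) \<le> (\<Sum>l. c l * ennreal (dyadic (Suc l)))"
    proof (rule dyadic_integral_le)
      fix l t assume t: "dyadic (Suc l) \<le> t" "t < dyadic l"
      have t0: "t > 0" using t(1) by (rule less_le_trans[rotated]) simp
      have 1: "(t powr (- s)) powr Q \<le> (2 powr s * 2 powr (real l * s)) powr Q"
        using Q scale[OF t(1)] by (intro powr_mono2) auto
      have 2: "1 / t \<le> 2 powr real (Suc l)"
        using t(1) t0 unfolding powr_minus by (simp add: field_simps)
      have "f t = (ennreal ((t powr (- s)) powr Q) * ennreal_power (modulus_power p S u t) (Q / p)) * ennreal (1 / t)"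
        using Q assms t0 by (simp add: f_def smoothness_modulus_eq ennreal_power_mult ennreal_power_power ennreal_power_ennreal)
      also have "\<dots> \<le> (ennreal ((2 powr s * 2 powr (real l * s)) powr Q) * ennreal_power (modulus_power p S u (dyadic l)) (Q / p)) * ennreal (2 powr real (Suc l))"
        using 1 2 Q assms t by (intro mult_mono ennreal_leI ennreal_power_mono modulus_power_mono) auto
      also have "\<dots> = c l"
        using Q assms by (simp add: c_def ennreal_power_mult ennreal_power_ennreal powr_powr powr_mult ennreal_mult mult_ac)
      finally show "f t \<le> c l" .
    qed
    also have "\<dots> = (\<Sum>l. ennreal (2 powr (s * Q)) * ennreal_power (?X l) (Q / p))"
    proof (rule suminf_cong)
      fix l
      have "ennreal (2 powr real (Suc l)) * ennreal (dyadic (Suc l)) = 1"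
        by (simp flip: ennreal_mult powr_add)
      then show "c l * ennreal (dyadic (Suc l)) = ennreal (2 powr (s * Q)) * ennreal_power (?X l) (Q / p)"
        unfolding c_def by (simp add: mult.assoc)
    qed
    also have "\<dots> = ennreal (2 powr (s * Q)) * (\<Sum>l. ennreal_power (?X l) (Q / p))" by simp
    finally have "besov_seminorm s p q S u \<le> ennreal_power (ennreal (2 powr (s * Q)) * (\<Sum>l. ennreal_power (?X l) (Q / p))) (1 / Q)"
      using False Q by (simp add: besov_seminorm_def f_def Q_def ennreal_power_mono)
    also have "\<dots> = ennreal (2 powr s) * seq_norm p q ?X"
      using False Q by (simp add: seq_norm_def Q_def ennreal_power_mult ennreal_power_ennreal powr_powr)
    finally show ?thesis .
  qed
qed

text \<open>The form in which Besov norms are bounded from above: it suffices to control the dyadic moduli by a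
sequence \<open>Y\<close> up to the geometric kernel, with a constant that is independent of the set and the
function.\<close>

lemma besov_norm_le_seq_norm:
  assumes "s > 0" "p > 0" "q > 0" "\<eta> > 0"
  obtains C where "C \<ge> 0"
    "\<And>S (u::real^'n \<Rightarrow> real) Y.
       lp_energy p S u \<le> (\<Sum>l. ennreal (geom_kernel \<eta> 0 l) * Y l) \<Longrightarrow>
       (\<And>k. ennreal (2 powr (real k * s * p)) * modulus_power p S u (dyadic k) \<le> (\<Sum>l. ennreal (geom_kernel \<eta> k l) * Y l)) \<Longrightarrow>
       besov_norm s p q S u \<le> ennreal C * seq_norm p q Y"
proof -
  obtain C where C: "C \<ge> 0"
    "\<And>X Y. (\<And>k. X k \<le> (\<Sum>l. ennreal (geom_kernel \<eta> k l) * Y l)) \<Longrightarrow> seq_norm p q X \<le> ennreal C * seq_norm p q Y"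
    using seq_norm_geom_kernel_le[OF assms(2-4)] by metis
  show thesis
  proof (rule that[of "C + 2 powr s * C"])
    show "C + 2 powr s * C \<ge> 0" using C by simp
    fix S and u :: "real^'n \<Rightarrow> real" and Y
    assume 1: "lp_energy p S u \<le> (\<Sum>l. ennreal (geom_kernel \<eta> 0 l) * Y l)"
      and 2: "\<And>k. ennreal (2 powr (real k * s * p)) * modulus_power p S u (dyadic k) \<le> (\<Sum>l. ennreal (geom_kernel \<eta> k l) * Y l)"
    have "lp_norm p S u = seq_norm p q (\<lambda>k. if k = 0 then lp_energy p S u else 0)"
      using assms by (simp add: seq_norm_single lp_norm_eq)
    also have "\<dots> \<le> ennreal C * seq_norm p q Y"
      using 1 by (intro C(2)) auto
    finally have 3: "lp_norm p S u \<le> ennreal C * seq_norm p q Y" .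
    have "besov_seminorm s p q S u \<le> ennreal (2 powr s) * (ennreal C * seq_norm p q Y)"
      by (rule order_trans[OF besov_seminorm_le_seq_norm[OF assms(1-3)]]) (intro mult_left_mono C(2) 2, simp)
    with 3 show "besov_norm s p q S u \<le> ennreal (C + 2 powr s * C) * seq_norm p q Y"
      unfolding besov_norm_def using C(1)
      by (subst ennreal_plus) (auto simp: ennreal_mult distrib_right mult.assoc intro: add_mono)
  qed
qed

section \<open>Increments averaged over balls\<close>

lemma emeasure_ball_cart: "r \<ge> 0 \<Longrightarrow> emeasure lborel (ball (c::real^'n) r) = ennreal (unit_ball_vol (real CARD('n)) * r ^ CARD('n))"
  by (simp add: emeasure_ball)

lemma unit_ball_vol_card_pos [simp]: "unit_ball_vol (real CARD('n::finite)) > 0"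
  by (rule unit_ball_vol_pos) simp

lemma measure_ball_cart: "r \<ge> 0 \<Longrightarrow> measure lebesgue (ball (c::real^'n) r) = unit_ball_vol (real CARD('n)) * r ^ CARD('n)"
  by (simp add: measure_def emeasure_ball_cart)

lemma increment_energy_lborel:
  "increment_energy p S u h
    = (\<integral>\<^sup>+x. indicator S x * indicator S (x + h) * epow p (u (x + h) - u x) \<partial>lborel)"
  unfolding increment_energy_def nn_integral_completion
  by (intro nn_integral_cong) (auto simp: indicator_def)

lemma lp_energy_lborel:
  "lp_energy p S u = (\<integral>\<^sup>+x. indicator S x * epow p (u x) \<partial>lborel)"
  unfolding lp_energy_def nn_integral_completion by (simp add: mult.commute)

lemma nn_integral_lborel_translate:
  fixes f :: "'a::euclidean_space \<Rightarrow> ennreal"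
  assumes [measurable]: "f \<in> borel_measurable borel"
  shows "(\<integral>\<^sup>+y. f (x + y) \<partial>lborel) = (\<integral>\<^sup>+y. f y \<partial>lborel)"
proof -
  have "(\<integral>\<^sup>+y. f y \<partial>lborel) = (\<integral>\<^sup>+y. f y \<partial>distr lborel borel ((+) x))"
    by (simp add: lborel_distr_plus)
  also have "\<dots> = (\<integral>\<^sup>+y. f (x + y) \<partial>lborel)"
    by (subst nn_integral_distr) auto
  finally show ?thesis by simp
qed

lemma measurable_mem_ball [measurable (raw)]:
  fixes f g :: "'b \<Rightarrow> 'a::{second_countable_topology, metric_space}"
  assumes [measurable]: "f \<in> borel_measurable M" "g \<in> borel_measurable M" "r \<in> borel_measurable M"
  shows "Measurable.pred M (\<lambda>x. f x \<in> ball (g x) (r x))"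
  unfolding mem_ball by measurable

text \<open>Substituting \<open>y = x + h\<close> turns the inner integral into one over \<open>h\<close> in a ball; after exchanging the
integrals, each \<open>h\<close> contributes at most the modulus.\<close>

lemma double_integral_le_modulus:
  fixes u :: "real^'n \<Rightarrow> real"
  assumes [measurable]: "u \<in> borel_measurable borel" "S \<in> sets borel" and "r \<ge> 0"
  shows "(\<integral>\<^sup>+x. \<integral>\<^sup>+y. indicator S x * indicator S y * indicator (ball x r) y * epow p (u x - u y) \<partial>lborel \<partial>lborel)
     \<le> ennreal (unit_ball_vol (real CARD('n)) * r ^ CARD('n)) * modulus_power p S u r"
proof -
  have "(\<integral>\<^sup>+x. \<integral>\<^sup>+y. indicator S x * indicator S y * indicator (ball x r) y * epow p (u x - u y) \<partial>lborel \<partial>lborel)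
     = (\<integral>\<^sup>+x. \<integral>\<^sup>+h. indicator S x * indicator S (x + h) * indicator (ball 0 r) h * epow p (u (x + h) - u x) \<partial>lborel \<partial>lborel)"
  proof (rule nn_integral_cong)
    fix x :: "real^'n"
    show "(\<integral>\<^sup>+y. indicator S x * indicator S y * indicator (ball x r) y * epow p (u x - u y) \<partial>lborel)
      = (\<integral>\<^sup>+h. indicator S x * indicator S (x + h) * indicator (ball 0 r) h * epow p (u (x + h) - u x) \<partial>lborel)"
      by (subst nn_integral_lborel_translate[of _ x, symmetric])
        (auto intro!: nn_integral_cong simp: indicator_def dist_norm abs_minus_commute)
  qed
  also have "\<dots> = (\<integral>\<^sup>+h. \<integral>\<^sup>+x. indicator S x * indicator S (x + h) * indicator (ball 0 r) h * epow p (u (x + h) - u x) \<partial>lborel \<partial>lborel)"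
    by (rule lborel_pair.Fubini') measurable
  also have "\<dots> = (\<integral>\<^sup>+h. indicator (ball 0 r) h * increment_energy p S u h \<partial>lborel)"
    unfolding increment_energy_lborel
    by (intro nn_integral_cong, subst nn_integral_cmult[symmetric]) (auto simp: mult_ac)
  also have "\<dots> \<le> (\<integral>\<^sup>+h. modulus_power p S u r * indicator (ball (0::real^'n) r) h \<partial>lborel)"
    by (intro nn_integral_mono) (auto simp: indicator_def intro!: increment_energy_le_modulus)
  also have "\<dots> = modulus_power p S u r * emeasure lborel (ball (0::real^'n) r)"
    by (rule nn_integral_cmult_indicator) simp
  finally show ?thesis using assms by (simp add: emeasure_ball_cart mult.commute)
qed

section \<open>A transition between two sets costs smoothness\<close>

text \<open>If \<open>v\<close> were far from \<open>c\<close> on more than half of \<open>ball y \<rho>\<close> for every \<open>y\<close> in \<open>A\<close>, then all pairs formed by a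
point of \<open>A\<close> and a far point of its ball would contribute to the double integral at scale \<open>\<rho>\<close>, and the
modulus at that scale would be at least a multiple of \<open>m\<close>.\<close>

lemma near_constant_on_half_ball:
  fixes v :: "real^'n \<Rightarrow> real"
  assumes [measurable]: "v \<in> borel_measurable borel" "A \<in> sets borel"
    and p: "p > 0" and \<rho>: "\<rho> > 0" and A: "\<And>y. y \<in> A \<Longrightarrow> v y = c" "ennreal m \<le> emeasure lborel A" and m: "m \<ge> 0"
    and not: "\<not> ennreal m \<le> ennreal (2 * 4 powr p) * modulus_power p UNIV v \<rho>"
  obtains y where "y \<in> A"
    "ennreal (unit_ball_vol (real CARD('n)) * \<rho> ^ CARD('n) / 2) \<le> emeasure lborel {z \<in> ball y \<rho>. \<bar>v z - c\<bar> < 1/4}"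
proof (rule ccontr)
  note witness = that
  assume neg: "\<not> thesis"
  define b where "b = unit_ball_vol (real CARD('n)) * \<rho> ^ CARD('n)"
  have b: "b > 0" using \<rho> by (simp add: b_def)
  define k where "k = (1/4) powr p * b / 2"
  have inner: "ennreal k \<le> (\<integral>\<^sup>+z. indicator UNIV y * indicator UNIV z * indicator (ball y \<rho>) z * epow p (v y - v z) \<partial>lborel)"
    if y: "y \<in> A" for y
  proof -
    let ?G = "{z \<in> ball y \<rho>. \<bar>v z - c\<bar> < 1/4}" and ?F = "{z \<in> ball y \<rho>. \<not> \<bar>v z - c\<bar> < 1/4}"
    have [measurable]: "?G \<in> sets borel" "?F \<in> sets borel" by measurable
    have "emeasure lborel (ball y \<rho>) = emeasure lborel ?G + emeasure lborel ?F"
      by (subst plus_emeasure) (auto intro!: arg_cong[where f="emeasure lborel"])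
    moreover have "emeasure lborel ?G < ennreal (b / 2)"
      using neg witness[OF y] unfolding b_def not_le[symmetric] by blast
    moreover have "emeasure lborel (ball y \<rho>) = ennreal b"
      using \<rho> by (simp add: emeasure_ball_cart b_def)
    ultimately have F: "ennreal (b / 2) \<le> emeasure lborel ?F"
      using b by (cases "emeasure lborel ?G"; cases "emeasure lborel ?F") (auto simp flip: ennreal_plus simp: ennreal_less_iff)
    have "ennreal k = ennreal ((1/4) powr p) * ennreal (b/2)"
      using b by (simp add: k_def flip: ennreal_mult)
    also have "\<dots> \<le> ennreal ((1/4) powr p) * emeasure lborel ?F"
      by (intro mult_left_mono F) simp
    also have "\<dots> = (\<integral>\<^sup>+z. ennreal ((1/4) powr p) * indicator ?F z \<partial>lborel)"
      by (rule nn_integral_cmult_indicator[symmetric]) simp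
    also have "\<dots> \<le> (\<integral>\<^sup>+z. indicator UNIV y * indicator UNIV z * indicator (ball y \<rho>) z * epow p (v y - v z) \<partial>lborel)"
      using A(1)[OF y] p by (intro nn_integral_mono) (auto simp: indicator_def abs_minus_commute intro!: ennreal_leI powr_mono2)
    finally show ?thesis .
  qed
  have "ennreal k * ennreal m \<le> ennreal k * emeasure lborel A"
    by (intro mult_left_mono A) simp
  also have "\<dots> = (\<integral>\<^sup>+y. ennreal k * indicator A y \<partial>lborel)"
    by (rule nn_integral_cmult_indicator[symmetric]) simp
  also have "\<dots> \<le> (\<integral>\<^sup>+y. \<integral>\<^sup>+z. indicator UNIV y * indicator UNIV z * indicator (ball y \<rho>) z * epow p (v y - v z) \<partial>lborel \<partial>lborel)"
    using inner by (intro nn_integral_mono) (auto simp: indicator_def)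
  also have "\<dots> \<le> ennreal b * modulus_power p UNIV v \<rho>"
    unfolding b_def using \<rho> by (intro double_integral_le_modulus) auto
  finally have le: "ennreal k * ennreal m \<le> ennreal b * modulus_power p UNIV v \<rho>" .
  show False
  proof (cases "modulus_power p UNIV v \<rho>")
    case (real \<theta>)
    then have "k * m \<le> b * \<theta>" using le b m by (simp add: k_def ennreal_le_iff flip: ennreal_mult)
    then have "m \<le> 2 * 4 powr p * \<theta>"
      using b by (simp add: k_def powr_divide field_simps)
    then show False using not real by (simp add: ennreal_leI flip: ennreal_mult)
  next
    case top
    then show False using not by (simp add: ennreal_mult_top)
  qed
qed

text \<open>Either the modulus at the small scale \<open>\<rho>\<close> is large, or \<open>v\<close> exceeds \<open>3/4\<close> on half of a small ball near
\<open>A\<close> and stays below \<open>1/4\<close> on half of a small ball near \<open>Z\<close>. Then the pairs from these two halves make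
the modulus at the large scale \<open>4 r\<close> large.\<close>

lemma modulus_capacity_bound:
  fixes v :: "real^'n \<Rightarrow> real"
  assumes [measurable]: "v \<in> borel_measurable borel" "A \<in> sets borel" "Z \<in> sets borel"
    and p: "p > 0" and \<rho>: "0 < \<rho>" "\<rho> \<le> r"
    and A: "\<And>y. y \<in> A \<Longrightarrow> v y = 1" "A \<subseteq> ball x r" "ennreal m \<le> emeasure lborel A"
    and Z: "\<And>y. y \<in> Z \<Longrightarrow> v y = 0" "Z \<subseteq> ball x r" "ennreal m \<le> emeasure lborel Z"
    and m: "m \<ge> 0"
  shows "ennreal m \<le> ennreal (2 * 4 powr p) * modulus_power p UNIV v \<rho>
    \<or> ennreal (unit_ball_vol (real CARD('n)) * (\<rho> ^ CARD('n))\<^sup>2)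
        \<le> ennreal (4 * 2 powr p * (4 * r) ^ CARD('n)) * modulus_power p UNIV v (4 * r)"
proof (cases "ennreal m \<le> ennreal (2 * 4 powr p) * modulus_power p UNIV v \<rho>")
  case False
  note not = this
  let ?n = "CARD('n)" and ?\<omega> = "unit_ball_vol (real CARD('n))"
  define b where "b = ?\<omega> * \<rho> ^ ?n"
  have b: "b > 0" using \<rho> by (simp add: b_def)
  have r: "r > 0" using \<rho> by simp
  obtain y where y: "y \<in> A" "ennreal (b / 2) \<le> emeasure lborel {z \<in> ball y \<rho>. \<bar>v z - 1\<bar> < 1/4}"
    using near_constant_on_half_ball[of v A p \<rho> 1 m] A \<rho> p m not unfolding b_def by auto
  obtain w where w: "w \<in> Z" "ennreal (b / 2) \<le> emeasure lborel {z \<in> ball w \<rho>. \<bar>v z - 0\<bar> < 1/4}"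
    using near_constant_on_half_ball[of v Z p \<rho> 0 m] Z \<rho> p m not unfolding b_def by auto
  define G where "G = {z \<in> ball y \<rho>. \<bar>v z - 1\<bar> < 1/4}"
  define H where "H = {z \<in> ball w \<rho>. \<bar>v z - 0\<bar> < 1/4}"
  have [measurable]: "G \<in> sets borel" "H \<in> sets borel" unfolding G_def H_def by measurable
  have point: "ennreal ((1/2) powr p) * indicator G a * indicator H e
      \<le> indicator UNIV a * indicator UNIV e * indicator (ball a (4 * r)) e * epow p (v a - v e)" for a e
  proof (cases "a \<in> G \<and> e \<in> H")
    case True
    then have "\<bar>v a - 1\<bar> < 1/4" "\<bar>v e\<bar> < 1/4" "dist y a < \<rho>" "dist w e < \<rho>" by (auto simp: G_def H_def)
    moreover have "dist x y < r" "dist x w < r" using y w A Z by auto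
    ultimately have "1/2 \<le> \<bar>v a - v e\<bar>" "dist a e < 4 * r"
      using \<rho> dist_triangle[of a e y] dist_triangle[of y e w] dist_triangle[of y w x]
        dist_commute[of a y] dist_commute[of y x] by linarith+
    then show ?thesis using p by (auto simp: indicator_def intro!: ennreal_leI powr_mono2)
  qed (auto simp: indicator_def)
  have "ennreal ((1/2) powr p) * ennreal (b/2) * ennreal (b/2) \<le> ennreal ((1/2) powr p) * emeasure lborel H * emeasure lborel G"
    using y w by (intro mult_mono) (auto simp: G_def H_def)
  also have "\<dots> = (\<integral>\<^sup>+a. \<integral>\<^sup>+e. ennreal ((1/2) powr p) * indicator G a * indicator H e \<partial>lborel \<partial>lborel)"
    by (simp add: nn_integral_cmult nn_integral_multc mult_ac)
  also have "\<dots> \<le> (\<integral>\<^sup>+a. \<integral>\<^sup>+e. indicator UNIV a * indicator UNIV e * indicator (ball a (4 * r)) e * epow p (v a - v e) \<partial>lborel \<partial>lborel)"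
    by (intro nn_integral_mono point)
  also have "\<dots> \<le> ennreal (?\<omega> * (4 * r) ^ ?n) * modulus_power p UNIV v (4 * r)"
    using r by (intro double_integral_le_modulus) auto
  finally have le: "ennreal ((1/2) powr p) * ennreal (b/2) * ennreal (b/2)
     \<le> ennreal (?\<omega> * (4 * r) ^ ?n) * modulus_power p UNIV v (4 * r)" .
  have "ennreal (?\<omega> * (\<rho> ^ ?n)\<^sup>2) \<le> ennreal (4 * 2 powr p * (4 * r) ^ ?n) * modulus_power p UNIV v (4 * r)"
  proof (cases "modulus_power p UNIV v (4 * r)")
    case (real \<theta>)
    have "(1/2) powr p * (b/2) * (b/2) \<le> ?\<omega> * (4 * r) ^ ?n * \<theta>"
      using le real b r unfolding real(2) by (simp add: ennreal_le_iff less_imp_le flip: ennreal_mult)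
    then have "?\<omega> * (?\<omega> * (\<rho> ^ ?n)\<^sup>2) \<le> ?\<omega> * (4 * 2 powr p * (4 * r) ^ ?n * \<theta>)"
      unfolding b_def by (simp add: powr_divide field_simps power2_eq_square)
    then have "?\<omega> * (\<rho> ^ ?n)\<^sup>2 \<le> 4 * 2 powr p * (4 * r) ^ ?n * \<theta>"
      using mult_le_cancel_left_pos[OF unit_ball_vol_card_pos] by blast
    then show ?thesis using real r by (simp add: ennreal_leI flip: ennreal_mult)
  next
    case top
    then show ?thesis using r by (simp add: ennreal_mult_top)
  qed
  then show ?thesis ..
qed simp

text \<open>The choice \<open>\<rho> = \<delta>\<^sup>a r\<close> with \<open>a = 1 / (4 n)\<close> balances the two alternatives: the first one gains the factor
\<open>\<delta>\<^sup>-\<^sup>a\<^sup>s\<^sup>p\<close> over the trivial bound \<open>\<delta>\<close>, and the second one gives \<open>\<delta>\<^sup>1\<^sup>/\<^sup>2\<close>. What matters is that the exponent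
\<open>1 - \<theta>\<close> is strictly less than 1: this makes the iteration below superlinear.\<close>

lemma density_ratio_bound:
  assumes s: "s > 0" and p: "p > 0"
  obtains C \<theta> where "C > 0" "0 < \<theta>" "\<theta> < 1"
    "\<And>(v::real^'n \<Rightarrow> real) A Z x r \<delta> Q. v \<in> borel_measurable borel \<Longrightarrow> A \<in> sets borel \<Longrightarrow> Z \<in> sets borel \<Longrightarrow>
      (\<And>y. y \<in> A \<Longrightarrow> v y = 1) \<Longrightarrow> (\<And>y. y \<in> Z \<Longrightarrow> v y = 0) \<Longrightarrow> A \<subseteq> ball x r \<Longrightarrow> Z \<subseteq> ball x r \<Longrightarrow>
      ennreal (\<delta> * (unit_ball_vol (real CARD('n)) * r ^ CARD('n))) \<le> emeasure lborel A \<Longrightarrow>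
      ennreal (\<delta> * (unit_ball_vol (real CARD('n)) * r ^ CARD('n))) \<le> emeasure lborel Z \<Longrightarrow>
      0 < \<delta> \<Longrightarrow> \<delta> \<le> 1 \<Longrightarrow> 0 < r \<Longrightarrow> r \<le> 1/8 \<Longrightarrow> Q \<ge> 0 \<Longrightarrow>
      (\<And>t. 0 < t \<Longrightarrow> t \<le> 1/2 \<Longrightarrow> modulus_power p UNIV v t \<le> ennreal (t powr (s * p) * Q)) \<Longrightarrow>
      \<delta> powr (1 - \<theta>) \<le> C * r powr (s * p - real CARD('n)) * Q"
proof -
  let ?n = "CARD('n)" and ?\<omega> = "unit_ball_vol (real CARD('n))"
  define a where "a = 1 / (4 * real ?n)"
  \<comment> \<open>The first alternative yields the exponent \<open>1 - a s p\<close>, the second one \<open>1/2\<close>.\<close>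
  define \<theta> where "\<theta> = min (1/2) (a * (s * p))"
  define C1 where "C1 = 2 * 4 powr p / ?\<omega>"
  define C2 where "C2 = 4 * 2 powr p * 4 ^ ?n * 4 powr (s * p) / ?\<omega>"
  have a: "a > 0" and an: "a * real ?n = 1/4" by (auto simp: a_def)
  have C: "C1 > 0" "C2 > 0" by (auto simp: C1_def C2_def)
  have \<theta>: "0 < \<theta>" "\<theta> < 1" using a s p by (auto simp: \<theta>_def min_def)
  show thesis
  proof (rule that[of "C1 + C2" \<theta>])
    show "C1 + C2 > 0" using C by simp
    show "0 < \<theta>" "\<theta> < 1" using \<theta> by auto
    fix v :: "real^'n \<Rightarrow> real" and A Z x and r \<delta> Q :: real
    assume meas: "v \<in> borel_measurable borel" "A \<in> sets borel" "Z \<in> sets borel"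
      and AZ: "\<And>y. y \<in> A \<Longrightarrow> v y = 1" "\<And>y. y \<in> Z \<Longrightarrow> v y = 0" "A \<subseteq> ball x r" "Z \<subseteq> ball x r"
      and m: "ennreal (\<delta> * (?\<omega> * r ^ ?n)) \<le> emeasure lborel A" "ennreal (\<delta> * (?\<omega> * r ^ ?n)) \<le> emeasure lborel Z"
      and \<delta>: "0 < \<delta>" "\<delta> \<le> 1" and r: "0 < r" "r \<le> 1/8" and Q: "Q \<ge> 0"
      and mod: "\<And>t. 0 < t \<Longrightarrow> t \<le> 1/2 \<Longrightarrow> modulus_power p UNIV v t \<le> ennreal (t powr (s * p) * Q)"
    define \<rho> where "\<rho> = \<delta> powr a * r"
    have "\<delta> powr a \<le> 1" using \<delta> a by (simp add: powr_le_one_le powr_le1)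
    then have \<rho>: "0 < \<rho>" "\<rho> \<le> r" using \<delta> r by (auto simp: \<rho>_def mult_left_le_one_le)
    define R where "R = r powr (s * p - real ?n) * Q"
    have R: "R \<ge> 0" using Q by (simp add: R_def)
    have rn: "r powr (s * p) = r powr (s * p - real ?n) * r ^ ?n"
      using r by (simp add: powr_diff powr_realpow)
    from modulus_capacity_bound[OF meas p \<rho> AZ(1,3) m(1) AZ(2,4) m(2)] \<delta> r
    have "ennreal (\<delta> * (?\<omega> * r ^ ?n)) \<le> ennreal (2 * 4 powr p) * modulus_power p UNIV v \<rho>
      \<or> ennreal (?\<omega> * (\<rho> ^ ?n)\<^sup>2) \<le> ennreal (4 * 2 powr p * (4 * r) ^ ?n) * modulus_power p UNIV v (4 * r)"
      by (simp add: less_imp_le)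
    then have "\<delta> powr (1 - \<theta>) \<le> C1 * R \<or> \<delta> powr (1 - \<theta>) \<le> C2 * R"
    proof
      assume "ennreal (\<delta> * (?\<omega> * r ^ ?n)) \<le> ennreal (2 * 4 powr p) * modulus_power p UNIV v \<rho>"
      also have "\<dots> \<le> ennreal (2 * 4 powr p) * ennreal (\<rho> powr (s * p) * Q)"
        using \<rho> r by (intro mult_left_mono mod) auto
      finally have "\<delta> * (?\<omega> * r ^ ?n) \<le> 2 * 4 powr p * (\<rho> powr (s * p) * Q)"
        using Q by (simp add: ennreal_le_iff flip: ennreal_mult)
      also have "\<rho> powr (s * p) = \<delta> powr (a * (s * p)) * (r powr (s * p - real ?n) * r ^ ?n)"
        by (simp add: \<rho>_def powr_mult powr_powr rn)
      finally have "(?\<omega> * r ^ ?n) * \<delta> \<le> (?\<omega> * r ^ ?n) * (C1 * \<delta> powr (a * (s * p)) * R)"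
        by (simp add: C1_def R_def mult_ac)
      then have *: "\<delta> \<le> C1 * \<delta> powr (a * (s * p)) * R"
        using mult_le_cancel_left_pos[of "?\<omega> * r ^ ?n"] r by simp
      have "\<delta> powr (1 - \<theta>) \<le> \<delta> powr (1 - a * (s * p))"
        using \<delta> by (intro powr_mono') (auto simp: \<theta>_def)
      also have "\<dots> = \<delta> / \<delta> powr (a * (s * p))" using \<delta> by (simp add: powr_diff)
      also have "\<dots> \<le> C1 * R"
        using * \<delta> by (simp add: field_simps)
      finally show ?thesis by simp
    next
      assume "ennreal (?\<omega> * (\<rho> ^ ?n)\<^sup>2) \<le> ennreal (4 * 2 powr p * (4 * r) ^ ?n) * modulus_power p UNIV v (4 * r)"
      also have "\<dots> \<le> ennreal (4 * 2 powr p * (4 * r) ^ ?n) * ennreal ((4 * r) powr (s * p) * Q)"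
        using r by (intro mult_left_mono mod) auto
      finally have "?\<omega> * (\<rho> ^ ?n)\<^sup>2 \<le> 4 * 2 powr p * (4 * r) ^ ?n * ((4 * r) powr (s * p) * Q)"
        using Q r by (simp add: ennreal_le_iff flip: ennreal_mult)
      also have "(4 * r) powr (s * p) = 4 powr (s * p) * (r powr (s * p - real ?n) * r ^ ?n)"
        by (simp add: powr_mult rn)
      also have "(\<rho> ^ ?n)\<^sup>2 = \<delta> powr (1/2) * (r ^ ?n)\<^sup>2"
      proof -
        have "(\<rho> ^ ?n) = \<delta> powr (1/4) * r ^ ?n"
          using \<delta> by (simp add: \<rho>_def power_mult_distrib powr_powr an flip: powr_realpow)
        moreover have "(\<delta> powr (1/4))\<^sup>2 = \<delta> powr (1/2)"
          by (simp add: power2_eq_square flip: powr_add)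
        ultimately show ?thesis by (simp add: power_mult_distrib)
      qed
      finally have "(?\<omega> * (r ^ ?n)\<^sup>2) * \<delta> powr (1/2) \<le> (?\<omega> * (r ^ ?n)\<^sup>2) * (C2 * R)"
        by (simp add: C2_def R_def mult_ac power2_eq_square power_mult_distrib)
      then have "\<delta> powr (1/2) \<le> C2 * R"
        using mult_le_cancel_left_pos[of "?\<omega> * (r ^ ?n)\<^sup>2"] r by simp
      moreover have "\<delta> powr (1 - \<theta>) \<le> \<delta> powr (1/2)"
        using \<delta> by (intro powr_mono') (auto simp: \<theta>_def)
      ultimately show ?thesis by simp
    qed
    moreover have "C1 * R \<ge> 0" "C2 * R \<ge> 0" using C R by auto
    ultimately have "\<delta> powr (1 - \<theta>) \<le> (C1 + C2) * R" unfolding distrib_right by linarith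
    then show "\<delta> powr (1 - \<theta>) \<le> (C1 + C2) * r powr (s * p - real ?n) * Q" by (simp add: R_def mult.assoc)
  qed
qed

section \<open>Lipschitz cutoffs\<close>

lemma nn_integral_indicator_translate:
  fixes W :: "'a::euclidean_space set"
  assumes [measurable]: "W \<in> sets borel"
  shows "(\<integral>\<^sup>+x. indicator W (x + h) \<partial>lborel) = emeasure lborel W"
  using nn_integral_lborel_translate[of "indicator W" h] by (simp add: add.commute)

text \<open>The increments of \<open>u\<close> are at most \<open>min 1 (L t)\<close> and live on two copies of \<open>W\<close>. Times \<open>t\<^sup>-\<^sup>s\<close>, this bound
peaks at \<open>t = 1 / L\<close> and decays geometrically on both sides, so a sequence with a single nonzero entry
at that scale dominates the dyadic moduli.\<close>

lemma besov_norm_cutoff_le: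
  assumes s: "0 < s" "s < 1" and p: "p > 0" and q: "q > 0"
  obtains C where "C \<ge> 0"
    "\<And>S (u::real^'n \<Rightarrow> real) W L. W \<in> sets borel \<Longrightarrow> u \<in> borel_measurable borel \<Longrightarrow>
       (\<And>x. 0 \<le> u x \<and> u x \<le> 1) \<Longrightarrow> (\<And>x y. \<bar>u x - u y\<bar> \<le> L * norm (x - y)) \<Longrightarrow> L \<ge> 1 \<Longrightarrow>
       (\<And>y. y \<in> S \<Longrightarrow> u y \<noteq> 0 \<Longrightarrow> y \<in> W) \<Longrightarrow>
       besov_norm s p q S u \<le> ennreal (C * L powr s) * ennreal_power (emeasure lborel W) (1 / p)"
proof -
  define \<eta> where "\<eta> = min (s * p) ((1 - s) * p)"
  have \<eta>: "\<eta> > 0" "\<eta> \<le> s * p" "\<eta> \<le> (1 - s) * p" using s p by (auto simp: \<eta>_def)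
  obtain C where C: "C \<ge> 0"
    "\<And>S (u::real^'n \<Rightarrow> real) Y.
       lp_energy p S u \<le> (\<Sum>l. ennreal (geom_kernel \<eta> 0 l) * Y l) \<Longrightarrow>
       (\<And>k. ennreal (2 powr (real k * s * p)) * modulus_power p S u (dyadic k) \<le> (\<Sum>l. ennreal (geom_kernel \<eta> k l) * Y l)) \<Longrightarrow>
       besov_norm s p q S u \<le> ennreal C * seq_norm p q Y"
    using besov_norm_le_seq_norm[OF s(1) p q \<eta>(1)] by blast
  define D where "D = 2 * 2 powr p"
  show thesis
  proof (rule that[of "C * D powr (1 / p)"])
    show "C * D powr (1 / p) \<ge> 0" using C by simp
    fix S W and u :: "real^'n \<Rightarrow> real" and L
    assume [measurable]: "W \<in> sets borel" "u \<in> borel_measurable borel"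
      and u01: "\<And>x. 0 \<le> u x \<and> u x \<le> 1" and lip: "\<And>x y. \<bar>u x - u y\<bar> \<le> L * norm (x - y)" and L: "L \<ge> 1"
      and W: "\<And>y. y \<in> S \<Longrightarrow> u y \<noteq> 0 \<Longrightarrow> y \<in> W"
    \<comment> \<open>The critical scale \<open>1 / L\<close> lies between \<open>2\<^sup>-\<^sup>N\<^sup>-\<^sup>1\<close> and \<open>2\<^sup>-\<^sup>N\<close>.\<close>
    define N where "N = nat \<lfloor>log 2 L\<rfloor>"
    have "log 2 L \<ge> 0" using L by simp
    then have "real N \<le> log 2 L" "log 2 L \<le> real N + 1" unfolding N_def by linarith+
    then have N: "2 powr real N \<le> L" "L \<le> 2 powr (real N + 1)"
      using L by (auto simp: le_log_iff[symmetric] log_le_iff[symmetric])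
    define A where "A = D * L powr (s * p)"
    have A: "A \<ge> 0" "D * 2 powr (real N * (s * p)) \<le> A"
    proof -
      have "(2 powr real N) powr (s * p) \<le> L powr (s * p)"
        using N s p by (intro powr_mono2) auto
      then show "D * 2 powr (real N * (s * p)) \<le> A" by (simp add: A_def D_def powr_powr)
      show "A \<ge> 0" by (simp add: A_def D_def)
    qed
    define Y where "Y l = (if l = N then ennreal A * emeasure lborel W else 0)" for l
    have lpe: "lp_energy p S u \<le> emeasure lborel W"
    proof -
      have "lp_energy p S u \<le> (\<integral>\<^sup>+x. indicator W x \<partial>lborel)"
        unfolding lp_energy_lborel
      proof (intro nn_integral_mono)
        fix x show "indicator S x * epow p (u x) \<le> indicator W x"
          using u01[of x] W[of x] p
          by (cases "u x = 0") (auto simp: indicator_def powr_le1)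
      qed
      then show ?thesis by simp
    qed
    have mod: "modulus_power p S u t \<le> ennreal (2 * (min 1 (L * t)) powr p) * emeasure lborel W" if t: "t > 0" for t
      unfolding modulus_power_def
    proof (rule SUP_least)
      fix h :: "real^'n" assume "h \<in> {h. norm h \<le> t}"
      then have h: "norm h \<le> t" by simp
      let ?m = "min 1 (L * t) powr p"
      have "increment_energy p S u h \<le> (\<integral>\<^sup>+x. ennreal ?m * (indicator W x + indicator W (x + h)) \<partial>lborel)"
        unfolding increment_energy_lborel
      proof (intro nn_integral_mono)
        fix x
        have "\<bar>u (x + h) - u x\<bar> \<le> L * norm h" using lip[of "x+h" x] by simp
        also have "\<dots> \<le> L * t" using h L by (intro mult_left_mono) auto
        finally have "\<bar>u (x + h) - u x\<bar> \<le> min 1 (L * t)" using u01[of x] u01[of "x+h"] by auto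
        then have le: "epow p (u (x + h) - u x) \<le> ennreal ?m"
          using p by (intro ennreal_leI powr_mono2) auto
        show "indicator S x * indicator S (x + h) * epow p (u (x + h) - u x)
          \<le> ennreal ?m * (indicator W x + indicator W (x + h))"
        proof (cases "x \<in> S \<and> x + h \<in> S \<and> (u x \<noteq> 0 \<or> u (x + h) \<noteq> 0)")
          case True
          then have "1 \<le> (indicator W x + indicator W (x + h) :: ennreal)"
            using W[of x] W[of "x+h"] by (auto simp: indicator_def)
          then have "ennreal ?m * 1 \<le> ennreal ?m * (indicator W x + indicator W (x + h))"
            by (rule mult_left_mono) simp
          with le have "epow p (u (x + h) - u x) \<le> ennreal ?m * (indicator W x + indicator W (x + h))"
            unfolding mult_1_right by (rule order_trans)
          then show ?thesis using True by (simp only: indicator_simps mult_1)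
        qed (auto simp: indicator_def)
      qed
      also have "\<dots> = ennreal ?m * (emeasure lborel W + emeasure lborel W)"
        by (subst nn_integral_cmult) (auto simp: nn_integral_add nn_integral_indicator_translate)
      also have "\<dots> = ennreal (2 * ?m) * emeasure lborel W"
        by (simp add: ennreal_mult mult_2[symmetric] mult_ac)
      finally show "increment_energy p S u h \<le> ennreal (2 * ?m) * emeasure lborel W" .
    qed
    have sumY: "(\<Sum>l. ennreal (geom_kernel \<eta> k l) * Y l) = ennreal (geom_kernel \<eta> k N * A) * emeasure lborel W" for k
      using A by (subst suminf_finite[of "{N}"]) (auto simp: Y_def ennreal_mult mult.assoc)
    have "1 \<le> geom_kernel \<eta> 0 N * A"
    proof -
      have "1 \<le> 2 powr (- \<eta> * real N) * 2 powr (real N * (s * p))"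
      proof -
        have "0 \<le> real N * (s * p - \<eta>)" using \<eta> by simp
        then have "0 \<le> - \<eta> * real N + real N * (s * p)" by (simp add: algebra_simps)
        then have "1 \<le> 2 powr (- \<eta> * real N + real N * (s * p))" by (intro ge_one_powr_ge_zero) auto
        then show ?thesis by (simp only: powr_add)
      qed
      also have "\<dots> \<le> 2 powr (- \<eta> * real N) * (D * 2 powr (real N * (s * p)))"
      proof (intro mult_left_mono)
        have "1 \<le> 2 powr p" using p by (simp add: ge_one_powr_ge_zero)
        then show "2 powr (real N * (s * p)) \<le> D * 2 powr (real N * (s * p))" by (simp add: D_def)
      qed simp
      also have "\<dots> \<le> geom_kernel \<eta> 0 N * A"
        unfolding geom_kernel_def using A by (simp add: mult_left_mono)
      finally show ?thesis .
    qed
    then have "emeasure lborel W \<le> ennreal (geom_kernel \<eta> 0 N * A) * emeasure lborel W"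
      using mult_right_mono[OF ennreal_leI, of 1 "geom_kernel \<eta> 0 N * A" "emeasure lborel W"] by simp
    with lpe have 1: "lp_energy p S u \<le> (\<Sum>l. ennreal (geom_kernel \<eta> 0 l) * Y l)"
      unfolding sumY by (rule order_trans)
    have 2: "ennreal (2 powr (real k * s * p)) * modulus_power p S u (dyadic k) \<le> (\<Sum>l. ennreal (geom_kernel \<eta> k l) * Y l)" for k
    proof -
      have "2 powr (real k * s * p) * (2 * (min 1 (L * dyadic k)) powr p) \<le> geom_kernel \<eta> k N * A"
      proof (cases "k \<le> N")
        case True
        have "min 1 (L * dyadic k) powr p \<le> 1 powr p"
          using p L by (intro powr_mono2) auto
        then have "2 powr (real k * s * p) * (2 * (min 1 (L * dyadic k)) powr p) \<le> 2 powr (real k * s * p) * 2"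
          by simp
        also have "\<dots> \<le> 2 powr (- \<eta> * (real N - real k) + real N * (s * p)) * D"
        proof (intro mult_mono)
          have "\<eta> * (real N - real k) \<le> (s * p) * (real N - real k)"
            using \<eta> True by (intro mult_right_mono) auto
          then show "2 powr (real k * s * p) \<le> 2 powr (- \<eta> * (real N - real k) + real N * (s * p))"
            by (simp add: algebra_simps)
          have "1 \<le> 2 powr p" using p by (simp add: ge_one_powr_ge_zero)
          then show "2 \<le> D" by (simp add: D_def)
        qed (auto simp: D_def)
        also have "\<dots> = geom_kernel \<eta> k N * (D * 2 powr (real N * (s * p)))"
          using True unfolding geom_kernel_def powr_add by (simp add: mult_ac abs_if)
        also have "\<dots> \<le> geom_kernel \<eta> k N * A" using A by (intro mult_left_mono) auto
        finally show ?thesis .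
      next
        case False
        have "min 1 (L * dyadic k) powr p \<le> (2 powr (real N + 1) * dyadic k) powr p"
          using p L N by (intro powr_mono2 min.coboundedI2 mult_right_mono) auto
        also have "\<dots> = 2 powr ((real N + 1 - real k) * p)"
          by (simp add: powr_powr flip: powr_add)
        finally have "2 powr (real k * s * p) * (2 * (min 1 (L * dyadic k)) powr p)
            \<le> 2 powr (real k * s * p) * (2 * 2 powr ((real N + 1 - real k) * p))"
          by simp
        also have "\<dots> = D * 2 powr (real k * s * p + (real N - real k) * p)"
        proof -
          have "2 powr ((real N + 1 - real k) * p) = 2 powr p * 2 powr ((real N - real k) * p)"
            by (simp add: algebra_simps flip: powr_add)
          then show ?thesis by (simp add: D_def powr_add)
        qed
        also have "\<dots> \<le> D * 2 powr (- \<eta> * (real k - real N) + real N * (s * p))"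
        proof (intro mult_left_mono)
          have "\<eta> * (real k - real N) \<le> (1 - s) * p * (real k - real N)"
            using \<eta> False by (intro mult_right_mono) auto
          then show "2 powr (real k * s * p + (real N - real k) * p) \<le> 2 powr (- \<eta> * (real k - real N) + real N * (s * p))"
            by (simp add: algebra_simps)
        qed (simp add: D_def)
        also have "\<dots> = geom_kernel \<eta> k N * (D * 2 powr (real N * (s * p)))"
          using False unfolding geom_kernel_def powr_add by (simp add: mult_ac abs_if)
        also have "\<dots> \<le> geom_kernel \<eta> k N * A" using A by (intro mult_left_mono) auto
        finally show ?thesis .
      qed
      then have "ennreal (2 powr (real k * s * p)) * ennreal (2 * (min 1 (L * dyadic k)) powr p) * emeasure lborel W
          \<le> ennreal (geom_kernel \<eta> k N * A) * emeasure lborel W"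
        by (intro mult_right_mono) (auto simp flip: ennreal_mult intro!: ennreal_leI)
      moreover have "ennreal (2 powr (real k * s * p)) * modulus_power p S u (dyadic k)
         \<le> ennreal (2 powr (real k * s * p)) * (ennreal (2 * (min 1 (L * dyadic k)) powr p) * emeasure lborel W)"
        by (intro mult_left_mono mod) auto
      ultimately show ?thesis unfolding sumY by (simp add: mult.assoc)
    qed
    have "besov_norm s p q S u \<le> ennreal C * seq_norm p q Y"
      by (rule C(2)[OF 1 2])
    also have "\<dots> = ennreal C * ennreal_power (ennreal A * emeasure lborel W) (1 / p)"
      unfolding Y_def using p q by (subst seq_norm_single) auto
    also have "\<dots> = ennreal (C * D powr (1/p) * L powr s) * ennreal_power (emeasure lborel W) (1 / p)"
    proof -
      have "A powr (1/p) = D powr (1/p) * L powr s"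
        using p by (simp add: A_def powr_mult powr_powr)
      then show ?thesis using p A C
        by (simp add: ennreal_power_mult ennreal_power_ennreal ennreal_mult mult.assoc)
    qed
    finally show "besov_norm s p q S u \<le> ennreal (C * D powr (1 / p) * L powr s) * ennreal_power (emeasure lborel W) (1 / p)" .
  qed
qed

section \<open>Extension domains satisfy the measure density condition\<close>

lemma AE_lebesgue_on_iff:
  assumes "S \<in> sets borel"
  shows "(AE x in lebesgue_on S. P x) \<longleftrightarrow> (AE x in lebesgue. x \<in> S \<longrightarrow> P x)"
  using assms by (intro AE_restrict_space_iff) auto

lemma borel_version:
  assumes "u \<in> borel_measurable lebesgue"
  obtains v :: "real^'n \<Rightarrow> real" where "v \<in> borel_measurable borel" "AE x in lebesgue. u x = v x"
  using completion_ex_borel_measurable_real[OF assms] by (auto simp: AE_completion)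

lemma measure_lebesgue_borel: "A \<in> sets borel \<Longrightarrow> measure lebesgue A = measure lborel A"
  by (simp add: measure_completion)

lemma emeasure_eq_AE_lborel:
  assumes "AE x in lebesgue. x \<in> A \<longleftrightarrow> x \<in> B" "A \<in> sets borel" "B \<in> sets borel"
  shows "emeasure lborel A = emeasure lborel B"
proof -
  have "emeasure lebesgue A = emeasure lebesgue B"
    using assms by (intro emeasure_eq_AE) auto
  then show ?thesis using assms by simp
qed

text \<open>The extension \<open>v\<close> of the Lipschitz cutoff between \<open>ball y b'\<close> and \<open>ball y b\<close>, together with the bound on
its modulus that follows from the norm of the cutoff on \<open>\<Omega>\<close>. The constant does not depend on the balls.\<close>

lemma extension_modulus_bound:
  fixes \<Omega> :: "(real^'n) set"
  assumes \<Omega>: "open \<Omega>" and s: "0 < s" "s < 1" and p: "p > 0" and q: "q > 0"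
    and E: "bounded_extension_operator s p q \<Omega> E"
  obtains K where "K \<ge> 0"
    "\<And>y b b'. 0 < b' \<Longrightarrow> b' < b \<Longrightarrow> b \<le> 1 \<Longrightarrow>
      \<exists>v. v \<in> borel_measurable borel \<and>
        (AE x in lebesgue. x \<in> \<Omega> \<inter> ball y b' \<longrightarrow> v x = 1) \<and>
        (AE x in lebesgue. x \<in> \<Omega> - ball y b \<longrightarrow> v x = 0) \<and>
        (\<forall>t. 0 < t \<longrightarrow> t \<le> 1/2 \<longrightarrow>
          modulus_power p UNIV v t \<le> ennreal (t powr (s * p) * (K * measure lborel (\<Omega> \<inter> ball y b) * (b - b') powr (- (s * p)))))"
proof -
  obtain C1 where C1: "C1 \<ge> 0" "\<And>u. u \<in> besov_space s p q \<Omega> \<Longrightarrow> besov_norm s p q UNIV (E u) \<le> ennreal C1 * besov_norm s p q \<Omega> u"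
    using E unfolding bounded_extension_operator_def by blast
  have E_in: "\<And>u. u \<in> besov_space s p q \<Omega> \<Longrightarrow> E u \<in> besov_space s p q UNIV"
    and E_ext: "\<And>u. u \<in> besov_space s p q \<Omega> \<Longrightarrow> AE x in lebesgue_on \<Omega>. E u x = u x"
    using E unfolding bounded_extension_operator_def by blast+
  obtain C2 where C2: "C2 \<ge> 0" "\<And>S (u::real^'n \<Rightarrow> real) W L. W \<in> sets borel \<Longrightarrow> u \<in> borel_measurable borel \<Longrightarrow>
       (\<And>x. 0 \<le> u x \<and> u x \<le> 1) \<Longrightarrow> (\<And>x y. \<bar>u x - u y\<bar> \<le> L * norm (x - y)) \<Longrightarrow> L \<ge> 1 \<Longrightarrow>
       (\<And>y. y \<in> S \<Longrightarrow> u y \<noteq> 0 \<Longrightarrow> y \<in> W) \<Longrightarrow>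
       besov_norm s p q S u \<le> ennreal (C2 * L powr s) * ennreal_power (emeasure lborel W) (1 / p)"
  proof -
    show thesis
    proof (rule besov_norm_cutoff_le[where ?'n='n, OF s p q], goal_cases)
      case (1 C)
      show ?case by (rule that[of C]) (fact 1)+
    qed
  qed
  obtain C3 where C3: "C3 \<ge> 0"
    "\<And>S (u::real^'n \<Rightarrow> real). seq_norm p q (dyadic_energy s p S u) \<le> ennreal C3 * besov_norm s p q S u"
  proof -
    show thesis
    proof (rule seq_norm_dyadic_energy_le[where ?'n='n, OF s(1) p q], goal_cases)
      case (1 C)
      show ?case by (rule that[of C]) (fact 1)+
    qed
  qed
  define K where "K = 2 powr (s * p) * (C3 * C1 * C2) powr p"
  show thesis
  proof (rule that[of K])
    show "K \<ge> 0" by (simp add: K_def)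
    fix y :: "real^'n" and b b' :: real assume b: "0 < b'" "b' < b" "b \<le> 1"
    define L where "L = 1 / (b - b')"
    define u where "u x = max 0 (min 1 (L * (b - dist y x)))" for x
    define W where "W = \<Omega> \<inter> ball y b"
    define F where "F = measure lborel W"
    have L: "L \<ge> 1" "L > 0" "L * (b - b') = 1" using b by (auto simp: L_def field_simps)
    have W[measurable]: "W \<in> sets borel" using \<Omega> by (auto simp: W_def)
    have emW: "emeasure lborel W = ennreal F"
    proof -
      have "emeasure lborel W \<le> emeasure lborel (ball y b)" by (intro emeasure_mono) (auto simp: W_def)
      also have "\<dots> < \<infinity>" using b by (simp add: emeasure_ball_cart)
      finally show ?thesis by (simp add: F_def emeasure_eq_ennreal_measure)
    qed
    have [measurable]: "u \<in> borel_measurable borel" unfolding u_def by measurable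
    have lip: "\<bar>u x - u z\<bar> \<le> L * norm (x - z)" for x z
    proof -
      have "\<bar>u x - u z\<bar> \<le> \<bar>L * (b - dist y x) - L * (b - dist y z)\<bar>" unfolding u_def by linarith
      also have "\<dots> = L * \<bar>dist y x - dist y z\<bar>"
        using L by (simp add: abs_mult flip: right_diff_distrib)
      also have "\<dots> \<le> L * norm (x - z)"
        using L dist_triangle[of y x z] dist_triangle[of y z x]
        by (intro mult_left_mono) (auto simp: dist_norm[symmetric] dist_commute abs_le_iff)
      finally show ?thesis .
    qed
    have u1: "u x = 1" if "x \<in> ball y b'" for x
    proof -
      have "L * (b - dist y x) \<ge> L * (b - b')" using that L by (intro mult_left_mono) auto
      then show ?thesis using L by (simp add: u_def)
    qed
    have u0: "u x = 0" if "x \<notin> ball y b" for x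
    proof -
      have "L * (b - dist y x) \<le> 0" using that L by (intro mult_nonneg_nonpos) auto
      then show ?thesis by (simp add: u_def)
    qed
    have norm_u: "besov_norm s p q \<Omega> u \<le> ennreal (C2 * L powr s * F powr (1 / p))"
    proof -
      have "besov_norm s p q \<Omega> u \<le> ennreal (C2 * L powr s) * ennreal_power (emeasure lborel W) (1 / p)"
      proof (rule C2(2)[OF _ _ _ lip L(1)])
        fix x assume "x \<in> \<Omega>" "u x \<noteq> 0"
        then show "x \<in> W" using u0[of x] unfolding W_def by blast
      qed (auto simp: u_def)
      then show ?thesis using C2(1) by (simp add: emW ennreal_power_ennreal F_def flip: ennreal_mult)
    qed
    have u_in: "u \<in> besov_space s p q \<Omega>"
      using norm_u unfolding besov_space_def
      by (auto intro!: measurable_restrict_space1 measurable_completion simp: le_less_trans[OF _ ennreal_less_top])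
    have "E u \<in> borel_measurable lebesgue"
      using E_in[OF u_in] by (simp add: besov_space_def lebesgue_on_UNIV_eq)
    then obtain v where v: "v \<in> borel_measurable borel" "AE x in lebesgue. E u x = v x"
      by (rule borel_version)
    have ext: "AE x in lebesgue. x \<in> \<Omega> \<longrightarrow> v x = u x"
      using v(2) E_ext[OF u_in] \<Omega> by (auto simp: AE_lebesgue_on_iff)
    define R where "R = C3 * C1 * C2 * L powr s * F powr (1 / p)"
    have R: "R \<ge> 0" using C1 C2 C3 by (simp add: R_def)
    have "seq_norm p q (dyadic_energy s p UNIV v) \<le> ennreal C3 * besov_norm s p q UNIV v" by (rule C3)
    also have "besov_norm s p q UNIV v = besov_norm s p q UNIV (E u)"
      using v(2) by (intro besov_norm_cong_AE) auto
    also have "ennreal C3 * \<dots> \<le> ennreal C3 * (ennreal C1 * ennreal (C2 * L powr s * F powr (1 / p)))"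
      by (intro mult_left_mono order_trans[OF C1(2)[OF u_in]] norm_u) auto
    also have "\<dots> = ennreal R"
      using C1 C2 C3 by (simp add: R_def mult.assoc flip: ennreal_mult)
    finally have seq: "seq_norm p q (dyadic_energy s p UNIV v) \<le> ennreal R" .
    have Rp: "2 powr (s * p) * R powr p = K * F * (b - b') powr (- (s * p))"
    proof -
      have "R powr p = (C3 * C1 * C2) powr p * (L powr s) powr p * (F powr (1/p)) powr p"
        by (simp add: R_def powr_mult mult.assoc)
      also have "(F powr (1/p)) powr p = F" using p by (simp add: powr_powr F_def)
      also have "(L powr s) powr p = (b - b') powr (- (s * p))"
        using b by (simp add: L_def powr_powr powr_divide powr_minus_divide)
      finally show ?thesis by (simp add: K_def)
    qed
    have mod: "modulus_power p UNIV v t \<le> ennreal (t powr (s * p) * (K * F * (b - b') powr (- (s * p))))"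
      if t: "0 < t" "t \<le> 1/2" for t
    proof -
      obtain l where l: "l \<ge> 1" "dyadic (Suc l) < t" "t \<le> dyadic l"
        using dyadic_scale_le[of t 1] t by (auto simp: powr_minus)
      have "ennreal (2 powr (real l * s * p)) * modulus_power p UNIV v (dyadic l) = dyadic_energy s p UNIV v l"
        using l by (simp add: dyadic_energy_def)
      also have "\<dots> \<le> ennreal_power (seq_norm p q (dyadic_energy s p UNIV v)) p"
        by (rule seq_norm_ge_term[OF p q])
      also have "\<dots> \<le> ennreal_power (ennreal R) p"
        using p by (intro ennreal_power_mono seq) simp
      also have "\<dots> = ennreal (R powr p)" using R by (simp add: ennreal_power_ennreal)
      finally have le: "ennreal (2 powr (real l * s * p)) * modulus_power p UNIV v (dyadic l) \<le> ennreal (R powr p)" .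
      have "modulus_power p UNIV v t \<le> modulus_power p UNIV v (dyadic l)"
        by (rule modulus_power_mono) (rule l)
      also have "\<dots> = ennreal (2 powr (- (real l * s * p))) * (ennreal (2 powr (real l * s * p)) * modulus_power p UNIV v (dyadic l))"
      proof -
        have "ennreal (2 powr (- (real l * s * p))) * ennreal (2 powr (real l * s * p)) = 1"
          by (simp flip: ennreal_mult powr_add)
        then show ?thesis by (metis mult.assoc mult_1)
      qed
      also have "\<dots> \<le> ennreal (2 powr (- (real l * s * p))) * ennreal (R powr p)"
        by (intro mult_left_mono le) simp
      also have "\<dots> = ennreal (2 powr (- (real l * s * p)) * R powr p)" by (simp add: ennreal_mult)
      also have "\<dots> \<le> ennreal (t powr (s * p) * (2 powr (s * p) * R powr p))"
      proof (intro ennreal_leI)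
        have "(dyadic l) powr (s * p) \<le> (2 * t) powr (s * p)"
        proof (intro powr_mono2)
          have "dyadic l = 2 * dyadic (Suc l)" unfolding two_powr_neg_Suc by simp
          then show "dyadic l \<le> 2 * t" using l by simp
        qed (use s p in auto)
        then have "2 powr (- (real l * s * p)) \<le> t powr (s * p) * 2 powr (s * p)"
          by (simp add: powr_powr powr_mult mult_ac)
        then have "2 powr (- (real l * s * p)) * R powr p \<le> t powr (s * p) * 2 powr (s * p) * R powr p"
          by (rule mult_right_mono) simp
        then show "2 powr (- (real l * s * p)) * R powr p \<le> t powr (s * p) * (2 powr (s * p) * R powr p)"
          by (simp add: mult.assoc)
      qed
      finally show ?thesis by (simp add: Rp)
    qed
    have "AE x in lebesgue. x \<in> \<Omega> \<inter> ball y b' \<longrightarrow> v x = 1"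
      using ext by eventually_elim (auto simp: u1 simp del: mem_ball)
    moreover have "AE x in lebesgue. x \<in> \<Omega> - ball y b \<longrightarrow> v x = 0"
      using ext by eventually_elim (auto simp: u0 simp del: mem_ball)
    ultimately show "\<exists>v. v \<in> borel_measurable borel \<and>
        (AE x in lebesgue. x \<in> \<Omega> \<inter> ball y b' \<longrightarrow> v x = 1) \<and>
        (AE x in lebesgue. x \<in> \<Omega> - ball y b \<longrightarrow> v x = 0) \<and>
        (\<forall>t. 0 < t \<longrightarrow> t \<le> 1/2 \<longrightarrow>
          modulus_power p UNIV v t \<le> ennreal (t powr (s * p) * (K * measure lborel (\<Omega> \<inter> ball y b) * (b - b') powr (- (s * p)))))"
      using v(1) mod unfolding F_def W_def by blast
  qed
qed

text \<open>If \<open>\<delta> 0\<close> is below the threshold \<open>\<epsilon>\<close>, then the superlinear recursion beats the factor \<open>\<Lambda>\<^sup>j\<close>, and induction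
shows \<open>\<delta> j \<le> \<epsilon> \<mu>\<^sup>j\<close> for \<open>\<mu> = \<Lambda>\<^sup>-\<^sup>1\<^sup>/\<^sup>\<theta> < 1\<close>, which contradicts the lower bound \<open>m\<close>.\<close>

lemma de_giorgi_lower_bound:
  assumes "0 < \<theta>" "\<theta> < 1" "M > 0" "\<Lambda> > 1"
  obtains \<epsilon> :: real where "\<epsilon> > 0"
    "\<And>\<delta> m. (\<And>j::nat. m \<le> \<delta> j) \<Longrightarrow> m > 0 \<Longrightarrow> (\<And>j. \<delta> (Suc j) powr (1 - \<theta>) \<le> M * \<Lambda> ^ j * \<delta> j) \<Longrightarrow> \<epsilon> \<le> \<delta> 0"
proof -
  \<comment> \<open>The rate \<open>\<mu>\<close> is chosen so that \<open>\<mu>\<^sup>\<theta> \<Lambda> = 1\<close>, and then \<open>\<epsilon>\<close> so that the induction step closes.\<close>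
  define \<mu> where "\<mu> = \<Lambda> powr (- 1 / \<theta>)"
  have \<mu>: "0 < \<mu>" "\<mu> < 1" using assms by (auto simp: \<mu>_def powr_less_one)
  have \<mu>\<Lambda>: "\<mu> powr \<theta> * \<Lambda> = 1"
  proof -
    have "\<mu> powr \<theta> = \<Lambda> powr (- 1 / \<theta> * \<theta>)" by (simp only: \<mu>_def powr_powr)
    also have "- 1 / \<theta> * \<theta> = - 1" using assms by simp
    finally show ?thesis using assms by (simp add: powr_minus)
  qed
  define \<epsilon> where "\<epsilon> = (\<mu> powr (1 - \<theta>) / M) powr (1 / \<theta>)"
  have \<epsilon>: "\<epsilon> > 0" using \<mu> assms by (simp add: \<epsilon>_def)
  have \<epsilon>\<theta>: "M * \<epsilon> powr \<theta> = \<mu> powr (1 - \<theta>)" using \<mu> assms by (simp add: \<epsilon>_def powr_powr)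
  show thesis
  proof (rule that[OF \<epsilon>], rule ccontr)
    fix \<delta> :: "nat \<Rightarrow> real" and m
    assume m: "\<And>j. m \<le> \<delta> j" "m > 0" and step: "\<And>j. \<delta> (Suc j) powr (1 - \<theta>) \<le> M * \<Lambda> ^ j * \<delta> j" and "\<not> \<epsilon> \<le> \<delta> 0"
    then have less: "\<delta> 0 \<le> \<epsilon>" by simp
    have pos: "\<delta> j > 0" for j using m by (meson less_le_trans)
    have bound: "\<delta> j \<le> \<epsilon> * \<mu> ^ j" for j
    proof (induction j)
      case (Suc j)
      have "\<delta> (Suc j) powr (1 - \<theta>) \<le> M * \<Lambda> ^ j * (\<epsilon> * \<mu> ^ j)"
        using assms by (intro order_trans[OF step] mult_left_mono Suc) auto
      also have "\<dots> = (M * \<epsilon> powr \<theta>) * \<epsilon> powr (1 - \<theta>) * ((\<mu> powr \<theta> * \<Lambda>) ^ j * (\<mu> ^ j) powr (1 - \<theta>))"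
      proof -
        have "\<epsilon> = \<epsilon> powr \<theta> * \<epsilon> powr (1 - \<theta>)" using \<epsilon> by (simp flip: powr_add)
        moreover have "\<mu> ^ j = (\<mu> powr \<theta>) ^ j * (\<mu> ^ j) powr (1 - \<theta>)"
          using \<mu> by (simp add: powr_powr flip: powr_realpow powr_add) (simp add: algebra_simps)
        ultimately have "M * \<Lambda> ^ j * (\<epsilon> * \<mu> ^ j) = M * \<Lambda> ^ j * ((\<epsilon> powr \<theta> * \<epsilon> powr (1 - \<theta>)) * ((\<mu> powr \<theta>) ^ j * (\<mu> ^ j) powr (1 - \<theta>)))"
          by simp
        then show ?thesis by (simp add: power_mult_distrib mult_ac)
      qed
      also have "\<dots> = (\<epsilon> * \<mu> ^ Suc j) powr (1 - \<theta>)"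
        unfolding \<mu>\<Lambda> \<epsilon>\<theta> using \<mu> \<epsilon> by (simp add: powr_mult)
      finally have le: "\<delta> (Suc j) powr (1 - \<theta>) \<le> (\<epsilon> * \<mu> ^ Suc j) powr (1 - \<theta>)" .
      show ?case
      proof (rule ccontr)
        assume "\<not> ?thesis"
        then have "(\<epsilon> * \<mu> ^ Suc j) powr (1 - \<theta>) < \<delta> (Suc j) powr (1 - \<theta>)"
          using \<epsilon> \<mu> assms by (intro powr_less_mono2) auto
        with le show False by simp
      qed
    qed (use less in simp)
    have "(\<lambda>j. \<epsilon> * \<mu> ^ j) \<longlonglongrightarrow> \<epsilon> * 0"
      using \<mu> by (intro tendsto_mult tendsto_const LIMSEQ_realpow_zero) auto
    then have "m \<le> \<epsilon> * 0"
      using order_trans[OF m(1) bound] by (intro LIMSEQ_le_const) auto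
    then show False using m by simp
  qed
qed

lemma emeasure_Int_ball_finite:
  "emeasure lborel (X \<inter> ball (x::real^'n) r) < \<infinity>"
proof -
  have "emeasure lborel (X \<inter> ball x r) \<le> emeasure lborel (ball x r)" by (intro emeasure_mono) auto
  also have "\<dots> < \<infinity>" by (rule emeasure_lborel_ball_finite)
  finally show ?thesis .
qed

lemma emeasure_open_Int_ball:
  "open \<Omega> \<Longrightarrow> emeasure lborel (\<Omega> \<inter> ball (x::real^'n) r) = ennreal (measure lborel (\<Omega> \<inter> ball x r))"
  using emeasure_Int_ball_finite[of \<Omega> x r] by (intro emeasure_eq_ennreal_measure) auto

lemma measure_Int_ball_mono:
  assumes "open \<Omega>" "ball (y::real^'n) b \<subseteq> ball x r"
  shows "measure lborel (\<Omega> \<inter> ball y b) \<le> measure lborel (\<Omega> \<inter> ball x r)"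
  unfolding measure_def
  using assms emeasure_Int_ball_finite[of \<Omega> x r]
  by (intro enn2real_mono emeasure_mono) auto

lemma measure_open_Int_ball_pos:
  assumes "open \<Omega>" "(y::real^'n) \<in> \<Omega>" "b > 0"
  shows "measure lborel (\<Omega> \<inter> ball y b) > 0"
proof -
  have "open (\<Omega> \<inter> ball y b)" "y \<in> \<Omega> \<inter> ball y b" using assms by auto
  then have "\<not> negligible (\<Omega> \<inter> ball y b)"
    using open_not_negligible by blast
  then have "emeasure lebesgue (\<Omega> \<inter> ball y b) \<noteq> 0"
    using assms by (auto simp: negligible_iff_null_sets null_sets_def)
  then have "emeasure lborel (\<Omega> \<inter> ball y b) \<noteq> 0" using assms by simp
  then show ?thesis using emeasure_open_Int_ball[OF assms(1), of y b]
    by (metis ennreal_0 measure_nonneg order_less_le)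
qed

text \<open>Of the two balls of radius \<open>r/4\<close>, the one with less of \<open>\<Omega>\<close> is shrunk, and the other one provides the
set where the extended cutoff vanishes. It stays at least as large as the shrinking set, so the
density bound applies at every step of the iteration.\<close>

lemma smaller_ball_density:
  fixes \<Omega> :: "(real^'n) set"
  assumes \<Omega>: "open \<Omega>" and s: "0 < s" "s < 1" and p: "p > 0" and q: "q > 0"
    and E: "bounded_extension_operator s p q \<Omega> E"
  obtains \<epsilon> where "\<epsilon> > 0"
    "\<And>x y w r. 0 < r \<Longrightarrow> r \<le> 1/8 \<Longrightarrow> y \<in> \<Omega> \<Longrightarrow> ball y (r/4) \<subseteq> ball x r \<Longrightarrow> ball w (r/4) \<subseteq> ball x r \<Longrightarrow>
      dist y w = r / 2 \<Longrightarrow> measure lborel (\<Omega> \<inter> ball y (r/4)) \<le> measure lborel (\<Omega> \<inter> ball w (r/4)) \<Longrightarrow>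
      \<epsilon> * (unit_ball_vol (real CARD('n)) * r ^ CARD('n)) \<le> measure lborel (\<Omega> \<inter> ball y (r/4))"
proof -
  let ?n = "CARD('n)" and ?\<omega> = "unit_ball_vol (real CARD('n))"
  obtain K where K: "K \<ge> 0"
    "\<And>y b b'. 0 < b' \<Longrightarrow> b' < b \<Longrightarrow> b \<le> 1 \<Longrightarrow>
      \<exists>v. v \<in> borel_measurable borel \<and>
        (AE x in lebesgue. x \<in> \<Omega> \<inter> ball y b' \<longrightarrow> v x = 1) \<and>
        (AE x in lebesgue. x \<in> \<Omega> - ball y b \<longrightarrow> v x = 0) \<and>
        (\<forall>t. 0 < t \<longrightarrow> t \<le> 1/2 \<longrightarrow>
          modulus_power p UNIV v t \<le> ennreal (t powr (s * p) * (K * measure lborel (\<Omega> \<inter> ball y b) * (b - b') powr (- (s * p)))))"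
  proof -
    show thesis
    proof (rule extension_modulus_bound[OF \<Omega> s p q E], goal_cases)
      case (1 C)
      show ?case by (rule that[of C]) (fact 1)+
    qed
  qed
  obtain C \<theta> where C: "C > 0" and \<theta>: "0 < \<theta>" "\<theta> < 1" and ratio:
    "\<And>(v::real^'n \<Rightarrow> real) A Z x r \<delta> Q. v \<in> borel_measurable borel \<Longrightarrow> A \<in> sets borel \<Longrightarrow> Z \<in> sets borel \<Longrightarrow>
      (\<And>y. y \<in> A \<Longrightarrow> v y = 1) \<Longrightarrow> (\<And>y. y \<in> Z \<Longrightarrow> v y = 0) \<Longrightarrow> A \<subseteq> ball x r \<Longrightarrow> Z \<subseteq> ball x r \<Longrightarrow>
      ennreal (\<delta> * (?\<omega> * r ^ ?n)) \<le> emeasure lborel A \<Longrightarrow>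
      ennreal (\<delta> * (?\<omega> * r ^ ?n)) \<le> emeasure lborel Z \<Longrightarrow>
      0 < \<delta> \<Longrightarrow> \<delta> \<le> 1 \<Longrightarrow> 0 < r \<Longrightarrow> r \<le> 1/8 \<Longrightarrow> Q \<ge> 0 \<Longrightarrow>
      (\<And>t. 0 < t \<Longrightarrow> t \<le> 1/2 \<Longrightarrow> modulus_power p UNIV v t \<le> ennreal (t powr (s * p) * Q)) \<Longrightarrow>
      \<delta> powr (1 - \<theta>) \<le> C * r powr (s * p - real ?n) * Q"
  proof -
    show thesis
    proof (rule density_ratio_bound[where ?'n='n, OF s(1) p], goal_cases)
      case (1 C \<theta>)
      show ?case by (rule that[of C \<theta>]) (fact 1)+
    qed
  qed
  \<comment> \<open>The recursion needs a positive constant, hence \<open>K + 1\<close> in place of \<open>K\<close>.\<close>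
  define M where "M = C * (K + 1) * ?\<omega> * 16 powr (s * p)"
  have M: "M > 0" using C K(1) by (simp add: M_def add_nonneg_pos)
  obtain \<epsilon> where \<epsilon>: "\<epsilon> > 0" and giorgi:
    "\<And>\<delta> m. (\<And>j::nat. m \<le> \<delta> j) \<Longrightarrow> m > 0 \<Longrightarrow> (\<And>j. \<delta> (Suc j) powr (1 - \<theta>) \<le> M * (2 powr (s * p)) ^ j * \<delta> j) \<Longrightarrow> \<epsilon> \<le> \<delta> 0"
  proof -
    have "(2::real) powr (s * p) > 1" using s p by simp
    show thesis
    proof (rule de_giorgi_lower_bound[OF \<theta> M \<open>2 powr (s * p) > 1\<close>], goal_cases)
      case (1 C)
      show ?case by (rule that[of C]) (fact 1)+
    qed
  qed
  show thesis
  proof (rule that[OF \<epsilon>])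
    fix x y w :: "real^'n" and r :: real
    assume r: "0 < r" "r \<le> 1/8" and y: "y \<in> \<Omega>" and sub: "ball y (r/4) \<subseteq> ball x r" "ball w (r/4) \<subseteq> ball x r"
      and d: "dist y w = r / 2" and le: "measure lborel (\<Omega> \<inter> ball y (r/4)) \<le> measure lborel (\<Omega> \<inter> ball w (r/4))"
    define B where "B = ?\<omega> * r ^ ?n"
    have B: "B > 0" using r by (simp add: B_def)
    \<comment> \<open>Radii decreasing from \<open>r/4\<close> to \<open>r/8\<close>; their differences decay geometrically, and the cutoffs
      between consecutive balls cost a factor \<open>2\<^sup>s\<^sup>p\<close> per step.\<close>
    define b where "b j = r / 8 * (1 + dyadic j)" for j :: nat
    define F where "F t = measure lborel (\<Omega> \<inter> ball y t)" for t
    have F_mono: "F t \<le> F t'" if "t \<le> t'" for t t'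
      unfolding F_def using that by (intro measure_Int_ball_mono \<Omega>) auto
    have b: "r / 8 < b j" "b j \<le> r / 4" "b (Suc j) < b j" "b j - b (Suc j) = r / 16 * dyadic j" for j
    proof -
      have "0 < dyadic j" "dyadic j \<le> (1::real)" using two_powr_neg_le_one[of "real j"] by auto
      then have "0 < r * dyadic j" "r * dyadic j \<le> r" using r by (auto simp: mult_left_le)
      moreover have "b j = r / 8 + r * dyadic j / 8"
        by (simp add: b_def distrib_left)
      moreover have "b (Suc j) = r / 8 + r * dyadic j / 16"
        unfolding b_def two_powr_neg_Suc by (simp add: distrib_left)
      ultimately show "r / 8 < b j" "b j \<le> r / 4" "b (Suc j) < b j" "b j - b (Suc j) = r / 16 * dyadic j"
        by linarith+
    qed
    define \<delta> where "\<delta> j = F (b j) / B" for j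
    have Fy: "F (r/4) \<le> B"
    proof -
      have "F (r/4) \<le> measure lborel (ball x r)"
        unfolding F_def measure_def using sub(1) emeasure_Int_ball_finite[of UNIV x r]
        by (intro enn2real_mono emeasure_mono) auto
      also have "\<dots> = B" using r by (simp add: B_def measure_def emeasure_ball_cart)
      finally show ?thesis .
    qed
    have "\<epsilon> \<le> \<delta> 0"
    proof (rule giorgi)
      show "F (r / 8) / B \<le> \<delta> j" for j
        unfolding \<delta>_def using b(1)[of j] B by (intro divide_right_mono F_mono) auto
      show "F (r / 8) / B > 0"
        using measure_open_Int_ball_pos[OF \<Omega> y, of "r / 8"] r B by (simp add: F_def)
      fix j
      have b': "0 < b (Suc j)" "b j \<le> 1" using b[of "Suc j"] b[of j] r by linarith+
      obtain v where v[measurable]: "v \<in> borel_measurable borel"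
        and v1: "AE x in lebesgue. x \<in> \<Omega> \<inter> ball y (b (Suc j)) \<longrightarrow> v x = 1"
        and v0: "AE x in lebesgue. x \<in> \<Omega> - ball y (b j) \<longrightarrow> v x = 0"
        and mod: "\<And>t. 0 < t \<Longrightarrow> t \<le> 1/2 \<Longrightarrow>
          modulus_power p UNIV v t \<le> ennreal (t powr (s * p) * (K * F (b j) * (b j - b (Suc j)) powr (- (s * p))))"
        using K(2)[OF b'(1) b(3)[of j] b'(2), of y] unfolding F_def by blast
      define A where "A = {a \<in> \<Omega> \<inter> ball y (b (Suc j)). v a = 1}"
      define Z where "Z = {a \<in> \<Omega> \<inter> ball w (r/4). v a = 0}"
      have [measurable]: "\<Omega> \<in> sets borel" using \<Omega> by simp
      have AZ_meas: "A \<in> sets borel" "Z \<in> sets borel" unfolding A_def Z_def by measurable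
      have "emeasure lborel A = emeasure lborel (\<Omega> \<inter> ball y (b (Suc j)))"
        using v1 AZ_meas by (intro emeasure_eq_AE_lborel) (auto simp: A_def)
      then have eA: "emeasure lborel A = ennreal (F (b (Suc j)))"
        by (simp add: F_def emeasure_open_Int_ball[OF \<Omega>])
      have disj: "a \<notin> ball y (b j)" if "a \<in> ball w (r/4)" for a
        using that d b(2)[of j] dist_triangle[of y w a] by (auto simp: dist_commute)
      have "emeasure lborel Z = emeasure lborel (\<Omega> \<inter> ball w (r/4))"
      proof (intro emeasure_eq_AE_lborel)
        show "AE x in lebesgue. x \<in> Z \<longleftrightarrow> x \<in> \<Omega> \<inter> ball w (r/4)"
          using v0 by eventually_elim (use disj in \<open>auto simp: Z_def simp del: mem_ball\<close>)
      qed (use AZ_meas in auto)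
      then have eZ: "emeasure lborel Z = ennreal (measure lborel (\<Omega> \<inter> ball w (r/4)))"
        by (simp add: emeasure_open_Int_ball[OF \<Omega>])
      have FS: "0 < F (b (Suc j))" "F (b (Suc j)) \<le> F (r/4)"
        using measure_open_Int_ball_pos[OF \<Omega> y b'(1)] F_mono[OF b(2)[of "Suc j"]] by (auto simp: F_def)
      have "\<delta> (Suc j) powr (1 - \<theta>) \<le> C * r powr (s * p - real ?n) * (K * F (b j) * (b j - b (Suc j)) powr (- (s * p)))"
      proof (rule ratio[OF v AZ_meas])
        show "A \<subseteq> ball x r"
          using sub(1) subset_ball[OF b(2)[of "Suc j"], of y] unfolding A_def by blast
        show "Z \<subseteq> ball x r" using sub(2) unfolding Z_def by blast
        show "0 < \<delta> (Suc j)" "\<delta> (Suc j) \<le> 1" using FS Fy B by (auto simp: \<delta>_def)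
        have "\<delta> (Suc j) * (?\<omega> * r ^ ?n) = F (b (Suc j))"
          unfolding B_def[symmetric] using B by (simp add: \<delta>_def)
        then show "ennreal (\<delta> (Suc j) * (?\<omega> * r ^ ?n)) \<le> emeasure lborel A"
          "ennreal (\<delta> (Suc j) * (?\<omega> * r ^ ?n)) \<le> emeasure lborel Z"
          unfolding eA eZ using FS le by (auto simp: F_def intro!: ennreal_leI)
        show "0 \<le> K * F (b j) * (b j - b (Suc j)) powr (- (s * p))" using K by (simp add: F_def)
      qed (use r mod in \<open>auto simp: A_def Z_def\<close>)
      also have "\<dots> \<le> C * r powr (s * p - real ?n) * ((K + 1) * F (b j) * (b j - b (Suc j)) powr (- (s * p)))"
        using C K by (intro mult_left_mono mult_right_mono) (auto simp: F_def)
      also have "(b j - b (Suc j)) powr (- (s * p)) = r powr (- (s * p)) * 16 powr (s * p) * (2 powr (s * p)) ^ j"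
      proof -
        have "(b j - b (Suc j)) powr (- (s * p)) = (r / 16) powr (- (s * p)) * (dyadic j) powr (- (s * p))"
          unfolding b(4) by (rule powr_mult)
        also have "(r / 16) powr (- (s * p)) = r powr (- (s * p)) * 16 powr (s * p)"
          by (simp add: powr_divide powr_minus field_simps)
        also have "(dyadic j) powr (- (s * p)) = (2 powr (s * p)) ^ j"
          by (simp add: powr_powr mult_ac flip: powr_realpow)
        finally show ?thesis .
      qed
      also have "C * r powr (s * p - real ?n) * ((K + 1) * F (b j) * (r powr (- (s * p)) * 16 powr (s * p) * (2 powr (s * p)) ^ j))
        = M * (2 powr (s * p)) ^ j * \<delta> j"
      proof -
        have "r powr (s * p - real ?n) * r powr (- (s * p)) = 1 / r ^ ?n"
          using r by (simp add: powr_minus_divide powr_diff powr_realpow)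
        moreover have "C * a * (X * (e * Y * Z)) = C * (a * e) * (X * (Y * Z))" for a e X Y Z :: real
          by (simp only: mult_ac)
        ultimately have "C * r powr (s * p - real ?n) * ((K + 1) * F (b j) * (r powr (- (s * p)) * 16 powr (s * p) * (2 powr (s * p)) ^ j))
          = C * (1 / r ^ ?n) * ((K + 1) * F (b j) * (16 powr (s * p) * (2 powr (s * p)) ^ j))"
          by (simp only:)
        also have "\<dots> = M * (2 powr (s * p)) ^ j * \<delta> j"
          using r by (simp add: M_def \<delta>_def B_def less_imp_neq[OF unit_ball_vol_card_pos, symmetric])
        finally show ?thesis .
      qed
      finally show "\<delta> (Suc j) powr (1 - \<theta>) \<le> M * (2 powr (s * p)) ^ j * \<delta> j" .
    qed
    also have "\<delta> 0 = F (r / 4) / B" by (simp add: \<delta>_def b_def)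
    finally show "\<epsilon> * (?\<omega> * r ^ ?n) \<le> measure lborel (\<Omega> \<inter> ball y (r/4))"
      using B by (simp add: B_def F_def pos_le_divide_eq)
  qed
qed

text \<open>If \<open>\<Omega>\<close> leaves the ball around \<open>x\<close>, then by connectedness it has a point \<open>z\<close> at distance exactly \<open>r/2\<close>
from \<open>x\<close>, and the ball of radius \<open>r/4\<close> around \<open>x\<close> or \<open>z\<close> that contains less of \<open>\<Omega>\<close> still contains enough.
Otherwise \<open>\<Omega>\<close> is contained in the ball, and its total measure is a lower bound. This handles
\<open>r \<le> 1/8\<close>; passing to \<open>r/8\<close> covers all \<open>r \<le> 1\<close>.\<close>

theorem extension_imp_measure_density:
  fixes \<Omega> :: "(real^'n) set"
  assumes \<Omega>: "open \<Omega>" "connected \<Omega>" and s: "0 < s" "s < 1" and p: "p > 0" and q: "q > 0"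
    and E: "bounded_extension_operator s p q \<Omega> E"
  shows "measure_density_condition \<Omega>"
proof -
  let ?n = "CARD('n)" and ?\<omega> = "unit_ball_vol (real CARD('n))"
  obtain \<epsilon> where \<epsilon>: "\<epsilon> > 0" and density:
    "\<And>x y w r. 0 < r \<Longrightarrow> r \<le> 1/8 \<Longrightarrow> y \<in> \<Omega> \<Longrightarrow> ball y (r/4) \<subseteq> ball x r \<Longrightarrow> ball w (r/4) \<subseteq> ball x r \<Longrightarrow>
      dist y w = r / 2 \<Longrightarrow> measure lborel (\<Omega> \<inter> ball y (r/4)) \<le> measure lborel (\<Omega> \<inter> ball w (r/4)) \<Longrightarrow>
      \<epsilon> * (?\<omega> * r ^ ?n) \<le> measure lborel (\<Omega> \<inter> ball y (r/4))"
  proof -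
    show thesis
    proof (rule smaller_ball_density[OF \<Omega>(1) s p q E], goal_cases)
      case (1 C)
      show ?case by (rule that[of C]) (fact 1)+
    qed
  qed
  \<comment> \<open>A bounded \<open>\<Omega>\<close> that fits into the ball is measured by its total measure; the value 0 arises
    only for empty or infinite measure, where this case does not occur.\<close>
  define c0 where "c0 = (if measure lborel \<Omega> = 0 then \<epsilon> else measure lborel \<Omega> / ?\<omega>)"
  define c where "c = min \<epsilon> c0"
  have c: "c > 0" using \<epsilon> by (auto simp: c_def c0_def zero_less_measure_iff less_imp_neq[symmetric])
  have small: "c * (?\<omega> * r ^ ?n) \<le> measure lborel (\<Omega> \<inter> ball x r)" if x: "x \<in> \<Omega>" and r: "0 < r" "r \<le> 1/8" for x r
  proof (cases "\<Omega> \<subseteq> ball x r")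
    case True
    then have eq: "\<Omega> \<inter> ball x r = \<Omega>" by auto
    then have pos: "measure lborel \<Omega> > 0" using measure_open_Int_ball_pos[OF \<Omega>(1) x r(1)] by simp
    have "c * (?\<omega> * r ^ ?n) \<le> measure lborel \<Omega> / ?\<omega> * (?\<omega> * 1)"
      using pos r by (intro mult_mono) (auto simp: c_def c0_def power_le_one)
    then show ?thesis using eq by (simp add: less_imp_neq[OF unit_ball_vol_card_pos, symmetric])
  next
    case False
    then obtain a where a: "a \<in> \<Omega>" "a \<notin> ball x r" by blast
    have "connected ((\<lambda>a. dist x a) ` \<Omega>)"
      by (intro connected_continuous_image continuous_intros \<Omega>)
    then have "{dist x x..dist x a} \<subseteq> (\<lambda>a. dist x a) ` \<Omega>"
      using x a by (intro connected_contains_Icc) auto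
    then have "r / 2 \<in> (\<lambda>a. dist x a) ` \<Omega>" using a r by (auto simp: subset_iff not_less)
    then obtain z where z: "z \<in> \<Omega>" "dist x z = r / 2" by auto
    have sub: "ball x (r/4) \<subseteq> ball x r" "ball z (r/4) \<subseteq> ball x r"
    proof -
      show "ball x (r/4) \<subseteq> ball x r" using r by (intro subset_ball) simp
      show "ball z (r/4) \<subseteq> ball x r"
      proof
        fix a assume "a \<in> ball z (r/4)"
        then show "a \<in> ball x r" using z r dist_triangle[of x a z] by simp
      qed
    qed
    have "c * (?\<omega> * r ^ ?n) \<le> \<epsilon> * (?\<omega> * r ^ ?n)"
      using r by (intro mult_right_mono) (auto simp: c_def)
    also have "\<exists>y. ball y (r/4) \<subseteq> ball x r \<and> \<epsilon> * (?\<omega> * r ^ ?n) \<le> measure lborel (\<Omega> \<inter> ball y (r/4))"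
    proof (cases "measure lborel (\<Omega> \<inter> ball x (r/4)) \<le> measure lborel (\<Omega> \<inter> ball z (r/4))")
      case True
      then show ?thesis using density[OF r x sub z(2)] sub by blast
    next
      case False
      then show ?thesis using density[OF r z(1) sub(2,1)] z(2) sub by (auto simp: dist_commute)
    qed
    then obtain y where y: "ball y (r/4) \<subseteq> ball x r" "\<epsilon> * (?\<omega> * r ^ ?n) \<le> measure lborel (\<Omega> \<inter> ball y (r/4))"
      by blast
    note y(2)
    also have "measure lborel (\<Omega> \<inter> ball y (r/4)) \<le> measure lborel (\<Omega> \<inter> ball x r)"
      by (rule measure_Int_ball_mono[OF \<Omega>(1) y(1)])
    finally show ?thesis .
  qed
  show ?thesis
    unfolding measure_density_condition_def
  proof (intro exI[of _ "c * (1/8) ^ ?n"] conjI ballI allI impI)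
    show "c * (1/8) ^ ?n > 0" using c by simp
    fix x r assume x: "x \<in> \<Omega>" and r: "0 < r \<and> r \<le> (1::real)"
    have "c * (1/8) ^ ?n * measure lebesgue (ball x r) = c * (?\<omega> * (r / 8) ^ ?n)"
      using r by (subst measure_ball_cart) (simp_all add: power_divide)
    also have "\<dots> \<le> measure lborel (\<Omega> \<inter> ball x (r / 8))"
      using r by (intro small x) auto
    also have "\<dots> \<le> measure lborel (\<Omega> \<inter> ball x r)"
      using r by (intro measure_Int_ball_mono \<Omega> subset_ball) auto
    finally show "c * (1/8) ^ ?n * measure lebesgue (ball x r) \<le> measure lebesgue (\<Omega> \<inter> ball x r)"
      using \<Omega> by (simp add: measure_lebesgue_borel)
  qed
qed

section \<open>Trimmed means\<close>

lemma clamp_lipschitz: "\<bar>max 0 (min 1 a) - max 0 (min 1 b)\<bar> \<le> \<bar>a - b :: real\<bar>"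
  by (cases "a \<le> 0"; cases "a \<le> 1"; cases "b \<le> 0"; cases "b \<le> 1") (auto simp: max_def min_def)

text \<open>The cumulative weight of the trimming: it ignores the lowest and the highest quarter of the distribution and is
Lipschitz in between.\<close>

definition ramp :: "real \<Rightarrow> real" where
  "ramp P = max 0 (min 1 (2 * P - 1 / 2))"

lemma ramp_bounds: "0 \<le> ramp P" "ramp P \<le> 1"
  by (auto simp: ramp_def)

lemma ramp_lipschitz: "\<bar>ramp P - ramp Q\<bar> \<le> 2 * \<bar>P - Q\<bar>"
proof -
  from clamp_lipschitz[of "2 * P - 1 / 2" "2 * Q - 1 / 2"]
  have "\<bar>ramp P - ramp Q\<bar> \<le> \<bar>(2 * P - 1 / 2) - (2 * Q - 1 / 2)\<bar>"
    unfolding ramp_def .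
  also have "(2 * P - 1 / 2) - (2 * Q - 1 / 2) = 2 * (P - Q)" by simp
  finally show ?thesis by (simp only: abs_mult abs_numeral)
qed

lemma ramp_eq: "P \<le> 1/4 \<Longrightarrow> ramp P = 0" "P \<ge> 3/4 \<Longrightarrow> ramp P = 1"
  unfolding ramp_def by auto

lemma borel_measurable_ramp [measurable]: "ramp \<in> borel_measurable borel"
  unfolding ramp_def by measurable

definition upper_fraction :: "'a::euclidean_space set \<Rightarrow> ('a \<Rightarrow> real) \<Rightarrow> real \<Rightarrow> real" where
  "upper_fraction U u lev = measure lborel {y \<in> U. lev < u y} / measure lborel U"

text \<open>With \<open>P\<close> the decreasing upper distribution function of \<open>u\<close> on \<open>U\<close>, this layer-cake formula is the mean
of the quantiles of \<open>u\<close> between \<open>1/4\<close> and \<open>3/4\<close>: it would be the mean of \<open>u\<close> if \<open>ramp P\<close> were replaced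
by \<open>P\<close>. The indicator makes the integrand vanish for large negative levels.\<close>

definition trimmed_mean :: "'a::euclidean_space set \<Rightarrow> ('a \<Rightarrow> real) \<Rightarrow> real" where
  "trimmed_mean U u = integral\<^sup>L lborel (\<lambda>lev. ramp (upper_fraction U u lev) - indicator {..<0} lev)"

text \<open>Outside \<open>[a, b)\<close> the ramp is 0 or 1, so only levels in this interval contribute beyond \<open>a\<close>.\<close>

lemma ramp_integral:
  fixes P :: "real \<Rightarrow> real"
  assumes [measurable]: "P \<in> borel_measurable borel" and ab: "a \<le> b"
    and P: "\<And>x. x \<ge> b \<Longrightarrow> P x \<le> 1/4" "\<And>x. x < a \<Longrightarrow> P x \<ge> 3/4"
  shows "integrable lborel (\<lambda>x. indicator {a..<b} x * ramp (P x))"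
    "integral\<^sup>L lborel (\<lambda>x. ramp (P x) - indicator {..<0} x) = a + integral\<^sup>L lborel (\<lambda>x. indicator {a..<b} x * ramp (P x))"
proof -
  show int1: "integrable lborel (\<lambda>x. indicator {a..<b} x * ramp (P x))"
    by (rule Bochner_Integration.integrable_bound[where f="indicator {a..<b} :: real \<Rightarrow> real"])
      (use ab ramp_bounds in \<open>auto simp: indicator_def intro!: integrable_real_indicator\<close>)
  define J where "J x = indicator {0..<a} x - (indicator {a..<0} x :: real)" for x :: real
  have J: "integrable lborel J" "integral\<^sup>L lborel J = a"
  proof -
    have int: "integrable lborel (indicator {0..<a} :: real \<Rightarrow> real)" "integrable lborel (indicator {a..<0} :: real \<Rightarrow> real)"
      by (cases "a \<ge> 0"; force intro!: integrable_real_indicator)+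
    then show "integrable lborel J" unfolding J_def by (rule Bochner_Integration.integrable_diff)
    show "integral\<^sup>L lborel J = a"
      unfolding J_def Bochner_Integration.integral_diff[OF int] by (cases "a \<ge> 0") auto
  qed
  have "(\<lambda>x. ramp (P x) - indicator {..<0} x) = (\<lambda>x. J x + indicator {a..<b} x * ramp (P x))"
  proof
    fix x show "ramp (P x) - indicator {..<0} x = J x + indicator {a..<b} x * ramp (P x)"
      using P[of x] ramp_eq[of "P x"] ab by (auto simp: J_def indicator_def)
  qed
  then show "integral\<^sup>L lborel (\<lambda>x. ramp (P x) - indicator {..<0} x) = a + integral\<^sup>L lborel (\<lambda>x. indicator {a..<b} x * ramp (P x))"
    using int1 J by simp
qed

lemma ramp_integral_bounds:
  fixes P :: "real \<Rightarrow> real"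
  assumes P: "P \<in> borel_measurable borel" "a \<le> b"
    "\<And>x. x \<ge> b \<Longrightarrow> P x \<le> 1/4" "\<And>x. x < a \<Longrightarrow> P x \<ge> 3/4"
  shows "integral\<^sup>L lborel (\<lambda>x. ramp (P x) - indicator {..<0} x) \<in> {a..b}"
proof -
  have "0 \<le> integral\<^sup>L lborel (\<lambda>x. indicator {a..<b} x * ramp (P x))"
    by (intro integral_nonneg_AE) (auto simp: ramp_bounds)
  moreover have "integral\<^sup>L lborel (\<lambda>x. indicator {a..<b} x * ramp (P x)) \<le> integral\<^sup>L lborel (indicator {a..<b} :: real \<Rightarrow> real)"
    using P(2) by (intro integral_mono ramp_integral(1)[OF P]) (auto simp: indicator_def ramp_bounds)
  ultimately show ?thesis using ramp_integral(2)[OF P] P(2) by simp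
qed

lemma ramp_integral_diff:
  fixes P Q :: "real \<Rightarrow> real"
  assumes P: "P \<in> borel_measurable borel" "a \<le> b"
    "\<And>x. x \<ge> b \<Longrightarrow> P x \<le> 1/4" "\<And>x. x < a \<Longrightarrow> P x \<ge> 3/4"
    and Q: "Q \<in> borel_measurable borel" "\<And>x. x \<ge> b \<Longrightarrow> Q x \<le> 1/4" "\<And>x. x < a \<Longrightarrow> Q x \<ge> 3/4"
    and \<epsilon>: "\<And>x. \<bar>P x - Q x\<bar> \<le> \<epsilon>"
  shows "\<bar>integral\<^sup>L lborel (\<lambda>x. ramp (P x) - indicator {..<0} x) - integral\<^sup>L lborel (\<lambda>x. ramp (Q x) - indicator {..<0} x)\<bar>
     \<le> 2 * \<epsilon> * (b - a)"
proof -
  have intP: "integrable lborel (\<lambda>x. indicator {a..<b} x * ramp (P x))"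
    "integral\<^sup>L lborel (\<lambda>x. ramp (P x) - indicator {..<0} x) = a + integral\<^sup>L lborel (\<lambda>x. indicator {a..<b} x * ramp (P x))"
    by (rule ramp_integral[OF P(1,2)]; use P in simp)+
  have intQ: "integrable lborel (\<lambda>x. indicator {a..<b} x * ramp (Q x))"
    "integral\<^sup>L lborel (\<lambda>x. ramp (Q x) - indicator {..<0} x) = a + integral\<^sup>L lborel (\<lambda>x. indicator {a..<b} x * ramp (Q x))"
    by (rule ramp_integral[OF Q(1) P(2)]; use Q in simp)+
  have le: "ramp (P x) - ramp (Q x) \<le> 2 * \<epsilon>" "ramp (Q x) - ramp (P x) \<le> 2 * \<epsilon>" for x
  proof -
    have "\<bar>ramp (P x) - ramp (Q x)\<bar> \<le> 2 * \<epsilon>"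
      by (rule order_trans[OF ramp_lipschitz mult_left_mono[OF \<epsilon>]]) simp
    then show "ramp (P x) - ramp (Q x) \<le> 2 * \<epsilon>" "ramp (Q x) - ramp (P x) \<le> 2 * \<epsilon>"
      by (simp_all add: abs_le_iff)
  qed
  have "\<bar>integral\<^sup>L lborel (\<lambda>x. indicator {a..<b} x * ramp (P x)) - integral\<^sup>L lborel (\<lambda>x. indicator {a..<b} x * ramp (Q x))\<bar>
    = \<bar>integral\<^sup>L lborel (\<lambda>x. indicator {a..<b} x * ramp (P x) - indicator {a..<b} x * ramp (Q x))\<bar>"
    by (simp only: Bochner_Integration.integral_diff[OF intP(1) intQ(1)])
  also have "\<dots> \<le> integral\<^sup>L lborel (\<lambda>x. \<bar>indicator {a..<b} x * ramp (P x) - indicator {a..<b} x * ramp (Q x)\<bar>)"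
    by (rule integral_abs_bound)
  also have "\<dots> \<le> integral\<^sup>L lborel (\<lambda>x. 2 * \<epsilon> * indicator {a..<b} x)"
  proof (rule integral_mono)
    show "integrable lborel (\<lambda>x. \<bar>indicator {a..<b} x * ramp (P x) - indicator {a..<b} x * ramp (Q x)\<bar>)"
      by (intro integrable_abs Bochner_Integration.integrable_diff intP(1) intQ(1))
    show "integrable lborel (\<lambda>x. 2 * \<epsilon> * indicator {a..<b} x)"
      using P(2) by (intro integrable_mult_right integrable_real_indicator) auto
    show "\<bar>indicator {a..<b} x * ramp (P x) - indicator {a..<b} x * ramp (Q x)\<bar> \<le> 2 * \<epsilon> * indicator {a..<b} x" for x
      using le[of x] by (auto simp: indicator_def abs_le_iff)
  qed
  also have "\<dots> = 2 * \<epsilon> * (b - a)" using P(2) by simp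
  finally show ?thesis unfolding intP(2) intQ(2) by simp
qed

lemma borel_measurable_upper_fraction:
  fixes u :: "'a::euclidean_space \<Rightarrow> real"
  assumes [measurable]: "u \<in> borel_measurable borel" "U \<in> sets borel" and fin: "emeasure lborel U < \<infinity>"
  shows "upper_fraction U u \<in> borel_measurable borel"
proof -
  have "mono (\<lambda>lev. - upper_fraction U u lev)"
  proof (rule monoI)
    fix x y :: real assume "x \<le> y"
    moreover have "emeasure lborel {z \<in> U. x < u z} < \<infinity>"
      by (rule le_less_trans[OF emeasure_mono fin]) auto
    ultimately have "measure lborel {z \<in> U. y < u z} \<le> measure lborel {z \<in> U. x < u z}"
      unfolding measure_def by (intro enn2real_mono emeasure_mono) auto
    then show "- upper_fraction U u x \<le> - upper_fraction U u y"
      unfolding upper_fraction_def by (simp add: divide_right_mono)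
  qed
  from borel_measurable_mono[OF this] show ?thesis
    using borel_measurable_uminus_eq[of "upper_fraction U u" borel] by simp
qed

text \<open>If all but a quarter of \<open>U\<close> has values within \<open>K\<close> of \<open>c\<close>, then the trimming discards the rest.\<close>

lemma upper_fraction_trim:
  fixes u :: "'a::euclidean_space \<Rightarrow> real"
  assumes [measurable]: "u \<in> borel_measurable borel" "U \<in> sets borel" and fin: "emeasure lborel U < \<infinity>"
    and pos: "measure lborel U > 0" and dev: "measure lborel {y \<in> U. K < \<bar>u y - c\<bar>} \<le> measure lborel U / 4"
  shows "x \<ge> c + K \<Longrightarrow> upper_fraction U u x \<le> 1/4" "x < c - K \<Longrightarrow> upper_fraction U u x \<ge> 3/4"
proof -
  have sub: "measure lborel A \<le> measure lborel B" if "A \<subseteq> B" "B \<subseteq> U" "B \<in> sets borel" for A B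
    unfolding measure_def using that le_less_trans[OF emeasure_mono[OF that(2)] fin]
    by (intro enn2real_mono emeasure_mono) auto
  { assume "x \<ge> c + K"
    then have "measure lborel {y \<in> U. x < u y} \<le> measure lborel {y \<in> U. K < \<bar>u y - c\<bar>}"
      by (intro sub) auto
    with dev show "upper_fraction U u x \<le> 1/4"
      using pos by (simp add: upper_fraction_def field_simps) }
  { assume x: "x < c - K"
    have "measure lborel (U - {y \<in> U. K < \<bar>u y - c\<bar>}) = measure lborel U - measure lborel {y \<in> U. K < \<bar>u y - c\<bar>}"
      using fin by (intro measure_Diff) auto
    moreover have "measure lborel (U - {y \<in> U. K < \<bar>u y - c\<bar>}) \<le> measure lborel {y \<in> U. x < u y}"
      using x by (intro sub) auto
    ultimately show "upper_fraction U u x \<ge> 3/4"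
      using pos dev by (simp add: upper_fraction_def field_simps) }
qed

text \<open>Chebyshev's inequality. For \<open>A = 0\<close> the threshold is 0, and the claim says that \<open>u = c\<close> almost
everywhere.\<close>

lemma chebyshev_quarter:
  fixes u :: "'a::euclidean_space \<Rightarrow> real"
  assumes [measurable]: "u \<in> borel_measurable borel" "U \<in> sets borel" and fin: "emeasure lborel U < \<infinity>"
    and p: "p > 0" and m: "0 < m" "m \<le> measure lborel U" and A: "A \<ge> 0"
    "(\<integral>\<^sup>+y. indicator U y * epow p (u y - c) \<partial>lborel) \<le> ennreal A"
  shows "measure lborel {y \<in> U. (4 * A / m) powr (1 / p) < \<bar>u y - c\<bar>} \<le> m / 4"
proof -
  define K where "K = (4 * A / m) powr (1 / p)"
  let ?B = "{y \<in> U. K < \<bar>u y - c\<bar>}"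
  have finB: "emeasure lborel ?B < \<infinity>" by (rule le_less_trans[OF emeasure_mono fin]) auto
  show ?thesis unfolding K_def[symmetric]
  proof (cases "A = 0")
    case True
    then have "(\<integral>\<^sup>+y. indicator U y * epow p (u y - c) \<partial>lborel) = 0" using A by simp
    then have "AE y in lborel. indicator U y * epow p (u y - c) = 0"
      by (subst (asm) nn_integral_0_iff_AE) auto
    then have "AE y in lborel. y \<notin> ?B"
      by eventually_elim (use True in \<open>auto simp: K_def indicator_def\<close>)
    then have "emeasure lborel ?B = 0"
      by (subst (asm) AE_iff_measurable[OF _ refl]) auto
    then show "measure lborel ?B \<le> m / 4" using m by (simp add: measure_def)
  next
    case False
    then have Kp: "K powr p = 4 * A / m" using A m p by (simp add: K_def powr_powr)
    have "ennreal (4 * A / m) * emeasure lborel ?B = (\<integral>\<^sup>+y. ennreal (4 * A / m) * indicator ?B y \<partial>lborel)"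
      by (rule nn_integral_cmult_indicator[symmetric]) simp
    also have "\<dots> \<le> (\<integral>\<^sup>+y. indicator U y * epow p (u y - c) \<partial>lborel)"
      using p unfolding Kp[symmetric]
      by (intro nn_integral_mono) (auto simp: indicator_def K_def intro!: ennreal_leI powr_mono2)
    finally have "ennreal (4 * A / m) * emeasure lborel ?B \<le> ennreal A" using A by simp
    then have "4 * A / m * measure lborel ?B \<le> A"
      using finB A m by (simp add: emeasure_eq_ennreal_measure ennreal_le_iff flip: ennreal_mult)
    then show "measure lborel ?B \<le> m / 4" using False A m by (simp add: field_simps)
  qed
qed

text \<open>Trimming turns the weak type bound of \<open>chebyshev_quarter\<close> into a pointwise one, for every \<open>p > 0\<close>.\<close>

lemma trimmed_mean_error:
  fixes u :: "'a::euclidean_space \<Rightarrow> real"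
  assumes meas: "u \<in> borel_measurable borel" "U \<in> sets borel" and fin: "emeasure lborel U < \<infinity>"
    and p: "p > 0" and m: "0 < m" "m \<le> measure lborel U"
  shows "epow p (trimmed_mean U u - c)
    \<le> ennreal (4 / m) * (\<integral>\<^sup>+y. indicator U y * epow p (u y - c) \<partial>lborel)"
proof (cases "(\<integral>\<^sup>+y. indicator U y * epow p (u y - c) \<partial>lborel)")
  case (real A)
  define K where "K = (4 * A / m) powr (1 / p)"
  have "measure lborel {y \<in> U. K < \<bar>u y - c\<bar>} \<le> m / 4"
    unfolding K_def using real by (intro chebyshev_quarter[OF meas fin p m]) auto
  then have dev: "measure lborel {y \<in> U. K < \<bar>u y - c\<bar>} \<le> measure lborel U / 4" using m by simp
  have "trimmed_mean U u \<in> {c - K..c + K}"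
    unfolding trimmed_mean_def
  proof (rule ramp_integral_bounds)
    show "upper_fraction U u \<in> borel_measurable borel" by (rule borel_measurable_upper_fraction[OF meas fin])
    show "c - K \<le> c + K" by (simp add: K_def)
  qed (use upper_fraction_trim[OF meas fin _ dev] m in auto)
  then have "\<bar>trimmed_mean U u - c\<bar> powr p \<le> K powr p"
    using p by (intro powr_mono2) auto
  also have "\<dots> = 4 / m * A" using real m p by (simp add: K_def powr_powr)
  finally show ?thesis using real m by (simp add: ennreal_leI flip: ennreal_mult)
next
  case top
  then show ?thesis using m by (simp add: ennreal_mult_top)
qed

text \<open>For any \<open>c\<close>, both upper distribution functions are trimmed outside an interval of length \<open>2 K\<close> around
\<open>c\<close>, where \<open>K\<close> is comparable to the \<open>p\<close>-mean of \<open>|u - c|\<close> on \<open>V\<close>; in this interval they differ by at most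
\<open>\<epsilon>\<close>. Averaging over \<open>c = u z\<close> for \<open>z\<close> in \<open>V\<close> makes the bound independent of \<open>c\<close>.\<close>

lemma trimmed_mean_diff:
  fixes u :: "'a::euclidean_space \<Rightarrow> real"
  assumes meas: "u \<in> borel_measurable borel" "U \<in> sets borel" "U' \<in> sets borel" "V \<in> sets borel"
    and fin: "emeasure lborel V < \<infinity>" and sub: "U \<subseteq> V" "U' \<subseteq> V"
    and p: "p > 0" and m: "0 < m" "m \<le> measure lborel U" "m \<le> measure lborel U'"
    and \<epsilon>: "\<epsilon> > 0" "\<And>x. \<bar>upper_fraction U u x - upper_fraction U' u x\<bar> \<le> \<epsilon>"
  shows "epow p (trimmed_mean U u - trimmed_mean U' u)
    \<le> ennreal (4 * (4 * \<epsilon>) powr p / m\<^sup>2)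
       * (\<integral>\<^sup>+z. \<integral>\<^sup>+y. indicator V z * indicator V y * epow p (u y - u z) \<partial>lborel \<partial>lborel)"
proof -
  note [measurable] = meas
  have fin': "emeasure lborel U < \<infinity>" "emeasure lborel U' < \<infinity>"
    by (rule le_less_trans[OF emeasure_mono[OF sub(1)] fin], use meas in simp,
        rule le_less_trans[OF emeasure_mono[OF sub(2)] fin], use meas in simp)
  define k where "k = 4 * (4 * \<epsilon>) powr p / m"
  have k: "k > 0" using \<epsilon> m by (simp add: k_def)
  let ?d = "\<bar>trimmed_mean U u - trimmed_mean U' u\<bar> powr p"
  have *: "ennreal ?d \<le> ennreal k * (\<integral>\<^sup>+y. indicator V y * epow p (u y - c) \<partial>lborel)" for c
  proof (cases "(\<integral>\<^sup>+y. indicator V y * epow p (u y - c) \<partial>lborel)")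
    case (real A)
    define K where "K = (4 * A / m) powr (1 / p)"
    have A: "(\<integral>\<^sup>+y. indicator U y * epow p (u y - c) \<partial>lborel) \<le> ennreal A"
      "(\<integral>\<^sup>+y. indicator U' y * epow p (u y - c) \<partial>lborel) \<le> ennreal A"
      unfolding real(2)[symmetric] using sub by (auto intro!: nn_integral_mono simp: indicator_def)
    have "measure lborel {y \<in> U. K < \<bar>u y - c\<bar>} \<le> m / 4"
      unfolding K_def by (rule chebyshev_quarter[OF meas(1,2) fin'(1) p m(1,2) real(1) A(1)])
    moreover have "measure lborel {y \<in> U'. K < \<bar>u y - c\<bar>} \<le> m / 4"
      unfolding K_def by (rule chebyshev_quarter[OF meas(1,3) fin'(2) p m(1,3) real(1) A(2)])
    ultimately have dev: "measure lborel {y \<in> U. K < \<bar>u y - c\<bar>} \<le> measure lborel U / 4"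
      "measure lborel {y \<in> U'. K < \<bar>u y - c\<bar>} \<le> measure lborel U' / 4" using m by simp_all
    have "\<bar>trimmed_mean U u - trimmed_mean U' u\<bar> \<le> 2 * \<epsilon> * ((c + K) - (c - K))"
      unfolding trimmed_mean_def
    proof (rule ramp_integral_diff)
      show "upper_fraction U u \<in> borel_measurable borel" "upper_fraction U' u \<in> borel_measurable borel"
        using borel_measurable_upper_fraction meas fin' by blast+
      show "c - K \<le> c + K" by (simp add: K_def)
    qed (use upper_fraction_trim[OF meas(1,2) fin'(1) _ dev(1)] upper_fraction_trim[OF meas(1,3) fin'(2) _ dev(2)] m \<epsilon> in auto)
    then have "?d \<le> (4 * \<epsilon> * K) powr p" using p by (intro powr_mono2) (auto simp: algebra_simps)
    also have "\<dots> = k * A" using real m p by (simp add: K_def k_def powr_powr powr_mult)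
    finally show ?thesis using real k by (simp add: ennreal_leI flip: ennreal_mult)
  next
    case top
    then show ?thesis using k by (simp add: ennreal_mult_top)
  qed
  have "ennreal ?d * ennreal m \<le> ennreal ?d * emeasure lborel V"
  proof (intro mult_left_mono)
    have "ennreal m \<le> emeasure lborel U"
      using m fin' by (simp add: emeasure_eq_ennreal_measure)
    also have "\<dots> \<le> emeasure lborel V" using sub by (intro emeasure_mono) auto
    finally show "ennreal m \<le> emeasure lborel V" .
  qed simp
  also have "\<dots> = (\<integral>\<^sup>+z. ennreal ?d * indicator V z \<partial>lborel)"
    by (rule nn_integral_cmult_indicator[symmetric]) simp
  also have "\<dots> \<le> (\<integral>\<^sup>+z. ennreal k * (\<integral>\<^sup>+y. indicator V z * indicator V y * epow p (u y - u z) \<partial>lborel) \<partial>lborel)"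
    using * by (intro nn_integral_mono) (auto simp: indicator_def)
  also have "\<dots> = ennreal k * (\<integral>\<^sup>+z. \<integral>\<^sup>+y. indicator V z * indicator V y * epow p (u y - u z) \<partial>lborel \<partial>lborel)"
    (is "_ = ennreal k * ?DD")
    by (rule nn_integral_cmult) measurable
  finally have le: "ennreal ?d * ennreal m \<le> ennreal k * ?DD" .
  have dm: "ennreal (?d * m) = ennreal ?d * ennreal m"
    by (rule ennreal_mult) (use m in auto)
  have "ennreal ?d = ennreal (1 / m * (?d * m))" using m by simp
  also have "\<dots> = ennreal (1 / m) * ennreal (?d * m)"
    by (rule ennreal_mult) (use m in auto)
  also have "\<dots> \<le> ennreal (1 / m) * (ennreal k * ?DD)"
    unfolding dm by (intro mult_left_mono le) simp
  also have "\<dots> = ennreal (4 * (4 * \<epsilon>) powr p / m\<^sup>2) * ?DD"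
  proof -
    have "ennreal (1 / m) * ennreal k = ennreal (4 * (4 * \<epsilon>) powr p / m\<^sup>2)"
      using m k by (simp add: k_def power2_eq_square flip: ennreal_mult)
    then show ?thesis by (simp only: mult.assoc[symmetric])
  qed
  finally show ?thesis .
qed

lemma upper_fraction_bounds:
  fixes u :: "'a::euclidean_space \<Rightarrow> real"
  assumes "U \<in> sets borel" "emeasure lborel U < \<infinity>" "u \<in> borel_measurable borel"
  shows "0 \<le> upper_fraction U u x" "upper_fraction U u x \<le> 1"
proof -
  have "measure lborel {y \<in> U. x < u y} \<le> measure lborel U"
    unfolding measure_def using assms by (intro enn2real_mono emeasure_mono) auto
  then show "0 \<le> upper_fraction U u x" "upper_fraction U u x \<le> 1"
    by (auto simp: upper_fraction_def divide_le_eq_1 zero_less_measure_iff)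
qed

text \<open>Two sets between \<open>I\<close> and \<open>V\<close> differ by at most \<open>V - I\<close>, which bounds the change of both the numerator and
the denominator.\<close>

lemma upper_fraction_diff_le:
  fixes u :: "'a::euclidean_space \<Rightarrow> real"
  assumes meas[measurable]: "u \<in> borel_measurable borel" "U \<in> sets borel" "U' \<in> sets borel" "I \<in> sets borel" "V \<in> sets borel"
    and fin: "emeasure lborel V < \<infinity>" and sub: "I \<subseteq> U" "U \<subseteq> V" "I \<subseteq> U'" "U' \<subseteq> V"
    and m: "0 < m" "m \<le> measure lborel U" "m \<le> measure lborel U'"
    and \<Delta>: "measure lborel (V - I) \<le> \<Delta>"
  shows "\<bar>upper_fraction U u x - upper_fraction U' u x\<bar> \<le> 2 * \<Delta> / m"
proof -
  have mono: "measure lborel A \<le> measure lborel B" if "A \<subseteq> B" "B \<subseteq> V" "B \<in> sets borel" for A B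
    unfolding measure_def using that le_less_trans[OF emeasure_mono[OF that(2)] fin]
    by (intro enn2real_mono emeasure_mono) auto
  have near: "\<bar>measure lborel (U \<inter> G) - measure lborel (U' \<inter> G)\<bar> \<le> \<Delta>" if [measurable]: "G \<in> sets borel" for G
  proof -
    have "measure lborel (V \<inter> G) = measure lborel (I \<inter> G) + measure lborel ((V - I) \<inter> G)"
    proof -
      have "V \<inter> G = (I \<inter> G) \<union> ((V - I) \<inter> G)" using sub by auto
      moreover have "measure lborel ((I \<inter> G) \<union> ((V - I) \<inter> G)) = measure lborel (I \<inter> G) + measure lborel ((V - I) \<inter> G)"
        using sub by (intro measure_Union) (auto intro!: le_less_trans[OF emeasure_mono fin, THEN less_imp_neq, simplified])
      ultimately show ?thesis by simp
    qed
    moreover have "measure lborel ((V - I) \<inter> G) \<le> measure lborel (V - I)" by (rule mono) auto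
    moreover have "measure lborel (I \<inter> G) \<le> measure lborel (U \<inter> G)" "measure lborel (I \<inter> G) \<le> measure lborel (U' \<inter> G)"
      "measure lborel (U \<inter> G) \<le> measure lborel (V \<inter> G)" "measure lborel (U' \<inter> G) \<le> measure lborel (V \<inter> G)"
      using sub by (auto intro!: mono)
    ultimately show ?thesis using \<Delta> by linarith
  qed
  define a a' where "a = measure lborel (U \<inter> {y. x < u y})" and "a' = measure lborel (U' \<inter> {y. x < u y})"
  define M M' where "M = measure lborel U" and "M' = measure lborel U'"
  have d: "\<bar>a - a'\<bar> \<le> \<Delta>" "\<bar>M - M'\<bar> \<le> \<Delta>"
    using near[of "{y. x < u y}"] near[of UNIV] by (auto simp: a_def a'_def M_def M'_def)
  have a': "0 \<le> a'" "a' \<le> M'" using sub by (auto simp: a'_def M'_def intro!: mono)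
  have MM: "m \<le> M" "m \<le> M'" "M > 0" "M' > 0" using m by (auto simp: M_def M'_def)
  have "a / M - a' / M' = (a - a') / M + a' / M' * ((M' - M) / M)"
    using MM by (simp add: field_simps)
  also have "\<bar>\<dots>\<bar> \<le> \<bar>a - a'\<bar> / M + \<bar>a' / M'\<bar> * (\<bar>M' - M\<bar> / M)"
    using MM by (intro order_trans[OF abs_triangle_ineq]) (simp add: abs_mult)
  also have "\<dots> \<le> \<Delta> / m + 1 * (\<Delta> / m)"
    using d a' MM m by (intro add_mono mult_mono frac_le) (auto simp: abs_minus_commute)
  finally have "\<bar>a / M - a' / M'\<bar> \<le> 2 * \<Delta> / m" by simp
  moreover have "{y \<in> U. x < u y} = U \<inter> {y. x < u y}" "{y \<in> U'. x < u y} = U' \<inter> {y. x < u y}" by auto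
  ultimately show ?thesis
    unfolding upper_fraction_def a_def a'_def M_def M'_def by simp
qed

lemma borel_measurable_trimmed_mean_ball:
  fixes u :: "'a::euclidean_space \<Rightarrow> real"
  assumes [measurable]: "u \<in> borel_measurable borel" "\<Omega> \<in> sets borel" "r \<in> borel_measurable borel"
  shows "(\<lambda>x. trimmed_mean (\<Omega> \<inter> ball x (r x)) u) \<in> borel_measurable borel"
proof -
  have eq: "measure lborel {y \<in> \<Omega> \<inter> ball x (r x). lev < u y}
      = enn2real (\<integral>\<^sup>+y. indicator \<Omega> y * (if dist x y < r x \<and> lev < u y then 1 else 0) \<partial>lborel)" for x lev
  proof -
    have "emeasure lborel {y \<in> \<Omega> \<inter> ball x (r x). lev < u y} = (\<integral>\<^sup>+y. indicator {y \<in> \<Omega> \<inter> ball x (r x). lev < u y} y \<partial>lborel)"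
      by (subst nn_integral_indicator) auto
    also have "\<dots> = (\<integral>\<^sup>+y. indicator \<Omega> y * (if dist x y < r x \<and> lev < u y then 1 else 0) \<partial>lborel)"
      by (intro nn_integral_cong) (auto simp: indicator_def)
    finally show ?thesis by (simp add: measure_def)
  qed
  have eq': "measure lborel (\<Omega> \<inter> ball x (r x))
      = enn2real (\<integral>\<^sup>+y. indicator \<Omega> y * (if dist x y < r x then 1 else 0) \<partial>lborel)" for x
  proof -
    have "emeasure lborel (\<Omega> \<inter> ball x (r x)) = (\<integral>\<^sup>+y. indicator (\<Omega> \<inter> ball x (r x)) y \<partial>lborel)"
      by (subst nn_integral_indicator) auto
    also have "\<dots> = (\<integral>\<^sup>+y. indicator \<Omega> y * (if dist x y < r x then 1 else 0) \<partial>lborel)"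
      by (intro nn_integral_cong) (auto simp: indicator_def)
    finally show ?thesis by (simp add: measure_def)
  qed
  have [measurable]: "(indicator {..<0} :: real \<Rightarrow> real) \<in> borel_measurable borel" by simp
  show ?thesis
    unfolding trimmed_mean_def upper_fraction_def eq eq' by measurable
qed

section \<open>Trimmed means over balls meeting the domain\<close>

lemma power_diff_le:
  fixes a b :: real
  assumes "0 \<le> b" "b \<le> a"
  shows "a ^ Suc n - b ^ Suc n \<le> real (Suc n) * a ^ n * (a - b)"
proof (induction n)
  case (Suc n)
  have "a ^ Suc (Suc n) - b ^ Suc (Suc n) = a * (a ^ Suc n - b ^ Suc n) + (a - b) * b ^ Suc n"
    by (simp add: algebra_simps)
  also have "\<dots> \<le> a * (real (Suc n) * a ^ n * (a - b)) + (a - b) * a ^ Suc n"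
    using assms Suc by (intro add_mono mult_left_mono power_mono) auto
  finally show ?case by (simp add: algebra_simps)
qed simp

lemma ennreal_mult3: "a \<ge> 0 \<Longrightarrow> b \<ge> 0 \<Longrightarrow> c \<ge> 0 \<Longrightarrow> ennreal a * (ennreal b * ennreal c) = ennreal (a * b * c)"
  by (simp add: ennreal_mult mult.assoc)

text \<open>The telescoping sum is dominated by a geometric series.\<close>

lemma geometric_telescope:
  fixes t :: "nat \<Rightarrow> real"
  assumes "\<And>j. j < m \<Longrightarrow> \<bar>t j - t (Suc j)\<bar> \<le> Q * x ^ j" "0 < x" "x < 1" "Q \<ge> 0"
  shows "\<bar>t 0 - t m\<bar> \<le> Q / (1 - x)"
proof -
  have "\<bar>t 0 - t m\<bar> \<le> Q * (1 - x ^ m) / (1 - x)" using assms(1)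
  proof (induction m)
    case (Suc m)
    have "\<bar>t 0 - t (Suc m)\<bar> \<le> \<bar>t 0 - t m\<bar> + \<bar>t m - t (Suc m)\<bar>" by linarith
    also have "\<dots> \<le> Q * (1 - x ^ m) / (1 - x) + Q * x ^ m" using Suc by (intro add_mono) auto
    also have "\<dots> = Q * (1 - x ^ Suc m) / (1 - x)" using assms by (simp add: field_simps)
    finally show ?case .
  qed simp
  also have "\<dots> \<le> Q / (1 - x)"
    using assms by (intro divide_right_mono mult_left_le) auto
  finally show ?thesis .
qed

text \<open>The exponent of the influence of finer (\<open>t > 0\<close>) and coarser (\<open>t \<le> 0\<close>) scales. The slope 1 on the coarse
side comes from Lipschitz estimates; the small slope \<open>\<epsilon>\<close> on the fine side is the price for summing the
differences of consecutive trimmed means in \<open>L\<^sup>p\<close> for arbitrary \<open>p\<close>.\<close>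

definition bent :: "real \<Rightarrow> real \<Rightarrow> real" where
  "bent \<epsilon> t = (if t \<le> 0 then t else \<epsilon> * t)"

lemma bent_lipschitz:
  assumes "0 \<le> \<epsilon>" "\<epsilon> \<le> 1" shows "bent \<epsilon> t' \<le> bent \<epsilon> t + \<bar>t - t'\<bar>"
proof -
  have "t' > 0 \<Longrightarrow> \<epsilon> * t' \<le> t'" "t > 0 \<Longrightarrow> 0 \<le> \<epsilon> * t" "\<epsilon> * t' \<le> \<epsilon> * t + \<epsilon> * \<bar>t - t'\<bar>" "\<epsilon> * \<bar>t - t'\<bar> \<le> \<bar>t - t'\<bar>"
    using assms by (auto simp: mult_left_le_one_le distrib_left[symmetric] intro!: mult_left_mono)
  then show ?thesis unfolding bent_def by (cases "t \<le> 0"; cases "t' \<le> 0") auto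
qed

text \<open>The density is required around all points whose distance to \<open>\<Omega>\<close> is at most a third of the radius,
because trimmed means are taken around points outside \<open>\<Omega>\<close>. Accordingly \<open>\<sigma> x\<close>, three times the distance,
is the radius that belongs to \<open>x\<close>.\<close>

locale density_domain =
  fixes \<Omega> :: "(real^'n) set" and \<kappa> p s :: real
  assumes open_domain: "open \<Omega>" and ne: "\<Omega> \<noteq> {}" and \<kappa>: "\<kappa> > 0" and p: "p > 0" and s: "0 < s" "s < 1"
    and density: "\<And>x r. 0 < r \<Longrightarrow> r \<le> 1 \<Longrightarrow> 3 * infdist x \<Omega> \<le> r \<Longrightarrow> \<kappa> * r ^ CARD('n) \<le> measure lborel (\<Omega> \<inter> ball x r)"
begin

lemma domain_borel [measurable]: "\<Omega> \<in> sets borel"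
  using open_domain by simp

abbreviation "\<sigma> x \<equiv> 3 * infdist x \<Omega>"

definition loc_mean :: "(real^'n \<Rightarrow> real) \<Rightarrow> real^'n \<Rightarrow> real \<Rightarrow> real" where
  "loc_mean g x r = trimmed_mean (\<Omega> \<inter> ball x r) g"

text \<open>The mean of \<open>|g y - g z|\<^sup>p\<close> over pairs of points of \<open>\<Omega>\<close> in a dyadic ball around \<open>x\<close>, up to constants:
by the density condition, the part of \<open>\<Omega>\<close> in the ball has measure comparable to \<open>(2\<^sup>-\<^sup>l)\<^sup>n\<close>.\<close>

definition oscillation :: "(real^'n \<Rightarrow> real) \<Rightarrow> nat \<Rightarrow> real^'n \<Rightarrow> ennreal" where
  "oscillation g l x = ennreal (1 / ((dyadic l) ^ CARD('n))\<^sup>2) *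
     (\<integral>\<^sup>+z. \<integral>\<^sup>+y. indicator (\<Omega> \<inter> ball x (dyadic l)) z * indicator (\<Omega> \<inter> ball x (dyadic l)) y
        * epow p (g y - g z) \<partial>lborel \<partial>lborel)"

definition deviation :: "(real^'n \<Rightarrow> real) \<Rightarrow> nat \<Rightarrow> real^'n \<Rightarrow> ennreal" where
  "deviation g l x = ennreal (1 / (dyadic l) ^ CARD('n)) * (indicator \<Omega> x *
     (\<integral>\<^sup>+y. indicator (\<Omega> \<inter> ball x (dyadic l)) y * epow p (g y - g x) \<partial>lborel))"

definition scale_weight :: "nat \<Rightarrow> nat \<Rightarrow> real" where
  "scale_weight k j = 2 powr (p * bent (s / 2) (real j - real k))"

lemma scale_weight_pos [simp]: "scale_weight k j > 0" "scale_weight k j \<ge> 0" by (auto simp: scale_weight_def)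

text \<open>The oscillations at all scales, weighted by their influence on the scale \<open>2\<^sup>-\<^sup>k\<close>. The indices are shifted
because an oscillation over balls of radius \<open>2\<^sup>-\<^sup>j\<^sup>-\<^sup>1\<close> involves increments up to \<open>2\<^sup>-\<^sup>j\<close>, and only scales
below 1 are under control.\<close>

definition total_oscillation :: "(real^'n \<Rightarrow> real) \<Rightarrow> nat \<Rightarrow> real^'n \<Rightarrow> ennreal" where
  "total_oscillation g k x = (\<Sum>j. ennreal (scale_weight k (Suc j)) * oscillation g (Suc (Suc j)) x)"

lemma oscillation_le_total:
  assumes "j \<ge> 2"
  shows "oscillation g j x \<le> ennreal (1 / scale_weight k (j - 1)) * total_oscillation g k x"
proof -
  obtain i where i: "j = Suc (Suc i)" using assms by (metis One_nat_def Suc_1 Suc_le_D Suc_le_mono)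
  have "ennreal (scale_weight k (Suc i)) * oscillation g (Suc (Suc i)) x \<le> total_oscillation g k x"
    unfolding total_oscillation_def by (rule suminf_ge_term_ennreal)
  then have "ennreal (1 / scale_weight k (Suc i)) * (ennreal (scale_weight k (Suc i)) * oscillation g (Suc (Suc i)) x) \<le> ennreal (1 / scale_weight k (Suc i)) * total_oscillation g k x"
    by (rule mult_left_mono) simp
  moreover have "ennreal (1 / scale_weight k (Suc i)) * ennreal (scale_weight k (Suc i)) = 1"
    using less_imp_neq[OF scale_weight_pos(1), of k "Suc i"] by (simp flip: ennreal_mult)
  ultimately show ?thesis by (simp add: i mult.assoc[symmetric])
qed

text \<open>The case of \<open>trimmed_mean_diff\<close> in which \<open>V\<close> is the part of \<open>\<Omega>\<close> in a dyadic ball.\<close>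

lemma mean_diff_le_oscillation:
  assumes g: "g \<in> borel_measurable borel" and U: "U \<in> sets borel" "U' \<in> sets borel"
    "U \<subseteq> \<Omega> \<inter> ball x (dyadic l)" "U' \<subseteq> \<Omega> \<inter> ball x (dyadic l)"
    and \<mu>: "\<mu> > 0" "\<mu> * (dyadic l) ^ CARD('n) \<le> measure lborel U" "\<mu> * (dyadic l) ^ CARD('n) \<le> measure lborel U'"
    and e: "e > 0" "\<And>\<xi>. \<bar>upper_fraction U g \<xi> - upper_fraction U' g \<xi>\<bar> \<le> e"
  shows "epow p (trimmed_mean U g - trimmed_mean U' g) \<le> ennreal (4 * (4 * e) powr p / \<mu>\<^sup>2) * oscillation g l x"
proof -
  define R where "R = (dyadic l) ^ CARD('n)"
  have R: "R > 0" by (simp add: R_def)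
  have "epow p (trimmed_mean U g - trimmed_mean U' g)
    \<le> ennreal (4 * (4 * e) powr p / (\<mu> * R)\<^sup>2) * (\<integral>\<^sup>+z. \<integral>\<^sup>+y. indicator (\<Omega> \<inter> ball x (dyadic l)) z * indicator (\<Omega> \<inter> ball x (dyadic l)) y
        * epow p (g y - g z) \<partial>lborel \<partial>lborel)"
    using R \<mu> by (intro trimmed_mean_diff[OF g U(1,2) _ emeasure_Int_ball_finite U(3,4) p _ _ _ e]) (auto simp: R_def)
  also have "4 * (4 * e) powr p / (\<mu> * R)\<^sup>2 = 4 * (4 * e) powr p / \<mu>\<^sup>2 * (1 / R\<^sup>2)"
    by (simp add: power_mult_distrib)
  also have "ennreal \<dots> = ennreal (4 * (4 * e) powr p / \<mu>\<^sup>2) * ennreal (1 / R\<^sup>2)"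
    by (rule ennreal_mult) (use \<mu> R in auto)
  finally show ?thesis unfolding oscillation_def R_def by (simp only: mult.assoc)
qed

lemma mean_diff_le_oscillation':
  assumes g: "g \<in> borel_measurable borel" and U: "U \<in> sets borel" "U' \<in> sets borel"
    "U \<subseteq> \<Omega> \<inter> ball x (dyadic l)" "U' \<subseteq> \<Omega> \<inter> ball x (dyadic l)"
    and \<mu>: "\<mu> > 0" "\<mu> * (dyadic l) ^ CARD('n) \<le> measure lborel U" "\<mu> * (dyadic l) ^ CARD('n) \<le> measure lborel U'"
  shows "epow p (trimmed_mean U g - trimmed_mean U' g) \<le> ennreal (4 * 4 powr p / \<mu>\<^sup>2) * oscillation g l x"
proof -
  have "emeasure lborel U < \<infinity>" "emeasure lborel U' < \<infinity>"
    using le_less_trans[OF emeasure_mono[OF U(3)] emeasure_Int_ball_finite] le_less_trans[OF emeasure_mono[OF U(4)] emeasure_Int_ball_finite] by auto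
  then have "\<bar>upper_fraction U g \<xi> - upper_fraction U' g \<xi>\<bar> \<le> 1" for \<xi>
    using upper_fraction_bounds[OF U(1) _ g, of \<xi>] upper_fraction_bounds[OF U(2) _ g, of \<xi>]
    unfolding abs_le_iff by linarith
  from mean_diff_le_oscillation[OF g U \<mu> _ this] show ?thesis by simp
qed

text \<open>The passage from the radius \<open>\<sigma> x\<close> to a larger dyadic radius. Halving the radius repeatedly gives a chain of
trimmed means, in which a link at scale \<open>2\<^sup>-\<^sup>j\<close> is bounded by the oscillation there. The weights in
\<open>total_oscillation\<close> grow like \<open>2\<^sup>\<epsilon>\<^sup>p\<^sup>j\<close> on fine scales, hence the links decay like \<open>2\<^sup>-\<^sup>\<epsilon>\<^sup>j\<close> and their sum
converges, uniformly in the length of the chain.\<close>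

lemma mean_chain:
  "\<exists>C\<ge>0. \<forall>g\<in>borel_measurable borel. \<forall>x l k. 2 \<le> l \<longrightarrow> l \<le> k \<longrightarrow> k \<le> l + 3 \<longrightarrow> 0 < infdist x \<Omega> \<longrightarrow> \<sigma> x \<le> dyadic l \<longrightarrow>
     epow p (loc_mean g x (\<sigma> x) - loc_mean g x (dyadic l)) \<le> ennreal C * total_oscillation g k x"
proof -
  let ?n = "CARD('n)"
  define \<epsilon> where "\<epsilon> = s / 2"
  have \<epsilon>: "0 < \<epsilon>" "\<epsilon> < 1" using s by (auto simp: \<epsilon>_def)
  define \<mu> where "\<mu> = \<kappa> / 2 ^ ?n"
  have \<mu>: "\<mu> > 0" using \<kappa> by (simp add: \<mu>_def)
  define K where "K = 4 * 4 powr p / \<mu>\<^sup>2"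
  have K: "K > 0" using \<mu> by (simp add: K_def)
  define X where "X = 2 powr (- \<epsilon>)"
  have X: "0 < X" "X < 1" using \<epsilon> by (auto simp: X_def powr_less_one)
  \<comment> \<open>The factor \<open>2\<^sup>5\<^sup>p\<close> absorbs the distance of at most 3 between \<open>l\<close> and \<open>k\<close> and the index shift in
    \<open>total_oscillation\<close>.\<close>
  define C where "C = K * 2 powr (5 * p) * (1 / (1 - X)) powr p"
  show ?thesis
  proof (intro exI[of _ C] conjI ballI allI impI)
    show "C \<ge> 0" using K by (simp add: C_def)
    fix g :: "real^'n \<Rightarrow> real" and x l k
    assume g: "g \<in> borel_measurable borel" and l: "2 \<le> (l::nat)" and k: "l \<le> k" "k \<le> l + 3"
      and d: "0 < infdist x \<Omega>" and \<sigma>: "\<sigma> x \<le> dyadic l"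
    show "epow p (loc_mean g x (\<sigma> x) - loc_mean g x (dyadic l)) \<le> ennreal C * total_oscillation g k x"
    proof (cases "total_oscillation g k x")
      case (real F)
      obtain m where m: "m \<ge> l" "dyadic (Suc m) < \<sigma> x" "\<sigma> x \<le> dyadic m"
        using dyadic_scale_le[of "\<sigma> x" l] d \<sigma> by auto
      have step: "\<bar>loc_mean g x r - loc_mean g x (dyadic j)\<bar> \<le> (K * 2 powr (5 * p) * F) powr (1 / p) * X ^ (j - l)"
        if j: "l \<le> j" and r: "dyadic (Suc j) \<le> r" "r \<le> dyadic j" "\<sigma> x \<le> r" for j r
      proof -
        have r0: "r > 0" using d r by linarith
        have j1: "dyadic j \<le> (1::real)" using two_powr_neg_le_one[of "real j"] by simp
        have "\<mu> * (dyadic j) ^ ?n = \<kappa> * (dyadic (Suc j)) ^ ?n"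
          unfolding two_powr_neg_Suc by (simp add: \<mu>_def power_divide)
        also have "\<dots> \<le> \<kappa> * r ^ ?n" using r \<kappa> by (intro mult_left_mono power_mono) auto
        also have "\<dots> \<le> measure lborel (\<Omega> \<inter> ball x r)" using r r0 j1 by (intro density) auto
        finally have m1: "\<mu> * (dyadic j) ^ ?n \<le> measure lborel (\<Omega> \<inter> ball x r)" .
        also have "\<dots> \<le> measure lborel (\<Omega> \<inter> ball x (dyadic j))"
          using r by (intro measure_Int_ball_mono open_domain subset_ball) auto
        finally have m2: "\<mu> * (dyadic j) ^ ?n \<le> measure lborel (\<Omega> \<inter> ball x (dyadic j))" .
        have "epow p (loc_mean g x r - loc_mean g x (dyadic j)) \<le> ennreal K * oscillation g j x"
          unfolding loc_mean_def K_def using subset_ball[OF r(2), of x]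
          by (intro mean_diff_le_oscillation' g \<mu> m1 m2) auto
        also have "\<dots> \<le> ennreal K * (ennreal (1 / scale_weight k (j - 1)) * ennreal F)"
          unfolding real(2)[symmetric] using j l by (intro mult_left_mono oscillation_le_total) auto
        also have "\<dots> = ennreal (K * (1 / scale_weight k (j - 1)) * F)"
          by (rule ennreal_mult3) (use K real in auto)
        finally have "\<bar>loc_mean g x r - loc_mean g x (dyadic j)\<bar> powr p \<le> K * (1 / scale_weight k (j - 1)) * F"
          using K real by (subst (asm) ennreal_le_iff) (auto simp: less_imp_le)
        also have "\<dots> \<le> K * (2 powr (5 * p) * (X ^ (j - l)) powr p) * F"
        proof (intro mult_right_mono mult_left_mono)
          define t where "t = real (j - 1) - real k"
          define i where "i = real j - real l"
          have t: "t \<ge> i - 4" "i \<ge> 0" using j l k by (auto simp: t_def i_def of_nat_diff)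
          have "\<epsilon> * i \<le> i" "\<epsilon> * 4 \<le> 4" "\<epsilon> * (i - 4) \<le> \<epsilon> * t" using \<epsilon> t by (auto simp: mult_left_le_one_le intro: mult_left_mono)
          then have "\<epsilon> * i - 5 \<le> bent \<epsilon> t" using t unfolding bent_def by (auto simp: algebra_simps)
          then have "p * (\<epsilon> * i - 5) \<le> p * bent \<epsilon> t" using p by (intro mult_left_mono) auto
          then have "- (p * bent \<epsilon> t) \<le> 5 * p + - \<epsilon> * i * p" by (simp add: algebra_simps)
          then have "2 powr (- (p * bent \<epsilon> t)) \<le> 2 powr (5 * p) * 2 powr (- \<epsilon> * i * p)"
            by (simp add: powr_add[symmetric])
          moreover have "1 / scale_weight k (j - 1) = 2 powr (- (p * bent \<epsilon> t))"
            by (simp add: scale_weight_def t_def \<epsilon>_def powr_minus_divide)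
          moreover have "(X ^ (j - l)) powr p = 2 powr (- \<epsilon> * i * p)"
            using j by (simp add: X_def i_def powr_powr of_nat_diff flip: powr_realpow)
          ultimately show "1 / scale_weight k (j - 1) \<le> 2 powr (5 * p) * (X ^ (j - l)) powr p" by simp
        qed (use K real in auto)
        finally have "(\<bar>loc_mean g x r - loc_mean g x (dyadic j)\<bar> powr p) powr (1 / p)
            \<le> (K * (2 powr (5 * p) * (X ^ (j - l)) powr p) * F) powr (1 / p)"
          using p by (intro powr_mono2) auto
        also have "K * (2 powr (5 * p) * (X ^ (j - l)) powr p) * F = (K * 2 powr (5 * p) * F) * (X ^ (j - l)) powr p"
          by simp
        also have "((K * 2 powr (5 * p) * F) * (X ^ (j - l)) powr p) powr (1 / p) = (K * 2 powr (5 * p) * F) powr (1 / p) * X ^ (j - l)"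
          using p X by (subst powr_mult) (simp add: powr_powr)
        finally show ?thesis using p by (simp add: powr_powr)
      qed
      define Q where "Q = (K * 2 powr (5 * p) * F) powr (1 / p)"
      \<comment> \<open>The chain runs through the dyadic radii down to \<open>2\<^sup>-\<^sup>m\<close> and ends with \<open>\<sigma> x\<close>.\<close>
      define t where "t i = (if i \<le> m - l then loc_mean g x (dyadic (l + i)) else loc_mean g x (\<sigma> x))" for i
      have "\<bar>t 0 - t (Suc (m - l))\<bar> \<le> Q / (1 - X)"
      proof (rule geometric_telescope)
        fix i assume i: "i < Suc (m - l)"
        show "\<bar>t i - t (Suc i)\<bar> \<le> Q * X ^ i"
        proof (cases "i = m - l")
          case True
          then show ?thesis
            using step[of m "\<sigma> x"] m by (simp add: t_def Q_def abs_minus_commute)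
        next
          case False
          then have "Suc i \<le> m - l" using i by simp
          then have "- real m \<le> - real (Suc (l + i))" using m by simp
          then have "dyadic m \<le> (2::real) powr (- real (Suc (l + i)))" by (intro powr_mono) auto
          then have "\<sigma> x \<le> dyadic (Suc (l + i))" using m by linarith
          moreover have "dyadic (Suc (l + i)) \<le> (2::real) powr (- real (l + i))" by simp
          ultimately show ?thesis
            using step[of "l + i" "dyadic (Suc (l + i))"] \<open>Suc i \<le> m - l\<close>
            by (simp add: t_def Q_def abs_minus_commute)
        qed
      qed (use X in \<open>auto simp: Q_def\<close>)
      then have "\<bar>loc_mean g x (\<sigma> x) - loc_mean g x (dyadic l)\<bar> \<le> Q / (1 - X)"
        by (simp add: t_def abs_minus_commute)
      then have "\<bar>loc_mean g x (\<sigma> x) - loc_mean g x (dyadic l)\<bar> powr p \<le> (Q / (1 - X)) powr p"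
        using p by (intro powr_mono2) auto
      also have "(Q / (1 - X)) powr p = Q powr p * (1 / (1 - X)) powr p"
        by (simp add: powr_mult[symmetric])
      also have "Q powr p = K * 2 powr (5 * p) * F"
        using p K real by (simp add: Q_def powr_powr)
      also have "K * 2 powr (5 * p) * F * (1 / (1 - X)) powr p = C * F" by (simp add: C_def)
      finally show ?thesis using real K by (simp add: C_def ennreal_leI flip: ennreal_mult)
    next
      case top
      then show ?thesis using K X by (simp add: C_def ennreal_mult_top)
    qed
  qed
qed

text \<open>Inside \<open>\<Omega>\<close>, the value \<open>g x\<close> serves as the constant \<open>c\<close> in \<open>trimmed_mean_error\<close>.\<close>

lemma mean_near:
  "\<exists>C\<ge>0. \<forall>g\<in>borel_measurable borel. \<forall>x l. x \<in> \<Omega> \<longrightarrow> 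
     epow p (g x - loc_mean g x (dyadic l)) \<le> ennreal C * deviation g l x"
proof (intro exI[of _ "4 / \<kappa>"] conjI ballI allI impI)
  show "0 \<le> 4 / \<kappa>" using \<kappa> by simp
  fix g :: "real^'n \<Rightarrow> real" and x l assume g: "g \<in> borel_measurable borel" and x: "x \<in> \<Omega>"
  define R where "R = (dyadic l) ^ CARD('n)"
  have R: "R > 0" by (simp add: R_def)
  have "\<kappa> * R \<le> measure lborel (\<Omega> \<inter> ball x (dyadic l))"
    unfolding R_def using x two_powr_neg_le_one[of "real l"] by (intro density) auto
  then have "epow p (trimmed_mean (\<Omega> \<inter> ball x (dyadic l)) g - g x) \<le> ennreal (4 / (\<kappa> * R))
     * (\<integral>\<^sup>+y. indicator (\<Omega> \<inter> ball x (dyadic l)) y * epow p (g y - g x) \<partial>lborel)"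
    using R \<kappa> by (intro trimmed_mean_error[OF g _ emeasure_Int_ball_finite p]) auto
  also have "ennreal (4 / (\<kappa> * R)) = ennreal (4 / \<kappa>) * ennreal (1 / R)"
    using R \<kappa> by (subst ennreal_mult[symmetric]) auto
  finally show "epow p (g x - loc_mean g x (dyadic l)) \<le> ennreal (4 / \<kappa>) * deviation g l x"
    using x by (simp add: loc_mean_def deviation_def R_def mult.assoc abs_minus_commute)
qed

text \<open>Far from \<open>\<Omega>\<close> relative to \<open>h\<close>, the two balls contain a common concentric ball and lie in a common one, with
radii that differ by \<open>8 |h|\<close>. The distribution of \<open>g\<close> thus changes by a fraction of order \<open>|h| / \<sigma> x\<close>,
and so does the trimmed mean relative to the oscillation. This Lipschitz bound gives the decay
\<open>2\<^sup>(\<^sup>i\<^sup>-\<^sup>k\<^sup>)\<^sup>p\<close> on coarse scales.\<close>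

lemma mean_far:
  "\<exists>C\<ge>0. \<forall>g\<in>borel_measurable borel. \<forall>x h i k. 3 \<le> i \<longrightarrow> i \<le> k \<longrightarrow> h \<noteq> 0 \<longrightarrow> norm h \<le> dyadic k \<longrightarrow>
     dyadic (Suc i) < \<sigma> x \<longrightarrow> \<sigma> x \<le> dyadic i \<longrightarrow> 4 * norm h \<le> \<sigma> x \<longrightarrow>
     epow p (loc_mean g (x + h) (\<sigma> (x + h)) - loc_mean g x (\<sigma> x)) \<le> ennreal C * total_oscillation g k x"
proof -
  let ?n = "CARD('n)" and ?\<omega> = "unit_ball_vol (real CARD('n))"
  define N where "N = ?n - 1"
  have N: "?n = Suc N" by (simp add: N_def)
  \<comment> \<open>With \<open>\<rho>\<close> the radius of the dyadic ball below, both \<open>\<sigma> x\<close> and \<open>\<sigma> (x + h)\<close> are at least \<open>\<rho> / 16\<close>.\<close>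
  define \<mu> where "\<mu> = \<kappa> / 16 ^ ?n"
  have \<mu>: "\<mu> > 0" using \<kappa> by (simp add: \<mu>_def)
  define D where "D = 16 * ?\<omega> * real ?n / \<mu>"
  have D: "D > 0" using \<mu> by (simp add: D_def)
  define C where "C = 4 * (4 * D) powr p / \<mu>\<^sup>2 * 2 powr (2 * p)"
  show ?thesis
  proof (intro exI[of _ C] conjI ballI allI impI)
    show "C \<ge> 0" by (simp add: C_def)
    fix g :: "real^'n \<Rightarrow> real" and x h :: "real^'n" and i k
    assume g: "g \<in> borel_measurable borel" and i: "3 \<le> (i::nat)" "i \<le> k" and h: "h \<noteq> 0" "norm h \<le> dyadic k"
      and \<sigma>: "dyadic (Suc i) < \<sigma> x" "\<sigma> x \<le> dyadic i" "4 * norm h \<le> \<sigma> x"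
    define \<eta> where "\<eta> = norm h"
    have \<eta>: "\<eta> > 0" using h by (simp add: \<eta>_def)
    define \<rho> where "\<rho> = dyadic (i - 1)"
    have \<rho>: "dyadic i = \<rho> / 2" "dyadic (Suc i) = \<rho> / 4" "\<rho> > 0" "\<rho> \<le> 1"
    proof -
      have "real i = real (Suc (i - 1))" using i by simp
      then show "dyadic i = \<rho> / 2" unfolding \<rho>_def by (metis two_powr_neg_Suc)
      then show "dyadic (Suc i) = \<rho> / 4" by (simp only: two_powr_neg_Suc)
    qed (use two_powr_neg_le_one[of "real (i - 1)"] in \<open>auto simp: \<rho>_def\<close>)
    note \<sigma>' = \<sigma>[unfolded \<rho>(1,2) \<eta>_def[symmetric]]
    \<comment> \<open>The radius varies by at most \<open>3 |h|\<close> and the center by \<open>|h|\<close>, which explains \<open>\<sigma> x \<plusminus> 4 \<eta>\<close> below.\<close>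
    have tri: "\<bar>\<sigma> (x + h) - \<sigma> x\<bar> \<le> 3 * \<eta>"
      using infdist_triangle_abs[of "x + h" \<Omega> x] by (simp add: \<eta>_def dist_norm)
    define V where "V = \<Omega> \<inter> ball x (\<sigma> x + 4 * \<eta>)"
    define I where "I = \<Omega> \<inter> ball x (\<sigma> x - 4 * \<eta>)"
    define U where "U = \<Omega> \<inter> ball (x + h) (\<sigma> (x + h))"
    define U' where "U' = \<Omega> \<inter> ball x (\<sigma> x)"
    have [measurable]: "V \<in> sets borel" "I \<in> sets borel" "U \<in> sets borel" "U' \<in> sets borel"
      unfolding V_def I_def U_def U'_def by auto
    have dist_h: "dist x y \<le> dist (x + h) y + \<eta>" "dist (x + h) y \<le> dist x y + \<eta>" for y
      using dist_triangle[of x y "x + h"] dist_triangle[of "x + h" y x] by (auto simp: \<eta>_def dist_norm)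
    have sub: "I \<subseteq> U" "U \<subseteq> V" "I \<subseteq> U'" "U' \<subseteq> V"
    proof -
      show "I \<subseteq> U"
      proof
        fix y assume "y \<in> I"
        then show "y \<in> U" using tri dist_h(2)[of y] by (auto simp: I_def U_def)
      qed
      show "U \<subseteq> V"
      proof
        fix y assume "y \<in> U"
        then show "y \<in> V" using tri dist_h(1)[of y] by (auto simp: V_def U_def)
      qed
      show "I \<subseteq> U'" "U' \<subseteq> V" using \<eta> by (auto simp: I_def U'_def V_def)
    qed
    have V_sub: "V \<subseteq> \<Omega> \<inter> ball x \<rho>" using \<sigma>' by (auto simp: V_def)
    have meas: "\<mu> * \<rho> ^ ?n \<le> measure lborel (\<Omega> \<inter> ball z (\<sigma> z))" if "\<rho> / 16 \<le> \<sigma> z" "\<sigma> z \<le> 1" for z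
    proof -
      have "\<mu> * \<rho> ^ ?n = \<kappa> * (\<rho> / 16) ^ ?n" by (simp add: \<mu>_def power_divide)
      also have "\<dots> \<le> \<kappa> * \<sigma> z ^ ?n" using that \<rho> \<kappa> by (intro mult_left_mono power_mono) auto
      also have "\<dots> \<le> measure lborel (\<Omega> \<inter> ball z (\<sigma> z))" using that \<rho> by (intro density) auto
      finally show ?thesis .
    qed
    have mU: "\<mu> * \<rho> ^ ?n \<le> measure lborel U" "\<mu> * \<rho> ^ ?n \<le> measure lborel U'"
    proof -
      have "\<rho> / 16 \<le> \<sigma> (x + h)" "\<sigma> (x + h) \<le> 1" "\<rho> / 16 \<le> \<sigma> x" "\<sigma> x \<le> 1"
        using tri \<sigma>' \<rho>(3,4) unfolding abs_le_iff by linarith+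
      then show "\<mu> * \<rho> ^ ?n \<le> measure lborel U" "\<mu> * \<rho> ^ ?n \<le> measure lborel U'"
        unfolding U_def U'_def using meas by blast+
    qed
    define \<Delta> where "\<Delta> = ?\<omega> * (8 * real ?n * \<rho> ^ N * \<eta>)"
    have VI: "measure lborel (V - I) \<le> \<Delta>"
    proof -
      have "measure lborel (V - I) \<le> measure lborel (ball x (\<sigma> x + 4 * \<eta>) - ball x (\<sigma> x - 4 * \<eta>))"
      proof -
        have "emeasure lborel (ball x (\<sigma> x + 4 * \<eta>) - ball x (\<sigma> x - 4 * \<eta>)) < \<infinity>"
          by (rule le_less_trans[OF emeasure_mono emeasure_Int_ball_finite[of UNIV x "\<sigma> x + 4 * \<eta>"]]) auto
        then show ?thesis unfolding measure_def
          by (intro enn2real_mono emeasure_mono) (auto simp: V_def I_def)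
      qed
      also have "\<dots> = measure lborel (ball x (\<sigma> x + 4 * \<eta>)) - measure lborel (ball x (\<sigma> x - 4 * \<eta>))"
        using emeasure_Int_ball_finite[of UNIV x "\<sigma> x + 4 * \<eta>"] \<eta> by (intro measure_Diff) auto
      also have "\<dots> = ?\<omega> * ((\<sigma> x + 4 * \<eta>) ^ ?n - (\<sigma> x - 4 * \<eta>) ^ ?n)"
        using \<sigma>' \<eta> by (simp add: measure_def emeasure_ball_cart algebra_simps)
      also have "\<dots> \<le> ?\<omega> * (real ?n * (\<sigma> x + 4 * \<eta>) ^ N * (8 * \<eta>))"
        using power_diff_le[of "\<sigma> x - 4 * \<eta>" "\<sigma> x + 4 * \<eta>" N] \<sigma>' \<eta>
        unfolding N by (intro mult_left_mono) (auto simp: less_imp_le)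
      also have "\<dots> \<le> ?\<omega> * (real ?n * \<rho> ^ N * (8 * \<eta>))"
        using \<sigma>' \<eta> \<rho> by (intro mult_left_mono mult_right_mono power_mono) (auto simp: less_imp_le)
      finally show ?thesis by (simp add: \<Delta>_def mult_ac)
    qed
    have "epow p (trimmed_mean U g - trimmed_mean U' g)
        \<le> ennreal (4 * (4 * (2 * \<Delta> / (\<mu> * \<rho> ^ ?n))) powr p / \<mu>\<^sup>2) * oscillation g (i - 1) x"
    proof (rule mean_diff_le_oscillation[OF g _ _ _ _ \<mu> mU[unfolded \<rho>_def]])
      show "U \<subseteq> \<Omega> \<inter> ball x (2 powr - real (i - 1))" "U' \<subseteq> \<Omega> \<inter> ball x (2 powr - real (i - 1))"
        using sub V_sub unfolding \<rho>_def by auto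
      show "0 < 2 * \<Delta> / (\<mu> * \<rho> ^ ?n)" using \<mu> \<rho> \<eta> by (simp add: \<Delta>_def)
      show "\<bar>upper_fraction U g \<xi> - upper_fraction U' g \<xi>\<bar> \<le> 2 * \<Delta> / (\<mu> * \<rho> ^ ?n)" for \<xi>
        using g sub \<mu> \<rho> mU VI by (intro upper_fraction_diff_le[where V=V and I=I]) (auto simp: V_def emeasure_Int_ball_finite[simplified])
    qed auto
    also have "\<dots> \<le> ennreal (4 * (4 * (2 * \<Delta> / (\<mu> * \<rho> ^ ?n))) powr p / \<mu>\<^sup>2) * (ennreal (1 / scale_weight k (i - 1 - 1)) * total_oscillation g k x)"
      using i by (intro mult_left_mono oscillation_le_total) auto
    also have "\<dots> = ennreal (4 * (4 * (2 * \<Delta> / (\<mu> * \<rho> ^ ?n))) powr p / \<mu>\<^sup>2 * (1 / scale_weight k (i - 1 - 1))) * total_oscillation g k x"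
      by (subst ennreal_mult) (auto simp: mult.assoc)
    also have "\<dots> \<le> ennreal C * total_oscillation g k x"
    proof (intro mult_right_mono ennreal_leI)
      have "2 * \<Delta> / (\<mu> * \<rho> ^ ?n) = D * (\<eta> / \<rho>)"
        using \<rho> \<mu> unfolding \<Delta>_def D_def N by (simp add: field_simps)
      also have "\<dots> \<le> D * (2 powr (real i - 1 - real k))"
      proof (intro mult_left_mono)
        have "\<eta> / \<rho> \<le> dyadic k / \<rho>" using h \<rho> by (simp add: \<eta>_def divide_right_mono)
        also have "\<dots> = 2 powr (real i - 1 - real k)"
        proof -
          have "- real k - - real (i - 1) = real i - 1 - real k" using i by (simp add: of_nat_diff)
          then show ?thesis by (simp only: \<rho>_def powr_diff[symmetric])
        qed
        finally show "\<eta> / \<rho> \<le> 2 powr (real i - 1 - real k)" .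
      qed (use D in auto)
      finally have "(4 * (2 * \<Delta> / (\<mu> * \<rho> ^ ?n))) powr p \<le> (4 * D * 2 powr (real i - 1 - real k)) powr p"
        using p \<Delta>_def \<mu> \<rho> \<eta> by (intro powr_mono2) (auto simp: less_imp_le)
      also have "\<dots> = (4 * D) powr p * 2 powr ((real i - 1 - real k) * p)"
        using D by (subst powr_mult) (simp add: powr_powr)
      finally have 1: "(4 * (2 * \<Delta> / (\<mu> * \<rho> ^ ?n))) powr p \<le> (4 * D) powr p * 2 powr ((real i - 1 - real k) * p)" .
      have "1 / scale_weight k (i - 1 - 1) = 2 powr (- (p * (real i - 2 - real k)))"
        using i by (simp add: scale_weight_def bent_def of_nat_diff powr_minus_divide numeral_2_eq_2)
      also have "\<dots> \<le> 2 powr (2 * p) * 2 powr (- ((real i - 1 - real k) * p))"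
        using p by (simp add: algebra_simps flip: powr_add)
      finally have 2: "1 / scale_weight k (i - 1 - 1) \<le> 2 powr (2 * p) * 2 powr (- ((real i - 1 - real k) * p))" .
      have "4 * (4 * (2 * \<Delta> / (\<mu> * \<rho> ^ ?n))) powr p / \<mu>\<^sup>2 * (1 / scale_weight k (i - 1 - 1))
        \<le> 4 * ((4 * D) powr p * 2 powr ((real i - 1 - real k) * p)) / \<mu>\<^sup>2 * (2 powr (2 * p) * 2 powr (- ((real i - 1 - real k) * p)))"
        using 1 2 by (intro mult_mono divide_right_mono) auto
      also have "\<dots> = C * (2 powr ((real i - 1 - real k) * p) * 2 powr (- ((real i - 1 - real k) * p)))"
        by (simp add: C_def)
      also have "\<dots> = C" by (simp flip: powr_add)
      finally show "4 * (4 * (2 * \<Delta> / (\<mu> * \<rho> ^ ?n))) powr p / \<mu>\<^sup>2 * (1 / scale_weight k (i - 1 - 1)) \<le> C" .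
    qed auto
    finally show "epow p (loc_mean g (x + h) (\<sigma> (x + h)) - loc_mean g x (\<sigma> x)) \<le> ennreal C * total_oscillation g k x"
      unfolding loc_mean_def U_def U'_def .
  qed
qed

end

section \<open>Pointwise estimates for the extension\<close>

lemma ennreal_le_add_mult:
  fixes a :: ennreal
  assumes "a \<le> ennreal C * X" "X \<le> Y" "C \<le> D"
  shows "a \<le> ennreal D * Y"
  using assms by (meson ennreal_leI mult_mono order_trans zero_le)

lemma ennreal_collect:
  "0 \<le> a \<Longrightarrow> 0 \<le> M \<Longrightarrow> 0 \<le> N \<Longrightarrow>
    ennreal a * (ennreal M * T + ennreal N * T) = ennreal (a * (M + N)) * T"
  by (simp only: ennreal_mult ennreal_plus add_nonneg_nonneg distrib_right mult.assoc)

context density_domain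
begin

lemma borel_measurable_infdist [measurable]: "(\<lambda>x. infdist x \<Omega>) \<in> borel_measurable borel"
  by (intro borel_measurable_continuous_onI continuous_intros)

lemma borel_measurable_oscillation [measurable]:
  assumes [measurable]: "g \<in> borel_measurable borel"
  shows "oscillation g l \<in> borel_measurable borel"
  unfolding oscillation_def indicator_inter_arith by measurable

lemma borel_measurable_deviation [measurable]:
  assumes [measurable]: "g \<in> borel_measurable borel"
  shows "deviation g l \<in> borel_measurable borel"
  unfolding deviation_def indicator_inter_arith by measurable

lemma borel_measurable_total_oscillation [measurable]:
  assumes [measurable]: "g \<in> borel_measurable borel"
  shows "total_oscillation g k \<in> borel_measurable borel"
  unfolding total_oscillation_def by measurable

text \<open>The radius \<open>2\<^sup>-\<^sup>3\<close> exceeds \<open>\<sigma> x\<close> wherever the cutoff defined below is nonzero.\<close>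

definition local_energy :: "(real^'n \<Rightarrow> real) \<Rightarrow> real^'n \<Rightarrow> ennreal" where
  "local_energy g x = (\<integral>\<^sup>+y. indicator (\<Omega> \<inter> ball x (dyadic 3)) y * epow p (g y) \<partial>lborel)"

abbreviation "off_boundary x \<equiv> x \<in> \<Omega> \<or> 0 < infdist x \<Omega>"

abbreviation "fixed_scale_bound g x \<equiv> total_oscillation g 6 x + deviation g 3 x + local_energy g x"

abbreviation "pair_bound g k x h \<equiv> total_oscillation g k x + total_oscillation g k (x + h)
  + deviation g (k - 3) x + deviation g (k - 3) (x + h)"

lemma borel_measurable_local_energy [measurable]:
  assumes [measurable]: "g \<in> borel_measurable borel"
  shows "local_energy g \<in> borel_measurable borel"
  unfolding local_energy_def indicator_inter_arith by measurable

text \<open>Two points of a ball of radius \<open>\<rho>\<close> have distance less than \<open>2 \<rho>\<close>; integrating the center first leaves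
the double integral at scale \<open>2 \<rho>\<close>.\<close>

lemma integral_oscillation_le:
  assumes [measurable]: "g \<in> borel_measurable borel"
  shows "(\<integral>\<^sup>+x. oscillation g (Suc l) x \<partial>lborel)
    \<le> ennreal ((unit_ball_vol (real CARD('n)))\<^sup>2 * 2 ^ CARD('n)) * modulus_power p \<Omega> g (dyadic l)"
proof -
  let ?n = "CARD('n)" and ?\<omega> = "unit_ball_vol (real CARD('n))"
  define \<rho> where "\<rho> = dyadic (Suc l)"
  have \<rho>: "\<rho> > 0" "2 * \<rho> = dyadic l" unfolding \<rho>_def two_powr_neg_Suc by simp_all
  define H where "H z = (\<integral>\<^sup>+y. indicator \<Omega> z * indicator \<Omega> y * indicator (ball z (2 * \<rho>)) y * epow p (g z - g y) \<partial>lborel)" for z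
  have [measurable]: "H \<in> borel_measurable borel" unfolding H_def by measurable
  have point: "(\<integral>\<^sup>+z. \<integral>\<^sup>+y. indicator (\<Omega> \<inter> ball x \<rho>) z * indicator (\<Omega> \<inter> ball x \<rho>) y * epow p (g y - g z) \<partial>lborel \<partial>lborel)
     \<le> (\<integral>\<^sup>+z. indicator (ball z \<rho>) x * H z \<partial>lborel)" for x
  proof (intro nn_integral_mono)
    fix z
    show "(\<integral>\<^sup>+y. indicator (\<Omega> \<inter> ball x \<rho>) z * indicator (\<Omega> \<inter> ball x \<rho>) y * epow p (g y - g z) \<partial>lborel) \<le> indicator (ball z \<rho>) x * H z"
    proof (cases "z \<in> \<Omega> \<inter> ball x \<rho>")
      case True
      have "(\<integral>\<^sup>+y. indicator (\<Omega> \<inter> ball x \<rho>) z * indicator (\<Omega> \<inter> ball x \<rho>) y * epow p (g y - g z) \<partial>lborel) \<le> H z"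
        unfolding H_def
      proof (intro nn_integral_mono)
        fix y
        have "y \<in> ball x \<rho> \<Longrightarrow> y \<in> ball z (2 * \<rho>)"
          using True dist_triangle[of z y x] by (auto simp: dist_commute)
        then show "indicator (\<Omega> \<inter> ball x \<rho>) z * indicator (\<Omega> \<inter> ball x \<rho>) y * epow p (g y - g z)
          \<le> indicator \<Omega> z * indicator \<Omega> y * indicator (ball z (2 * \<rho>)) y * epow p (g z - g y)"
          using True by (auto simp: indicator_def abs_minus_commute simp del: mem_ball)
      qed
      then show ?thesis using True by (simp add: dist_commute)
    qed simp
  qed
  have "(\<integral>\<^sup>+x. oscillation g (Suc l) x \<partial>lborel)
     \<le> (\<integral>\<^sup>+x. ennreal (1 / (\<rho> ^ ?n)\<^sup>2) * (\<integral>\<^sup>+z. indicator (ball z \<rho>) x * H z \<partial>lborel) \<partial>lborel)"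
    unfolding oscillation_def \<rho>_def[symmetric] by (rule nn_integral_mono, rule mult_left_mono[OF point]) simp
  also have "\<dots> = ennreal (1 / (\<rho> ^ ?n)\<^sup>2) * (\<integral>\<^sup>+x. (\<integral>\<^sup>+z. indicator (ball z \<rho>) x * H z \<partial>lborel) \<partial>lborel)"
    by (rule nn_integral_cmult) measurable
  also have "(\<integral>\<^sup>+x. (\<integral>\<^sup>+z. indicator (ball z \<rho>) x * H z \<partial>lborel) \<partial>lborel) = (\<integral>\<^sup>+z. (\<integral>\<^sup>+x. indicator (ball z \<rho>) x * H z \<partial>lborel) \<partial>lborel)"
    by (rule lborel_pair.Fubini') measurable
  also have "\<dots> = (\<integral>\<^sup>+z. ennreal (?\<omega> * \<rho> ^ ?n) * H z \<partial>lborel)"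
  proof (intro nn_integral_cong)
    fix z
    have "(\<integral>\<^sup>+x. indicator (ball z \<rho>) x * H z \<partial>lborel) = (\<integral>\<^sup>+x. indicator (ball z \<rho>) x \<partial>lborel) * H z"
      by (rule nn_integral_multc) simp
    then show "(\<integral>\<^sup>+x. indicator (ball z \<rho>) x * H z \<partial>lborel) = ennreal (?\<omega> * \<rho> ^ ?n) * H z"
      using \<rho> by (simp add: emeasure_ball_cart)
  qed
  also have "\<dots> = ennreal (?\<omega> * \<rho> ^ ?n) * (\<integral>\<^sup>+z. H z \<partial>lborel)"
    by (rule nn_integral_cmult) measurable
  also have "ennreal (1 / (\<rho> ^ ?n)\<^sup>2) * \<dots> \<le> ennreal (1 / (\<rho> ^ ?n)\<^sup>2) * (ennreal (?\<omega> * \<rho> ^ ?n) * (ennreal (?\<omega> * (2 * \<rho>) ^ ?n) * modulus_power p \<Omega> g (2 * \<rho>)))"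
    unfolding H_def using \<rho> by (intro mult_left_mono double_integral_le_modulus) auto
  also have "\<dots> = (ennreal (1 / (\<rho> ^ ?n)\<^sup>2) * (ennreal (?\<omega> * \<rho> ^ ?n) * ennreal (?\<omega> * (2 * \<rho>) ^ ?n))) * modulus_power p \<Omega> g (2 * \<rho>)"
    by (simp only: mult.assoc)
  also have "ennreal (1 / (\<rho> ^ ?n)\<^sup>2) * (ennreal (?\<omega> * \<rho> ^ ?n) * ennreal (?\<omega> * (2 * \<rho>) ^ ?n)) = ennreal (1 / (\<rho> ^ ?n)\<^sup>2 * (?\<omega> * \<rho> ^ ?n) * (?\<omega> * (2 * \<rho>) ^ ?n))"
    by (rule ennreal_mult3) (use \<rho> in auto)
  also have "1 / (\<rho> ^ ?n)\<^sup>2 * (?\<omega> * \<rho> ^ ?n) * (?\<omega> * (2 * \<rho>) ^ ?n) = ?\<omega>\<^sup>2 * 2 ^ ?n"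
    using \<rho>(1) by (simp add: power_mult_distrib power2_eq_square field_simps)
  finally show ?thesis unfolding \<rho>(2) .
qed

lemma integral_deviation_le:
  assumes [measurable]: "g \<in> borel_measurable borel"
  shows "(\<integral>\<^sup>+x. deviation g l x \<partial>lborel) \<le> ennreal (unit_ball_vol (real CARD('n))) * modulus_power p \<Omega> g (dyadic l)"
proof -
  let ?n = "CARD('n)" and ?\<omega> = "unit_ball_vol (real CARD('n))"
  define \<rho> where "\<rho> = dyadic l"
  have \<rho>: "\<rho> > 0" by (simp add: \<rho>_def)
  have "(\<integral>\<^sup>+x. deviation g l x \<partial>lborel) = (\<integral>\<^sup>+x. ennreal (1 / \<rho> ^ ?n) * (\<integral>\<^sup>+y. indicator \<Omega> x * indicator \<Omega> y * indicator (ball x \<rho>) y * epow p (g x - g y) \<partial>lborel) \<partial>lborel)"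
    unfolding deviation_def \<rho>_def
    by (intro nn_integral_cong arg_cong[where f="(*) _"], subst nn_integral_cmult[symmetric])
      (auto intro!: nn_integral_cong simp: indicator_inter_arith abs_minus_commute mult.assoc)
  also have "\<dots> = ennreal (1 / \<rho> ^ ?n) * (\<integral>\<^sup>+x. (\<integral>\<^sup>+y. indicator \<Omega> x * indicator \<Omega> y * indicator (ball x \<rho>) y * epow p (g x - g y) \<partial>lborel) \<partial>lborel)"
    by (rule nn_integral_cmult) measurable
  also have "\<dots> \<le> ennreal (1 / \<rho> ^ ?n) * (ennreal (?\<omega> * \<rho> ^ ?n) * modulus_power p \<Omega> g \<rho>)"
    using \<rho> by (intro mult_left_mono double_integral_le_modulus) auto
  also have "\<dots> = ennreal (1 / \<rho> ^ ?n * (?\<omega> * \<rho> ^ ?n)) * modulus_power p \<Omega> g \<rho>"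
    using \<rho> by (subst ennreal_mult) (auto simp: mult.assoc)
  also have "1 / \<rho> ^ ?n * (?\<omega> * \<rho> ^ ?n) = ?\<omega>" using \<rho> by simp
  finally show ?thesis unfolding \<rho>_def .
qed

lemma integral_local_energy_le:
  assumes [measurable]: "g \<in> borel_measurable borel"
  shows "(\<integral>\<^sup>+x. local_energy g x \<partial>lborel) \<le> ennreal (unit_ball_vol (real CARD('n))) * lp_energy p \<Omega> g"
proof -
  let ?n = "CARD('n)" and ?\<omega> = "unit_ball_vol (real CARD('n))"
  define \<rho> where "\<rho> = dyadic 3"
  have \<rho>: "\<rho> > 0" "\<rho> \<le> 1" using two_powr_neg_le_one[of "real 3"] by (auto simp: \<rho>_def)
  have "(\<integral>\<^sup>+x. local_energy g x \<partial>lborel) = (\<integral>\<^sup>+x. \<integral>\<^sup>+y. indicator (ball y \<rho>) x * (indicator \<Omega> y * epow p (g y)) \<partial>lborel \<partial>lborel)"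
    unfolding local_energy_def \<rho>_def[symmetric]
    by (intro nn_integral_cong) (auto simp: indicator_def dist_commute)
  also have "\<dots> = (\<integral>\<^sup>+y. \<integral>\<^sup>+x. indicator (ball y \<rho>) x * (indicator \<Omega> y * epow p (g y)) \<partial>lborel \<partial>lborel)"
    by (rule lborel_pair.Fubini') measurable
  also have "\<dots> = (\<integral>\<^sup>+y. ennreal (?\<omega> * \<rho> ^ ?n) * (indicator \<Omega> y * epow p (g y)) \<partial>lborel)"
  proof (intro nn_integral_cong)
    fix y
    have "(\<integral>\<^sup>+x. indicator (ball y \<rho>) x * (indicator \<Omega> y * epow p (g y)) \<partial>lborel)
       = (\<integral>\<^sup>+x. indicator (ball y \<rho>) x \<partial>lborel) * (indicator \<Omega> y * epow p (g y))"
      by (rule nn_integral_multc) simp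
    then show "(\<integral>\<^sup>+x. indicator (ball y \<rho>) x * (indicator \<Omega> y * epow p (g y)) \<partial>lborel)
       = ennreal (?\<omega> * \<rho> ^ ?n) * (indicator \<Omega> y * epow p (g y))"
      using \<rho> by (simp add: emeasure_ball_cart)
  qed
  also have "\<dots> = ennreal (?\<omega> * \<rho> ^ ?n) * lp_energy p \<Omega> g"
    unfolding lp_energy_lborel by (rule nn_integral_cmult) measurable
  also have "\<dots> \<le> ennreal ?\<omega> * lp_energy p \<Omega> g"
    using \<rho> by (intro mult_right_mono ennreal_leI) (auto intro!: mult_left_le power_le_one simp: less_imp_le)
  finally show ?thesis .
qed

text \<open>On the boundary of \<open>\<Omega>\<close>, \<open>\<sigma> x = 0\<close> and the trimmed mean over the empty set is a junk value; by
\<open>boundary_null\<close> below this concerns a null set only.\<close>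

definition raw_extension :: "(real^'n \<Rightarrow> real) \<Rightarrow> real^'n \<Rightarrow> real" where
  "raw_extension g x = (if x \<in> \<Omega> then g x else loc_mean g x (\<sigma> x))"

text \<open>Equal to 1 for \<open>\<sigma> x \<le> 1/32\<close> and to 0 for \<open>\<sigma> x \<ge> 1/16\<close>: where it is nonzero, all balls in use have radius
well below 1, as required by the density condition and by the range of the modulus.\<close>

definition cutoff :: "real^'n \<Rightarrow> real" where
  "cutoff x = max 0 (min 1 (2 - 32 * \<sigma> x))"

definition extension :: "(real^'n \<Rightarrow> real) \<Rightarrow> real^'n \<Rightarrow> real" where
  "extension g x = cutoff x * raw_extension g x"

lemma borel_measurable_extension [measurable]:
  assumes [measurable]: "g \<in> borel_measurable borel"
  shows "extension g \<in> borel_measurable borel"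
proof -
  have [measurable]: "(\<lambda>x. loc_mean g x (\<sigma> x)) \<in> borel_measurable borel"
    unfolding loc_mean_def by (rule borel_measurable_trimmed_mean_ball) measurable
  show ?thesis unfolding extension_def raw_extension_def cutoff_def by measurable
qed

lemma extension_eq_on_domain: "x \<in> \<Omega> \<Longrightarrow> extension g x = g x"
  by (simp add: extension_def raw_extension_def cutoff_def)

text \<open>At a point that is close to \<open>\<Omega>\<close> relative to \<open>2\<^sup>-\<^sup>l\<close>, the extension is close to the trimmed mean at that
scale: by \<open>mean_near\<close> inside \<open>\<Omega>\<close> and by \<open>mean_chain\<close> outside.\<close>

lemma raw_extension_near:
  "\<exists>C\<ge>0. \<forall>g\<in>borel_measurable borel. \<forall>x l k. 2 \<le> l \<longrightarrow> l \<le> k \<longrightarrow> k \<le> l + 3 \<longrightarrow> off_boundary x \<longrightarrow> \<sigma> x \<le> dyadic l \<longrightarrow>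
     epow p (raw_extension g x - loc_mean g x (dyadic l)) \<le> ennreal C * (total_oscillation g k x + deviation g l x)"
proof -
  obtain C1 where C1: "C1 \<ge> 0" "\<forall>g\<in>borel_measurable borel. \<forall>x l k. 2 \<le> l \<longrightarrow> l \<le> k \<longrightarrow> k \<le> l + 3 \<longrightarrow> 0 < infdist x \<Omega> \<longrightarrow> \<sigma> x \<le> dyadic l \<longrightarrow>
     epow p (loc_mean g x (\<sigma> x) - loc_mean g x (dyadic l)) \<le> ennreal C1 * total_oscillation g k x"
    using mean_chain by blast
  obtain C2 where C2: "C2 \<ge> 0" "\<forall>g\<in>borel_measurable borel. \<forall>x l. x \<in> \<Omega> \<longrightarrow> 
     epow p (g x - loc_mean g x (dyadic l)) \<le> ennreal C2 * deviation g l x"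
    using mean_near by blast
  show ?thesis
  proof (intro exI[of _ "max C1 C2"] conjI ballI allI impI)
    show "max C1 C2 \<ge> 0" using C1 by simp
    fix g :: "real^'n \<Rightarrow> real" and x l k
    assume A: "g \<in> borel_measurable borel" "2 \<le> (l::nat)" "l \<le> k" "k \<le> l + 3" "off_boundary x" "\<sigma> x \<le> dyadic l"
    show "epow p (raw_extension g x - loc_mean g x (dyadic l)) \<le> ennreal (max C1 C2) * (total_oscillation g k x + deviation g l x)"
    proof (cases "x \<in> \<Omega>")
      case True
      then have "epow p (raw_extension g x - loc_mean g x (dyadic l)) \<le> ennreal C2 * deviation g l x"
        using C2(2) A by (simp add: raw_extension_def)
      then show ?thesis by (rule ennreal_le_add_mult) (auto intro: add_increasing)
    next
      case False
      then have "epow p (raw_extension g x - loc_mean g x (dyadic l)) \<le> ennreal C1 * total_oscillation g k x"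
        using C1(2)[rule_format, OF A(1-4) _ A(6)] A(5) by (simp add: raw_extension_def)
      then show ?thesis by (rule ennreal_le_add_mult) (auto intro: add_increasing2)
    qed
  qed
qed

lemma mean_shift:
  "\<exists>C\<ge>0. \<forall>g\<in>borel_measurable borel. \<forall>x h l k. 3 \<le> l \<longrightarrow> l \<le> k \<longrightarrow> k \<le> l + 3 \<longrightarrow> norm h \<le> dyadic l \<longrightarrow>
     \<sigma> x \<le> dyadic l \<longrightarrow> \<sigma> (x + h) \<le> dyadic l \<longrightarrow>
     epow p (loc_mean g (x + h) (dyadic l) - loc_mean g x (dyadic l)) \<le> ennreal C * total_oscillation g k x"
proof -
  define \<mu> where "\<mu> = \<kappa> / 2 ^ CARD('n)"
  have \<mu>: "\<mu> > 0" using \<kappa> by (simp add: \<mu>_def)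
  define C where "C = 4 * 4 powr p / \<mu>\<^sup>2 * 2 powr (5 * p)"
  show ?thesis
  proof (intro exI[of _ C] conjI ballI allI impI)
    show "C \<ge> 0" by (simp add: C_def)
    fix g :: "real^'n \<Rightarrow> real" and x h :: "real^'n" and l k :: nat
    assume g: "g \<in> borel_measurable borel" and l: "3 \<le> l" "l \<le> k" "k \<le> l + 3" and h: "norm h \<le> dyadic l"
      and \<sigma>: "\<sigma> x \<le> dyadic l" "\<sigma> (x + h) \<le> dyadic l"
    define \<rho> where "\<rho> = dyadic (l - 1)"
    have \<rho>: "dyadic l = \<rho> / 2" "\<rho> > 0" "\<rho> \<le> 1"
    proof -
      have "real l = real (Suc (l - 1))" using l by simp
      then show "dyadic l = \<rho> / 2" unfolding \<rho>_def by (metis two_powr_neg_Suc)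
    qed (use two_powr_neg_le_one[of "real (l - 1)"] in \<open>auto simp: \<rho>_def\<close>)
    have meas: "\<mu> * \<rho> ^ CARD('n) \<le> measure lborel (\<Omega> \<inter> ball z (\<rho> / 2))" if "\<sigma> z \<le> \<rho> / 2" for z
    proof -
      have "\<mu> * \<rho> ^ CARD('n) = \<kappa> * (\<rho> / 2) ^ CARD('n)" by (simp add: \<mu>_def power_divide)
      also have "\<dots> \<le> measure lborel (\<Omega> \<inter> ball z (\<rho> / 2))" using that \<rho> by (intro density) auto
      finally show ?thesis .
    qed
    have sub: "ball (x + h) (\<rho> / 2) \<subseteq> ball x \<rho>"
    proof
      fix y assume "y \<in> ball (x + h) (\<rho> / 2)"
      then show "y \<in> ball x \<rho>" using h \<rho> dist_triangle[of x y "x + h"] by (auto simp: dist_norm)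
    qed
    have "epow p (loc_mean g (x + h) (dyadic l) - loc_mean g x (dyadic l)) \<le> ennreal (4 * 4 powr p / \<mu>\<^sup>2) * oscillation g (l - 1) x"
      unfolding loc_mean_def \<rho>(1)
    proof (rule mean_diff_le_oscillation'[OF g _ _ _ _ \<mu>, where l="l - 1", folded \<rho>_def])
      show "\<Omega> \<inter> ball (x + h) (\<rho> / 2) \<subseteq> \<Omega> \<inter> ball x \<rho>" using sub by blast
      have "ball x (\<rho> / 2) \<subseteq> ball x \<rho>" using \<rho>(2) by (intro subset_ball) simp
      then show "\<Omega> \<inter> ball x (\<rho> / 2) \<subseteq> \<Omega> \<inter> ball x \<rho>" by blast
    qed (use meas \<sigma> \<rho>(1) in auto)
    also have "\<dots> \<le> ennreal (4 * 4 powr p / \<mu>\<^sup>2) * (ennreal (1 / scale_weight k (l - 1 - 1)) * total_oscillation g k x)"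
      using l by (intro mult_left_mono oscillation_le_total) auto
    also have "\<dots> \<le> ennreal (4 * 4 powr p / \<mu>\<^sup>2) * (ennreal (2 powr (5 * p)) * total_oscillation g k x)"
    proof (intro mult_left_mono mult_right_mono ennreal_leI)
      have "real (l - 1 - 1) - real k = real l - 2 - real k" using l by (simp add: of_nat_diff)
      then have "1 / scale_weight k (l - 1 - 1) = 2 powr (- (p * (real l - 2 - real k)))"
        using l by (simp add: scale_weight_def bent_def powr_minus_divide)
      also have "\<dots> \<le> 2 powr (5 * p)"
      proof (intro powr_mono)
        have "p * (- 5) \<le> p * (real l - 2 - real k)" using p l by (intro mult_left_mono) auto
        then show "- (p * (real l - 2 - real k)) \<le> 5 * p" by simp
      qed simp
      finally show "1 / scale_weight k (l - 1 - 1) \<le> 2 powr (5 * p)" .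
    qed auto
    also have "\<dots> = ennreal C * total_oscillation g k x"
      unfolding C_def by (subst ennreal_mult) (auto simp: mult.assoc)
    finally show "epow p (loc_mean g (x + h) (dyadic l) - loc_mean g x (dyadic l)) \<le> ennreal C * total_oscillation g k x" .
  qed
qed

text \<open>If \<open>x\<close> is close to \<open>\<Omega>\<close> relative to \<open>h\<close>, so is \<open>x + h\<close>, and both values are compared with trimmed means at the
scale \<open>2\<^sup>-\<^sup>l\<close> slightly above \<open>|h|\<close>, which are close to each other by \<open>mean_shift\<close>. Otherwise both points lie
outside \<open>\<Omega>\<close>, and \<open>mean_far\<close> applies at the scale of \<open>\<sigma> x\<close>.\<close>

lemma raw_extension_diff:
  "\<exists>C\<ge>0. \<forall>g\<in>borel_measurable borel. \<forall>x h k. 7 \<le> k \<longrightarrow> h \<noteq> 0 \<longrightarrow> norm h \<le> dyadic k \<longrightarrow>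
     off_boundary x \<longrightarrow> off_boundary (x + h) \<longrightarrow> \<sigma> x \<le> dyadic 3 \<longrightarrow>
     epow p (raw_extension g (x + h) - raw_extension g x)
       \<le> ennreal C * pair_bound g k x h"
proof -
  obtain C1 where C1: "C1 \<ge> 0" "\<And>g x l k. g\<in>borel_measurable borel \<Longrightarrow> 2 \<le> l \<Longrightarrow> l \<le> k \<Longrightarrow> k \<le> l + 3 \<Longrightarrow> off_boundary x \<Longrightarrow> \<sigma> x \<le> dyadic l \<Longrightarrow>
     epow p (raw_extension g x - loc_mean g x (dyadic l)) \<le> ennreal C1 * (total_oscillation g k x + deviation g l x)"
    using raw_extension_near by blast
  obtain C2 where C2: "C2 \<ge> 0" "\<And>g x h l k. g\<in>borel_measurable borel \<Longrightarrow> 3 \<le> l \<Longrightarrow> l \<le> k \<Longrightarrow> k \<le> l + 3 \<Longrightarrow> norm h \<le> dyadic l \<Longrightarrow>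
     \<sigma> x \<le> dyadic l \<Longrightarrow> \<sigma> (x + h) \<le> dyadic l \<Longrightarrow>
     epow p (loc_mean g (x + h) (dyadic l) - loc_mean g x (dyadic l)) \<le> ennreal C2 * total_oscillation g k x"
    using mean_shift by blast
  obtain C3 where C3: "C3 \<ge> 0" "\<And>g x h i k. g\<in>borel_measurable borel \<Longrightarrow> 3 \<le> i \<Longrightarrow> i \<le> k \<Longrightarrow> h \<noteq> 0 \<Longrightarrow> norm h \<le> dyadic k \<Longrightarrow>
     dyadic (Suc i) < \<sigma> x \<Longrightarrow> \<sigma> x \<le> dyadic i \<Longrightarrow> 4 * norm h \<le> \<sigma> x \<Longrightarrow>
     epow p (loc_mean g (x + h) (\<sigma> (x + h)) - loc_mean g x (\<sigma> x)) \<le> ennreal C3 * total_oscillation g k x"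
    using mean_far by blast
  define M where "M = max C1 C2"
  define C where "C = 2 powr p * (M + 2 powr p * (M + M)) + C3"
  have M: "M \<ge> 0" "C1 \<le> M" "C2 \<le> M" using C1 by (auto simp: M_def)
  show ?thesis
  proof (intro exI[of _ C] conjI ballI allI impI)
    show "C \<ge> 0" using M C3 by (simp add: C_def)
    fix g :: "real^'n \<Rightarrow> real" and x h :: "real^'n" and k :: nat
    assume g: "g \<in> borel_measurable borel" and k: "7 \<le> k" and h: "h \<noteq> 0" "norm h \<le> dyadic k"
      and good: "off_boundary x" "off_boundary (x + h)" and \<sigma>: "\<sigma> x \<le> dyadic 3"
    define T where "T = pair_bound g k x h"
    \<comment> \<open>Three dyadic steps leave room: \<open>2\<^sup>-\<^sup>l\<^sup>-\<^sup>1 + 3 |h| \<le> 2\<^sup>-\<^sup>l\<close> whenever \<open>|h| \<le> 2\<^sup>-\<^sup>k\<close>.\<close>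
    define l where "l = k - 3"
    have l: "k = Suc (Suc (Suc l))" "l \<ge> 4" using k by (auto simp: l_def)
    have kl: "dyadic k = dyadic l / 8"
      unfolding l(1) two_powr_neg_Suc by simp
    have pos: "dyadic l > (0::real)" by simp
    have tri: "\<bar>\<sigma> (x + h) - \<sigma> x\<bar> \<le> 3 * norm h"
      using infdist_triangle_abs[of "x + h" \<Omega> x] by (simp add: dist_norm)
    have "epow p (raw_extension g (x + h) - raw_extension g x) \<le> ennreal C * T"
    proof (cases "\<sigma> x \<le> dyadic (Suc l)")
      case True
      then have near: "\<sigma> x \<le> dyadic l" "\<sigma> (x + h) \<le> dyadic l" "norm h \<le> dyadic l"
        using tri h(2) pos unfolding kl two_powr_neg_Suc abs_le_iff by linarith+
      have "epow p (raw_extension g (x + h) - loc_mean g (x + h) (dyadic l)) \<le> ennreal C1 * (total_oscillation g k (x + h) + deviation g l (x + h))"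
        using l near good by (intro C1(2) g) auto
      then have 1: "epow p (raw_extension g (x + h) - loc_mean g (x + h) (dyadic l)) \<le> ennreal M * T"
        by (rule ennreal_le_add_mult) (use M in \<open>auto simp: T_def l_def intro!: add_mono add_increasing add_increasing2\<close>)
      have "epow p (raw_extension g x - loc_mean g x (dyadic l)) \<le> ennreal C1 * (total_oscillation g k x + deviation g l x)"
        using l near good by (intro C1(2) g) auto
      then have 2: "epow p (loc_mean g x (dyadic l) - raw_extension g x) \<le> ennreal M * T"
        unfolding abs_minus_commute[of "loc_mean g x (dyadic l)"]
        by (rule ennreal_le_add_mult) (use M in \<open>auto simp: T_def l_def intro!: add_mono add_increasing add_increasing2\<close>)
      have "epow p (loc_mean g (x + h) (dyadic l) - loc_mean g x (dyadic l)) \<le> ennreal C2 * total_oscillation g k x"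
        using l near by (intro C2(2) g) auto
      then have 3: "epow p (loc_mean g (x + h) (dyadic l) - loc_mean g x (dyadic l)) \<le> ennreal M * T"
        by (rule ennreal_le_add_mult) (use M in \<open>auto simp: T_def intro!: add_increasing2\<close>)
      have "epow p (raw_extension g (x + h) - raw_extension g x) \<le> ennreal (2 powr p) * (ennreal M * T + ennreal (2 powr p) * (ennreal M * T + ennreal M * T))"
        by (rule order_trans[OF ennreal_powr_triangle[OF p, where y="loc_mean g (x + h) (dyadic l)"]],
            intro mult_left_mono add_mono 1 order_trans[OF ennreal_powr_triangle[OF p, where y="loc_mean g x (dyadic l)"]] 2 3) auto
      also have "\<dots> = ennreal (2 powr p * (M + 2 powr p * (M + M))) * T"
        using M by (simp only: ennreal_collect mult_nonneg_nonneg add_nonneg_nonneg powr_ge_zero)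
      also have "\<dots> \<le> ennreal C * T"
        using C3 by (intro mult_right_mono ennreal_leI) (auto simp: C_def)
      finally show ?thesis .
    next
      case False
      obtain i where i: "i \<ge> 3" "dyadic (Suc i) < \<sigma> x" "\<sigma> x \<le> dyadic i"
      proof -
        have "0 < dyadic (Suc l)" by simp
        then have "0 < \<sigma> x" using False by linarith
        with \<sigma> that show thesis using dyadic_scale_le[of "\<sigma> x" 3] by blast
      qed
      have far: "4 * norm h \<le> \<sigma> x" "0 < \<sigma> (x + h)" "0 < \<sigma> x"
        using False h(2) tri pos unfolding kl two_powr_neg_Suc abs_le_iff by linarith+
      then have "x \<notin> \<Omega>" "x + h \<notin> \<Omega>" by auto
      have "dyadic (Suc l) < dyadic i" using False i by linarith
      then have "i \<le> k" using l by simp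
      then have "epow p (raw_extension g (x + h) - raw_extension g x) \<le> ennreal C3 * total_oscillation g k x"
        using C3(2)[OF g i(1) _ h i(2,3) far(1)] \<open>x \<notin> \<Omega>\<close> \<open>x + h \<notin> \<Omega>\<close> by (simp add: raw_extension_def)
      then show ?thesis
        by (rule ennreal_le_add_mult) (use M in \<open>auto simp: T_def C_def intro!: add_increasing2\<close>)
    qed
    then show "epow p (raw_extension g (x + h) - raw_extension g x)
       \<le> ennreal C * pair_bound g k x h"
      unfolding T_def .
  qed
qed

text \<open>Comparison with the trimmed mean at the fixed scale \<open>2\<^sup>-\<^sup>3\<close>, which in turn is bounded by the local \<open>L\<^sup>p\<close> norm.
Averaging at the scale \<open>\<sigma> x\<close> directly would count points of \<open>\<Omega>\<close> near the boundary once for each scale.\<close>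

lemma raw_extension_bound:
  "\<exists>C\<ge>0. \<forall>g\<in>borel_measurable borel. \<forall>x. off_boundary x \<longrightarrow> \<sigma> x \<le> dyadic 3 \<longrightarrow>
     epow p (raw_extension g x) \<le> ennreal C * fixed_scale_bound g x"
proof -
  obtain C1 where C1: "C1 \<ge> 0" "\<And>g x l k. g\<in>borel_measurable borel \<Longrightarrow> 2 \<le> l \<Longrightarrow> l \<le> k \<Longrightarrow> k \<le> l + 3 \<Longrightarrow> off_boundary x \<Longrightarrow> \<sigma> x \<le> dyadic l \<Longrightarrow>
     epow p (raw_extension g x - loc_mean g x (dyadic l)) \<le> ennreal C1 * (total_oscillation g k x + deviation g l x)"
    using raw_extension_near by blast
  define m where "m = \<kappa> * (dyadic 3) ^ CARD('n)"
  have m: "m > 0" using \<kappa> by (simp add: m_def)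
  define M where "M = max C1 (4 / m)"
  have M: "M \<ge> 0" "C1 \<le> M" "4 / m \<le> M" using C1 by (auto simp: M_def)
  show ?thesis
  proof (intro exI[of _ "2 powr p * (M + M)"] conjI ballI allI impI)
    show "2 powr p * (M + M) \<ge> 0" using M by simp
    fix g :: "real^'n \<Rightarrow> real" and x :: "real^'n"
    assume g: "g \<in> borel_measurable borel" and good: "off_boundary x" and \<sigma>: "\<sigma> x \<le> dyadic 3"
    define T where "T = fixed_scale_bound g x"
    have "epow p (raw_extension g x - loc_mean g x (dyadic 3)) \<le> ennreal C1 * (total_oscillation g 6 x + deviation g 3 x)"
      using good \<sigma> by (intro C1(2) g) auto
    then have 1: "epow p (raw_extension g x - loc_mean g x (dyadic 3)) \<le> ennreal M * T"
      by (rule ennreal_le_add_mult) (use M in \<open>auto simp: T_def intro!: add_increasing2\<close>)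
    have "m \<le> measure lborel (\<Omega> \<inter> ball x (dyadic 3))"
      unfolding m_def using \<sigma> two_powr_neg_le_one[of "real 3"] by (intro density) auto
    then have "epow p (trimmed_mean (\<Omega> \<inter> ball x (dyadic 3)) g - 0)
       \<le> ennreal (4 / m) * (\<integral>\<^sup>+y. indicator (\<Omega> \<inter> ball x (dyadic 3)) y * epow p (g y - 0) \<partial>lborel)"
      by (intro trimmed_mean_error[OF g _ emeasure_Int_ball_finite p m]) auto
    then have "epow p (loc_mean g x (dyadic 3) - 0) \<le> ennreal (4 / m) * local_energy g x"
      unfolding loc_mean_def local_energy_def diff_zero .
    then have 2: "epow p (loc_mean g x (dyadic 3) - 0) \<le> ennreal M * T"
      by (rule ennreal_le_add_mult) (use M in \<open>auto simp: T_def intro!: add_increasing\<close>)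
    have "epow p (raw_extension g x - 0) \<le> ennreal (2 powr p) * (ennreal M * T + ennreal M * T)"
      by (rule order_trans[OF ennreal_powr_triangle[OF p, where y="loc_mean g x (dyadic 3)"]],
            intro mult_left_mono add_mono 1 2) auto
    also have "\<dots> = ennreal (2 powr p * (M + M)) * T"
      using M by (simp only: ennreal_collect powr_ge_zero)
    finally show "epow p (raw_extension g x) \<le> ennreal (2 powr p * (M + M)) * fixed_scale_bound g x"
      by (simp add: T_def)
  qed
qed

lemma cutoff_bounds: "0 \<le> cutoff x" "cutoff x \<le> 1" "\<sigma> x \<ge> 1/16 \<Longrightarrow> cutoff x = 0"
  by (auto simp: cutoff_def)

lemma cutoff_lipschitz: "\<bar>cutoff (x + h) - cutoff x\<bar> \<le> 96 * norm h"
proof -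
  from clamp_lipschitz[of "2 - 32 * \<sigma> (x + h)" "2 - 32 * \<sigma> x"]
  have "\<bar>cutoff (x + h) - cutoff x\<bar> \<le> \<bar>(2 - 32 * \<sigma> (x + h)) - (2 - 32 * \<sigma> x)\<bar>"
    unfolding cutoff_def .
  also have "(2 - 32 * \<sigma> (x + h)) - (2 - 32 * \<sigma> x) = 96 * (infdist x \<Omega> - infdist (x + h) \<Omega>)" by simp
  also have "\<bar>96 * (infdist x \<Omega> - infdist (x + h) \<Omega>)\<bar> = 96 * \<bar>infdist x \<Omega> - infdist (x + h) \<Omega>\<bar>" by (simp only: abs_mult abs_numeral)
  also have "\<dots> \<le> 96 * norm h"
    using infdist_triangle_abs[of x \<Omega> "x + h"] by (simp add: dist_norm)
  finally show ?thesis .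
qed

lemma extension_bound:
  "\<exists>C\<ge>0. \<forall>g\<in>borel_measurable borel. \<forall>x. off_boundary x \<longrightarrow>
     epow p (extension g x) \<le> ennreal C * fixed_scale_bound g x"
proof -
  obtain C where C: "C \<ge> 0" "\<And>g x. g\<in>borel_measurable borel \<Longrightarrow> off_boundary x \<Longrightarrow> \<sigma> x \<le> dyadic 3 \<Longrightarrow>
     epow p (raw_extension g x) \<le> ennreal C * fixed_scale_bound g x"
    using raw_extension_bound by blast
  show ?thesis
  proof (intro exI[of _ C] conjI ballI allI impI C(1))
    fix g :: "real^'n \<Rightarrow> real" and x :: "real^'n"
    assume g: "g \<in> borel_measurable borel" and good: "off_boundary x"
    show "epow p (extension g x) \<le> ennreal C * fixed_scale_bound g x"
    proof (cases "\<sigma> x \<le> dyadic 3")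
      case True
      have "\<bar>extension g x\<bar> \<le> \<bar>raw_extension g x\<bar>"
        using cutoff_bounds[of x] by (simp add: extension_def abs_mult mult_left_le_one_le)
      then have "epow p (extension g x) \<le> epow p (raw_extension g x)"
        using p by (intro ennreal_leI powr_mono2) auto
      also have "\<dots> \<le> ennreal C * fixed_scale_bound g x"
        by (rule C(2)[OF g good True])
      finally show ?thesis .
    next
      case False
      have "dyadic 3 = (1/8::real)" by (simp add: powr_minus)
      then have "\<sigma> x \<ge> 1/16" using False by simp
      then show ?thesis by (simp add: extension_def cutoff_bounds(3))
    qed
  qed
qed

text \<open>A product rule: the difference of the uncut extension, plus the difference of the cutoff, which is
of order \<open>2\<^sup>-\<^sup>k\<close>, times the extension itself.\<close>

lemma extension_diff:
  "\<exists>C\<ge>0. \<forall>g\<in>borel_measurable borel. \<forall>x h k. 7 \<le> k \<longrightarrow> h \<noteq> 0 \<longrightarrow> norm h \<le> dyadic k \<longrightarrow>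
     off_boundary x \<longrightarrow> off_boundary (x + h) \<longrightarrow>
     epow p (extension g (x + h) - extension g x)
       \<le> ennreal C * (pair_bound g k x h
           + ennreal (2 powr (- (real k * p))) * fixed_scale_bound g x)"
proof -
  obtain C1 where C1: "C1 \<ge> 0" "\<And>g x. g\<in>borel_measurable borel \<Longrightarrow> off_boundary x \<Longrightarrow> \<sigma> x \<le> dyadic 3 \<Longrightarrow>
     epow p (raw_extension g x) \<le> ennreal C1 * fixed_scale_bound g x"
    using raw_extension_bound by blast
  obtain C2 where C2: "C2 \<ge> 0" "\<And>g x h k. g\<in>borel_measurable borel \<Longrightarrow> 7 \<le> k \<Longrightarrow> h \<noteq> 0 \<Longrightarrow> norm h \<le> dyadic k \<Longrightarrow>
     off_boundary x \<Longrightarrow> off_boundary (x + h) \<Longrightarrow> \<sigma> x \<le> dyadic 3 \<Longrightarrow>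
     epow p (raw_extension g (x + h) - raw_extension g x)
       \<le> ennreal C2 * pair_bound g k x h"
    using raw_extension_diff by blast
  define M where "M = max C2 (96 powr p * C1)"
  have M: "M \<ge> 0" "C2 \<le> M" "96 powr p * C1 \<le> M" using C2 by (auto simp: M_def)
  show ?thesis
  proof (intro exI[of _ "2 powr p * M"] conjI ballI allI impI)
    show "2 powr p * M \<ge> 0" using M by simp
    fix g :: "real^'n \<Rightarrow> real" and x h :: "real^'n" and k :: nat
    assume g: "g \<in> borel_measurable borel" and k: "7 \<le> k" and h: "h \<noteq> 0" "norm h \<le> dyadic k"
      and good: "off_boundary x" "off_boundary (x + h)"
    define T where "T = pair_bound g k x h"
    define B where "B = fixed_scale_bound g x"
    have e3: "dyadic 3 = (1/8::real)" by (simp add: powr_minus)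
    show "epow p (extension g (x + h) - extension g x) \<le> ennreal (2 powr p * M) * (T + ennreal (2 powr (- (real k * p))) * B)"
    proof (cases "\<sigma> x \<le> dyadic 3")
      case True
      have "\<bar>extension g (x + h) - extension g x\<bar> \<le> \<bar>\<bar>raw_extension g (x + h) - raw_extension g x\<bar> + 96 * norm h * \<bar>raw_extension g x\<bar>\<bar>"
      proof -
        have "extension g (x + h) - extension g x = cutoff (x + h) * (raw_extension g (x + h) - raw_extension g x) + (cutoff (x + h) - cutoff x) * raw_extension g x"
          by (simp add: extension_def algebra_simps)
        also have "\<bar>\<dots>\<bar> \<le> \<bar>cutoff (x + h) * (raw_extension g (x + h) - raw_extension g x)\<bar> + \<bar>(cutoff (x + h) - cutoff x) * raw_extension g x\<bar>"
          by (rule abs_triangle_ineq)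
        also have "\<dots> \<le> \<bar>raw_extension g (x + h) - raw_extension g x\<bar> + 96 * norm h * \<bar>raw_extension g x\<bar>"
          unfolding abs_mult using cutoff_bounds[of "x + h"] cutoff_lipschitz[of x h]
          by (intro add_mono mult_right_mono mult_left_le_one_le) auto
        finally show ?thesis by simp
      qed
      then have "epow p (extension g (x + h) - extension g x) \<le> ennreal (\<bar>\<bar>raw_extension g (x + h) - raw_extension g x\<bar> + 96 * norm h * \<bar>raw_extension g x\<bar>\<bar> powr p)"
        using p by (intro ennreal_leI powr_mono2) auto
      also have "\<dots> \<le> ennreal (2 powr p) * (ennreal (\<bar>\<bar>raw_extension g (x + h) - raw_extension g x\<bar>\<bar> powr p) + ennreal (\<bar>96 * norm h * \<bar>raw_extension g x\<bar>\<bar> powr p))"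
        by (rule ennreal_powr_add_le[OF p])
      also have "\<dots> \<le> ennreal (2 powr p) * (ennreal M * T + ennreal M * (ennreal (2 powr (- (real k * p))) * B))"
      proof (intro mult_left_mono add_mono)
        show "ennreal (\<bar>\<bar>raw_extension g (x + h) - raw_extension g x\<bar>\<bar> powr p) \<le> ennreal M * T"
          unfolding T_def abs_abs by (rule ennreal_le_add_mult[OF C2(2)[OF g k h good True] order_refl M(2)])
        have "\<bar>96 * norm h * \<bar>raw_extension g x\<bar>\<bar> powr p = 96 powr p * norm h powr p * \<bar>raw_extension g x\<bar> powr p"
          by (simp add: powr_mult abs_mult)
        also have "\<dots> \<le> 96 powr p * 2 powr (- (real k * p)) * \<bar>raw_extension g x\<bar> powr p"
        proof (intro mult_right_mono mult_left_mono)
          have "norm h powr p \<le> (dyadic k) powr p" using h p by (intro powr_mono2) auto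
          then show "norm h powr p \<le> 2 powr (- (real k * p))" by (simp add: powr_powr)
        qed auto
        finally have "ennreal (\<bar>96 * norm h * \<bar>raw_extension g x\<bar>\<bar> powr p) \<le> ennreal (96 powr p * 2 powr (- (real k * p)) * \<bar>raw_extension g x\<bar> powr p)"
          by (rule ennreal_leI)
        also have "\<dots> = ennreal (96 powr p * 2 powr (- (real k * p))) * epow p (raw_extension g x)"
          by (rule ennreal_mult) auto
        also have "\<dots> \<le> ennreal (96 powr p * 2 powr (- (real k * p))) * (ennreal C1 * B)"
          unfolding B_def by (intro mult_left_mono C1(2) g good True) simp
        also have "\<dots> = ennreal (96 powr p * C1) * (ennreal (2 powr (- (real k * p))) * B)"
          using C1(1) by (simp add: ennreal_mult mult_ac)
        also have "\<dots> \<le> ennreal M * (ennreal (2 powr (- (real k * p))) * B)"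
          using M by (intro mult_right_mono ennreal_leI) auto
        finally show "ennreal (\<bar>96 * norm h * \<bar>raw_extension g x\<bar>\<bar> powr p) \<le> ennreal M * (ennreal (2 powr (- (real k * p))) * B)" .
      qed auto
      also have "\<dots> = ennreal (2 powr p * M) * (T + ennreal (2 powr (- (real k * p))) * B)"
        using M by (simp add: ennreal_mult distrib_left mult.assoc)
      finally show ?thesis .
    next
      case False
      have "- real k \<le> - real 7" using k by simp
      then have "dyadic k \<le> (2::real) powr (- real 7)" by (intro powr_mono) auto
      also have "(2::real) powr (- real 7) = 1 / 128" by (simp add: powr_minus)
      finally have "norm h \<le> 1 / 128" using h by simp
      moreover have "\<sigma> x \<le> \<sigma> (x + h) + 3 * norm h"
        using infdist_triangle[of x \<Omega> "x + h"] by (simp add: dist_norm)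
      ultimately have "\<sigma> x \<ge> 1/16" "\<sigma> (x + h) \<ge> 1/16" using False unfolding e3 by linarith+
      then show ?thesis by (simp add: extension_def cutoff_bounds(3))
    qed
  qed
qed

end

section \<open>The Besov norm of the extension\<close>

lemma ennreal_mult_assoc: "a \<ge> 0 \<Longrightarrow> b \<ge> 0 \<Longrightarrow> ennreal a * (ennreal b * X) = ennreal (a * b) * X"
  by (simp add: ennreal_mult mult.assoc)

lemma seq_norm_cmult:
  assumes "p > 0" "q > 0" "c > 0"
  shows "seq_norm p q (\<lambda>l. ennreal c * Y l) = ennreal (c powr (1 / p)) * seq_norm p q Y"
proof (cases "q = \<infinity>")
  case True
  have "(SUP l. ennreal_power (ennreal c * Y l) (1 / p)) = (SUP l. ennreal (c powr (1 / p)) * ennreal_power (Y l) (1 / p))"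
    using assms by (simp add: ennreal_power_mult ennreal_power_ennreal)
  then show ?thesis using True by (simp add: seq_norm_def SUP_mult_left_ennreal)
next
  case False
  then have q: "enn2real q > 0" using assms by (simp add: enn2real_positive_iff top.not_eq_extremum)
  have "(\<Sum>l. ennreal_power (ennreal c * Y l) (enn2real q / p)) = ennreal (c powr (enn2real q / p)) * (\<Sum>l. ennreal_power (Y l) (enn2real q / p))"
    using assms q by (simp add: ennreal_power_mult ennreal_power_ennreal)
  then show ?thesis using False assms q
    by (simp add: seq_norm_def ennreal_power_mult ennreal_power_ennreal powr_powr)
qed

context density_domain
begin

text \<open>The density condition passes to boundary points. If an open set \<open>G\<close> exceeds a bounded piece of the
boundary by little, then a Vitali covering of the piece by disjoint balls in \<open>G\<close> has total measure at most
a multiple of the measure of \<open>\<Omega> \<inter> G\<close>, which is disjoint from the boundary and hence small.\<close>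

lemma boundary_null: "AE x in lborel. off_boundary x"
proof -
  let ?n = "CARD('n)" and ?\<omega> = "unit_ball_vol (real CARD('n))"
  define N where "N R = {x. x \<notin> \<Omega> \<and> infdist x \<Omega> = 0} \<inter> ball 0 R" for R
  have N_borel [measurable]: "N R \<in> sets borel" for R
    unfolding N_def by measurable
  have null: "emeasure lborel (N R) = 0" for R
  proof -
    have le: "emeasure lborel (N R) \<le> ennreal (?\<omega> / \<kappa>) * ennreal e" if e: "e > 0" for e
    proof -
      have "N R \<in> sets lebesgue" by simp
      then obtain G where G: "open G" "N R \<subseteq> G" "emeasure lebesgue (G - N R) < ennreal e"
        using sets_lebesgue_outer_open[OF _ e] by metis
      define K where "K = {(x, r). x \<in> N R \<and> 0 < r \<and> r \<le> 1 \<and> ball x r \<subseteq> G}"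
      have cover: "\<exists>i. i \<in> K \<and> x \<in> ball (fst i) (snd i) \<and> snd i < d" if "x \<in> N R" "0 < d" for x d
      proof -
        have "x \<in> G" using G(2) that(1) by (rule subsetD)
        then obtain r where r: "r > 0" "ball x r \<subseteq> G" by (rule openE[OF G(1)])
        define r' where "r' = min (min r 1) (d / 2)"
        have "r' > 0" "r' \<le> 1" "r' \<le> r" "r' < d" using r that by (auto simp: r'_def)
        moreover have "ball x r' \<subseteq> G" using subset_ball[OF \<open>r' \<le> r\<close>, of x] r by blast
        ultimately show ?thesis using that by (intro exI[of _ "(x, r')"]) (auto simp: K_def)
      qed
      obtain C where C: "countable C" "C \<subseteq> K"
        "pairwise (\<lambda>i j. disjnt (ball (fst i) (snd i)) (ball (fst j) (snd j))) C"
        "negligible (N R - (\<Union>i \<in> C. ball (fst i) (snd i)))"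
        by (rule Vitali_covering_theorem_balls[of "N R" K fst snd, OF cover]) auto
      let ?B = "\<lambda>i. ball (fst i) (snd i)" 
      have disj: "disjoint_family_on ?B C" "disjoint_family_on (\<lambda>i. \<Omega> \<inter> ?B i) C"
        using C(3) unfolding disjoint_family_on_def pairwise_def disjnt_def by blast+
      have ball_le: "emeasure lborel (?B i) \<le> ennreal (?\<omega> / \<kappa>) * emeasure lborel (\<Omega> \<inter> ?B i)" if "i \<in> C" for i
      proof -
        have i: "fst i \<in> N R" "0 < snd i" "snd i \<le> 1" using that C(2) by (auto simp: K_def)
        then have dens: "\<kappa> * snd i ^ ?n \<le> measure lborel (\<Omega> \<inter> ?B i)"
          by (intro density) (auto simp: N_def)
        have "emeasure lborel (?B i) = ennreal (?\<omega> / \<kappa> * (\<kappa> * snd i ^ ?n))"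
          using i \<kappa> by (simp add: emeasure_ball_cart)
        also have "\<dots> \<le> ennreal (?\<omega> / \<kappa> * measure lborel (\<Omega> \<inter> ?B i))"
          using dens \<kappa> by (intro ennreal_leI mult_left_mono) (auto simp: less_imp_le)
        also have "\<dots> = ennreal (?\<omega> / \<kappa>) * emeasure lborel (\<Omega> \<inter> ?B i)"
          using \<kappa> by (subst ennreal_mult) (auto simp: emeasure_open_Int_ball[OF open_domain] less_imp_le)
        finally show ?thesis .
      qed
      have "open (\<Union>i \<in> C. ?B i)" by auto
      then have U_borel: "(\<Union>i \<in> C. ?B i) \<in> sets borel" by simp
      have "emeasure lborel (N R) \<le> emeasure lborel ((\<Union>i \<in> C. ?B i) \<union> (N R - (\<Union>i \<in> C. ?B i)))"
        using U_borel by (intro emeasure_mono) auto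
      also have "\<dots> \<le> emeasure lborel (\<Union>i \<in> C. ?B i) + emeasure lborel (N R - (\<Union>i \<in> C. ?B i))"
        using U_borel by (intro emeasure_subadditive) auto
      also have "emeasure lborel (N R - (\<Union>i \<in> C. ?B i)) = 0"
      proof -
        have "emeasure lebesgue (N R - (\<Union>i \<in> C. ?B i)) = 0"
          using C(4) by (simp only: negligible_iff_null_sets null_setsD1)
        then show ?thesis using U_borel by simp
      qed
      also have "emeasure lborel (\<Union>i \<in> C. ?B i) + 0 = (\<integral>\<^sup>+i. emeasure lborel (?B i) \<partial>count_space C)"
        using C(1) disj(1) by (simp add: emeasure_UN_countable)
      also have "\<dots> \<le> (\<integral>\<^sup>+i. ennreal (?\<omega> / \<kappa>) * emeasure lborel (\<Omega> \<inter> ?B i) \<partial>count_space C)"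
        using ball_le by (intro nn_integral_mono) auto
      also have "\<dots> = ennreal (?\<omega> / \<kappa>) * (\<integral>\<^sup>+i. emeasure lborel (\<Omega> \<inter> ?B i) \<partial>count_space C)"
        by (rule nn_integral_cmult) simp
      also have "(\<integral>\<^sup>+i. emeasure lborel (\<Omega> \<inter> ?B i) \<partial>count_space C) = emeasure lborel (\<Union>i \<in> C. \<Omega> \<inter> ?B i)"
        using C(1) disj(2) by (intro emeasure_UN_countable[symmetric]) auto
      also have "\<dots> \<le> emeasure lborel (G - N R)"
      proof (rule emeasure_mono)
        have "?B i \<subseteq> G" if "i \<in> C" for i
          using subsetD[OF C(2) that] unfolding K_def case_prod_beta mem_Collect_eq by blast
        moreover have "\<Omega> \<inter> N R = {}" by (auto simp: N_def)
        ultimately show "(\<Union>i \<in> C. \<Omega> \<inter> ?B i) \<subseteq> G - N R" by blast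
        show "G - N R \<in> sets lborel" using G(1) by simp
      qed
      also have "\<dots> \<le> ennreal e" using G by simp
      finally show ?thesis by (simp add: mult_left_mono)
    qed
    have small: "emeasure lborel (N R) \<le> ennreal e" if e: "e > 0" for e
    proof -
      have "emeasure lborel (N R) \<le> ennreal (?\<omega> / \<kappa>) * ennreal (\<kappa> / ?\<omega> * e)" using e \<kappa> by (intro le) simp
      also have "\<dots> = ennreal (?\<omega> / \<kappa> * (\<kappa> / ?\<omega> * e))" using e \<kappa> by (subst ennreal_mult) (auto simp: less_imp_le)
      also have "?\<omega> / \<kappa> * (\<kappa> / ?\<omega> * e) = e" using \<kappa> less_imp_neq[OF unit_ball_vol_card_pos[where 'n='n]] by simp
      finally show ?thesis .
    qed
    have "emeasure lborel (N R) \<le> 0"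
    proof (rule ennreal_le_epsilon)
      fix e :: real assume "0 < e"
      then show "emeasure lborel (N R) \<le> 0 + ennreal e" unfolding add_0 by (rule small)
    qed
    then show ?thesis unfolding le_zero_eq .
  qed
  have "AE x in lborel. x \<notin> N (real m)" for m :: nat
    using null by (intro AE_not_in) (simp add: null_sets_def)
  then have "AE x in lborel. \<forall>m::nat. x \<notin> N (real m)" by (simp add: AE_all_countable)
  then show ?thesis
  proof eventually_elim
    case (elim x)
    obtain m :: nat where "norm x < real m" using reals_Archimedean2 by blast
    then show ?case using elim infdist_nonneg[of x \<Omega>] by (auto simp: N_def less_le)
  qed
qed

lemma boundary_null_translate: "AE x in lborel. off_boundary (x + h)"
proof -
  have "AE x in lebesgue. off_boundary x" by (intro AE_completion boundary_null)
  from AE_lebesgue_translate[OF this, of h] show ?thesis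
    by (simp add: AE_completion_iff)
qed

text \<open>The counterpart of \<open>total_oscillation\<close> after integration over \<open>x\<close>.\<close>

definition weighted_modulus :: "(real^'n \<Rightarrow> real) \<Rightarrow> nat \<Rightarrow> ennreal" where
  "weighted_modulus g k = (\<Sum>j. ennreal (scale_weight k (Suc j)) * modulus_power p \<Omega> g (dyadic (Suc j)))"

lemma scale_weight_le:
  "scale_weight k j \<le> 2 powr (p * \<bar>real k - real k'\<bar>) * scale_weight k' j"
proof -
  have "bent (s / 2) (real j - real k) \<le> bent (s / 2) (real j - real k') + \<bar>(real j - real k') - (real j - real k)\<bar>"
    using s by (intro bent_lipschitz) auto
  then have "p * bent (s / 2) (real j - real k) \<le> p * (bent (s / 2) (real j - real k') + \<bar>real k - real k'\<bar>)"
    using p by (intro mult_left_mono) auto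
  then show ?thesis unfolding scale_weight_def by (simp add: algebra_simps flip: powr_add)
qed

lemma weighted_modulus_le: "weighted_modulus g k \<le> ennreal (2 powr (p * \<bar>real k - real k'\<bar>)) * weighted_modulus g k'"
proof -
  have "weighted_modulus g k \<le> (\<Sum>j. ennreal (2 powr (p * \<bar>real k - real k'\<bar>)) * (ennreal (scale_weight k' (Suc j)) * modulus_power p \<Omega> g (dyadic (Suc j))))"
    unfolding weighted_modulus_def
  proof (intro suminf_le summableI)
    fix j
    have "ennreal (scale_weight k (Suc j)) \<le> ennreal (2 powr (p * \<bar>real k - real k'\<bar>)) * ennreal (scale_weight k' (Suc j))"
      using ennreal_leI[OF scale_weight_le[of k "Suc j" k']] by (simp add: ennreal_mult)
    then show "ennreal (scale_weight k (Suc j)) * modulus_power p \<Omega> g (dyadic (Suc j))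
      \<le> ennreal (2 powr (p * \<bar>real k - real k'\<bar>)) * (ennreal (scale_weight k' (Suc j)) * modulus_power p \<Omega> g (dyadic (Suc j)))"
      unfolding mult.assoc[symmetric] by (rule mult_right_mono) simp
  qed
  then show ?thesis unfolding weighted_modulus_def by simp
qed

lemma modulus_le_weighted_modulus:
  assumes "j \<ge> 1" "j \<le> k"
  shows "modulus_power p \<Omega> g (dyadic j) \<le> ennreal (2 powr (p * real (k - j))) * weighted_modulus g k"
proof -
  obtain i where i: "j = Suc i" using assms by (cases j) auto
  have "ennreal (scale_weight k j) * modulus_power p \<Omega> g (dyadic j) \<le> weighted_modulus g k"
    unfolding i weighted_modulus_def by (rule suminf_ge_term_ennreal)
  then have "ennreal (2 powr (p * real (k - j))) * (ennreal (scale_weight k j) * modulus_power p \<Omega> g (dyadic j))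
     \<le> ennreal (2 powr (p * real (k - j))) * weighted_modulus g k"
    by (rule mult_left_mono) simp
  moreover have "ennreal (2 powr (p * real (k - j))) * ennreal (scale_weight k j) = 1"
  proof -
    have "2 powr (p * real (k - j)) * scale_weight k j = 2 powr (p * real (k - j) + p * (real j - real k))"
      using assms by (simp add: scale_weight_def bent_def powr_add)
    also have "p * real (k - j) + p * (real j - real k) = 0" using assms by (simp add: of_nat_diff algebra_simps)
    finally show ?thesis by (simp flip: ennreal_mult)
  qed
  ultimately show ?thesis by (metis mult.assoc mult_1)
qed

lemma integral_total_oscillation_le:
  assumes [measurable]: "g \<in> borel_measurable borel"
  shows "(\<integral>\<^sup>+x. total_oscillation g k x \<partial>lborel) \<le> ennreal ((unit_ball_vol (real CARD('n)))\<^sup>2 * 2 ^ CARD('n)) * weighted_modulus g k"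
proof -
  let ?c = "ennreal ((unit_ball_vol (real CARD('n)))\<^sup>2 * 2 ^ CARD('n))"
  have "(\<integral>\<^sup>+x. total_oscillation g k x \<partial>lborel) = (\<Sum>j. \<integral>\<^sup>+x. ennreal (scale_weight k (Suc j)) * oscillation g (Suc (Suc j)) x \<partial>lborel)"
    unfolding total_oscillation_def by (rule nn_integral_suminf) measurable
  also have "\<dots> = (\<Sum>j. ennreal (scale_weight k (Suc j)) * (\<integral>\<^sup>+x. oscillation g (Suc (Suc j)) x \<partial>lborel))"
    by (intro suminf_cong nn_integral_cmult) measurable
  also have "\<dots> \<le> (\<Sum>j. ennreal (scale_weight k (Suc j)) * (?c * modulus_power p \<Omega> g (dyadic (Suc j))))"
    by (intro suminf_le summableI mult_left_mono integral_oscillation_le assms) simp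
  also have "\<dots> = (\<Sum>j. ?c * (ennreal (scale_weight k (Suc j)) * modulus_power p \<Omega> g (dyadic (Suc j))))"
    by (simp only: mult.left_commute)
  also have "\<dots> = ?c * weighted_modulus g k" unfolding weighted_modulus_def by simp
  finally show ?thesis .
qed

lemma integral_fixed_scale_le:
  "\<exists>C\<ge>0. \<forall>g\<in>borel_measurable borel.
     (\<integral>\<^sup>+x. fixed_scale_bound g x \<partial>lborel) \<le> ennreal C * (weighted_modulus g 6 + lp_energy p \<Omega> g)"
proof -
  let ?\<omega> = "unit_ball_vol (real CARD('n))"
  define C1 where "C1 = ?\<omega>\<^sup>2 * 2 ^ CARD('n)"
  define C2 where "C2 = ?\<omega> * 2 powr (p * real (6 - 3 :: nat))"
  define C where "C = max (C1 + C2) ?\<omega>"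
  have w: "?\<omega> > 0" by simp
  have C: "C1 \<ge> 0" "C2 \<ge> 0" "C \<ge> 0" using w by (auto simp: C1_def C2_def C_def max_def)
  show ?thesis
  proof (intro exI[of _ C] conjI ballI C(3))
    fix g :: "real^'n \<Rightarrow> real" assume g[measurable]: "g \<in> borel_measurable borel"
    have "(\<integral>\<^sup>+x. fixed_scale_bound g x \<partial>lborel)
      = (\<integral>\<^sup>+x. total_oscillation g 6 x \<partial>lborel) + (\<integral>\<^sup>+x. deviation g 3 x \<partial>lborel) + (\<integral>\<^sup>+x. local_energy g x \<partial>lborel)"
      by (simp add: nn_integral_add)
    also have "\<dots> \<le> ennreal C1 * weighted_modulus g 6 + ennreal C2 * weighted_modulus g 6 + ennreal ?\<omega> * lp_energy p \<Omega> g"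
    proof (intro add_mono)
      show "(\<integral>\<^sup>+x. total_oscillation g 6 x \<partial>lborel) \<le> ennreal C1 * weighted_modulus g 6"
        unfolding C1_def by (rule integral_total_oscillation_le[OF g])
      have "(\<integral>\<^sup>+x. deviation g 3 x \<partial>lborel) \<le> ennreal ?\<omega> * modulus_power p \<Omega> g (dyadic 3)"
        by (rule integral_deviation_le[OF g])
      also have "\<dots> \<le> ennreal ?\<omega> * (ennreal (2 powr (p * real (6 - 3 :: nat))) * weighted_modulus g 6)"
        by (intro mult_left_mono modulus_le_weighted_modulus) auto
      also have "\<dots> = ennreal C2 * weighted_modulus g 6"
        unfolding C2_def using w by (subst ennreal_mult) (auto simp: mult.assoc less_imp_le)
      finally show "(\<integral>\<^sup>+x. deviation g 3 x \<partial>lborel) \<le> ennreal C2 * weighted_modulus g 6" .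
      show "(\<integral>\<^sup>+x. local_energy g x \<partial>lborel) \<le> ennreal ?\<omega> * lp_energy p \<Omega> g"
        by (rule integral_local_energy_le[OF g])
    qed
    also have "ennreal C1 * weighted_modulus g 6 + ennreal C2 * weighted_modulus g 6 = ennreal (C1 + C2) * weighted_modulus g 6"
      using C by (simp only: ennreal_plus distrib_right)
    also have "ennreal (C1 + C2) * weighted_modulus g 6 + ennreal ?\<omega> * lp_energy p \<Omega> g \<le> ennreal C * weighted_modulus g 6 + ennreal C * lp_energy p \<Omega> g"
      by (intro add_mono mult_right_mono ennreal_leI) (auto simp: C_def)
    finally show "(\<integral>\<^sup>+x. fixed_scale_bound g x \<partial>lborel) \<le> ennreal C * (weighted_modulus g 6 + lp_energy p \<Omega> g)"
      by (simp only: distrib_left)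
  qed
qed

lemma extension_lp_energy:
  "\<exists>C\<ge>0. \<forall>g\<in>borel_measurable borel. lp_energy p UNIV (extension g) \<le> ennreal C * (weighted_modulus g 6 + lp_energy p \<Omega> g)"
proof -
  obtain C1 where C1: "C1 \<ge> 0" "\<And>g. g\<in>borel_measurable borel \<Longrightarrow>
     (\<integral>\<^sup>+x. fixed_scale_bound g x \<partial>lborel) \<le> ennreal C1 * (weighted_modulus g 6 + lp_energy p \<Omega> g)"
    using integral_fixed_scale_le by blast
  obtain C2 where C2: "C2 \<ge> 0" "\<And>g x. g\<in>borel_measurable borel \<Longrightarrow> off_boundary x \<Longrightarrow>
     epow p (extension g x) \<le> ennreal C2 * fixed_scale_bound g x"
    using extension_bound by blast
  show ?thesis
  proof (intro exI[of _ "C2 * C1"] conjI ballI)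
    show "C2 * C1 \<ge> 0" using C1 C2 by simp
    fix g :: "real^'n \<Rightarrow> real" assume g[measurable]: "g \<in> borel_measurable borel"
    have "lp_energy p UNIV (extension g) \<le> (\<integral>\<^sup>+x. ennreal C2 * fixed_scale_bound g x \<partial>lborel)"
      unfolding lp_energy_lborel
      by (intro nn_integral_mono_AE) (use boundary_null in \<open>eventually_elim, auto intro: C2(2)[OF g]\<close>)
    also have "\<dots> = ennreal C2 * (\<integral>\<^sup>+x. fixed_scale_bound g x \<partial>lborel)"
      by (rule nn_integral_cmult) measurable
    also have "\<dots> \<le> ennreal C2 * (ennreal C1 * (weighted_modulus g 6 + lp_energy p \<Omega> g))"
      by (intro mult_left_mono C1(2) g) simp
    finally show "lp_energy p UNIV (extension g) \<le> ennreal (C2 * C1) * (weighted_modulus g 6 + lp_energy p \<Omega> g)"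
      using C1 C2 by (simp add: ennreal_mult mult.assoc)
  qed
qed

text \<open>The pointwise bound \<open>extension_diff\<close>, integrated over \<open>x\<close>: oscillations and deviations become moduli of \<open>g\<close> on \<open>\<Omega>\<close>.\<close>

lemma extension_increment_small:
  "\<exists>C\<ge>0. \<forall>g\<in>borel_measurable borel. \<forall>h k. 7 \<le> k \<longrightarrow> h \<noteq> 0 \<longrightarrow> norm h \<le> dyadic k \<longrightarrow>
     increment_energy p UNIV (extension g) h \<le> ennreal C * (weighted_modulus g k + ennreal (2 powr (- (real k * p))) * (weighted_modulus g 6 + lp_energy p \<Omega> g))"
proof -
  let ?\<omega> = "unit_ball_vol (real CARD('n))"
  obtain C1 where C1: "C1 \<ge> 0" "\<And>g. g\<in>borel_measurable borel \<Longrightarrow>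
     (\<integral>\<^sup>+x. fixed_scale_bound g x \<partial>lborel) \<le> ennreal C1 * (weighted_modulus g 6 + lp_energy p \<Omega> g)"
    using integral_fixed_scale_le by blast
  obtain C2 where C2: "C2 \<ge> 0" "\<And>g x h k. g\<in>borel_measurable borel \<Longrightarrow> 7 \<le> k \<Longrightarrow> h \<noteq> 0 \<Longrightarrow> norm h \<le> dyadic k \<Longrightarrow>
     off_boundary x \<Longrightarrow> off_boundary (x + h) \<Longrightarrow>
     epow p (extension g (x + h) - extension g x)
       \<le> ennreal C2 * (pair_bound g k x h
           + ennreal (2 powr (- (real k * p))) * fixed_scale_bound g x)"
    using extension_diff by blast
  define D1 where "D1 = ?\<omega>\<^sup>2 * 2 ^ CARD('n)"
  define D2 where "D2 = ?\<omega> * 2 powr (p * 3)"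
  define D where "D = D1 + D1 + D2 + D2"
  have w: "?\<omega> > 0" by simp
  have D: "D1 \<ge> 0" "D2 \<ge> 0" "D \<ge> 0" using w by (auto simp: D1_def D2_def D_def)
  define M where "M = max D C1"
  have M: "M \<ge> 0" "D \<le> M" "C1 \<le> M" using D by (auto simp: M_def)
  show ?thesis
  proof (intro exI[of _ "C2 * M"] conjI ballI allI impI)
    show "C2 * M \<ge> 0" using C2 M by simp
    fix g :: "real^'n \<Rightarrow> real" and h :: "real^'n" and k :: nat
    assume g[measurable]: "g \<in> borel_measurable borel" and k: "7 \<le> k" and h: "h \<noteq> 0" "norm h \<le> dyadic k"
    define w where "w = ennreal (2 powr (- (real k * p)))"
    have shift: "(\<integral>\<^sup>+x. f (x + h) \<partial>lborel) = (\<integral>\<^sup>+x. f x \<partial>lborel)" if "f \<in> borel_measurable borel" for f :: "real^'n \<Rightarrow> ennreal"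
      using nn_integral_lborel_translate[OF that, of h] by (simp add: add.commute)
    have "increment_energy p UNIV (extension g) h
      \<le> (\<integral>\<^sup>+x. ennreal C2 * (pair_bound g k x h
           + w * fixed_scale_bound g x) \<partial>lborel)"
      unfolding increment_energy_lborel w_def
      by (intro nn_integral_mono_AE)
        (use boundary_null boundary_null_translate[of h] in \<open>eventually_elim, auto intro: C2(2)[OF g k h]\<close>)
    also have "\<dots> = ennreal C2 * (((\<integral>\<^sup>+x. total_oscillation g k x \<partial>lborel) + (\<integral>\<^sup>+x. total_oscillation g k (x + h) \<partial>lborel)
        + (\<integral>\<^sup>+x. deviation g (k - 3) x \<partial>lborel) + (\<integral>\<^sup>+x. deviation g (k - 3) (x + h) \<partial>lborel))
        + w * (\<integral>\<^sup>+x. fixed_scale_bound g x \<partial>lborel))"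
      by (simp add: nn_integral_cmult nn_integral_add)
    also have "\<dots> = ennreal C2 * (((\<integral>\<^sup>+x. total_oscillation g k x \<partial>lborel) + (\<integral>\<^sup>+x. total_oscillation g k x \<partial>lborel)
        + (\<integral>\<^sup>+x. deviation g (k - 3) x \<partial>lborel) + (\<integral>\<^sup>+x. deviation g (k - 3) x \<partial>lborel))
        + w * (\<integral>\<^sup>+x. fixed_scale_bound g x \<partial>lborel))"
      by (simp add: shift)
    also have "\<dots> \<le> ennreal C2 * ((ennreal D1 * weighted_modulus g k + ennreal D1 * weighted_modulus g k + ennreal D2 * weighted_modulus g k + ennreal D2 * weighted_modulus g k)
        + w * (ennreal C1 * (weighted_modulus g 6 + lp_energy p \<Omega> g)))"
    proof -
      have 1: "(\<integral>\<^sup>+x. total_oscillation g k x \<partial>lborel) \<le> ennreal D1 * weighted_modulus g k"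
        unfolding D1_def by (rule integral_total_oscillation_le[OF g])
      have "(\<integral>\<^sup>+x. deviation g (k - 3) x \<partial>lborel) \<le> ennreal ?\<omega> * modulus_power p \<Omega> g (dyadic (k - 3))"
        by (rule integral_deviation_le[OF g])
      also have "\<dots> \<le> ennreal ?\<omega> * (ennreal (2 powr (p * real (k - (k - 3)))) * weighted_modulus g k)"
        using k by (intro mult_left_mono modulus_le_weighted_modulus) auto
      also have "\<dots> = ennreal D2 * weighted_modulus g k"
        unfolding D2_def using k by (subst ennreal_mult) (auto simp: mult.assoc less_imp_le)
      finally have 2: "(\<integral>\<^sup>+x. deviation g (k - 3) x \<partial>lborel) \<le> ennreal D2 * weighted_modulus g k" .
      show ?thesis by (intro mult_left_mono add_mono 1 2 C1(2) g) auto
    qed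
    also have "ennreal D1 * weighted_modulus g k + ennreal D1 * weighted_modulus g k + ennreal D2 * weighted_modulus g k + ennreal D2 * weighted_modulus g k = ennreal D * weighted_modulus g k"
      unfolding D_def using D by (simp only: ennreal_plus distrib_right add_nonneg_nonneg)
    also have "ennreal C2 * (ennreal D * weighted_modulus g k + w * (ennreal C1 * (weighted_modulus g 6 + lp_energy p \<Omega> g)))
       \<le> ennreal C2 * (ennreal M * weighted_modulus g k + w * (ennreal M * (weighted_modulus g 6 + lp_energy p \<Omega> g)))"
      using M by (intro mult_left_mono add_mono mult_right_mono ennreal_leI) auto
    also have "\<dots> = ennreal (C2 * M) * (weighted_modulus g k + w * (weighted_modulus g 6 + lp_energy p \<Omega> g))"
    proof -
      have "ennreal (C2 * M) = ennreal C2 * ennreal M" using C2 M by (simp add: ennreal_mult)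
      moreover have "w * (ennreal M * Y) = ennreal M * (w * Y)" for Y by (rule mult.left_commute)
      ultimately show ?thesis by (simp only: distrib_left mult.assoc)
    qed
    finally show "increment_energy p UNIV (extension g) h \<le> ennreal (C2 * M) * (weighted_modulus g k + ennreal (2 powr (- (real k * p))) * (weighted_modulus g 6 + lp_energy p \<Omega> g))"
      unfolding w_def .
  qed
qed

lemma increment_energy_le_lp:
  assumes [measurable]: "v \<in> borel_measurable borel"
  shows "increment_energy p UNIV v h \<le> ennreal (2 powr p * 2) * lp_energy p UNIV v"
proof -
  have "increment_energy p UNIV v h \<le> (\<integral>\<^sup>+x. ennreal (2 powr p) * (epow p (v (x + h)) + epow p (v x)) \<partial>lborel)"
    unfolding increment_energy_lborel
    by (intro nn_integral_mono) (use ennreal_powr_add_le[OF p, of "v (_ + h)" "- v _"] in simp)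
  also have "\<dots> = ennreal (2 powr p) * ((\<integral>\<^sup>+x. epow p (v (x + h)) \<partial>lborel) + (\<integral>\<^sup>+x. epow p (v x) \<partial>lborel))"
    by (simp add: nn_integral_cmult nn_integral_add)
  also have "(\<integral>\<^sup>+x. epow p (v (x + h)) \<partial>lborel) = lp_energy p UNIV v"
    using nn_integral_lborel_translate[of "\<lambda>x. epow p (v x)" h]
    by (simp add: lp_energy_lborel add.commute)
  also have "(\<integral>\<^sup>+x. epow p (v x) \<partial>lborel) = lp_energy p UNIV v"
    by (simp add: lp_energy_lborel)
  also have "ennreal (2 powr p) * (lp_energy p UNIV v + lp_energy p UNIV v) = ennreal (2 powr p * 2) * lp_energy p UNIV v"
    by (simp add: ennreal_mult mult_2[symmetric] mult.assoc)
  finally show ?thesis .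
qed

text \<open>For \<open>k \<ge> 7\<close> the increments are bounded by \<open>extension_increment_small\<close>; for the finitely many coarser scales
the \<open>L\<^sup>p\<close> norm of the extension suffices.\<close>

lemma extension_modulus:
  "\<exists>C\<ge>0. \<forall>g\<in>borel_measurable borel. lp_energy p UNIV (extension g) \<le> ennreal C * (weighted_modulus g 0 + lp_energy p \<Omega> g) \<and>
     (\<forall>k. modulus_power p UNIV (extension g) (dyadic k) \<le> ennreal C * (weighted_modulus g k + ennreal (2 powr (- (real k * p))) * lp_energy p \<Omega> g))"
proof -
  obtain C1 where C1: "C1 \<ge> 0" "\<And>g. g\<in>borel_measurable borel \<Longrightarrow> lp_energy p UNIV (extension g) \<le> ennreal C1 * (weighted_modulus g 6 + lp_energy p \<Omega> g)"
    using extension_lp_energy by blast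
  obtain C2 where C2: "C2 \<ge> 0" "\<And>g h k. g\<in>borel_measurable borel \<Longrightarrow> 7 \<le> k \<Longrightarrow> h \<noteq> 0 \<Longrightarrow> norm h \<le> dyadic k \<Longrightarrow>
     increment_energy p UNIV (extension g) h \<le> ennreal C2 * (weighted_modulus g k + ennreal (2 powr (- (real k * p))) * (weighted_modulus g 6 + lp_energy p \<Omega> g))"
    using extension_increment_small by blast
  define K where "K = 2 powr (6 * p)"
  have K: "K \<ge> 1" using p by (simp add: K_def ge_one_powr_ge_zero)
  define D where "D = 2 powr p * 2 * C1 * K + C2 * (1 + K) + C1 * K"
  have D: "D \<ge> 0" "2 powr p * 2 * C1 * K \<le> D" "C2 * (1 + K) \<le> D" "C1 * K \<le> D"
    using C1 C2 K by (auto simp: D_def)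
  have w6: "weighted_modulus g 6 + lp_energy p \<Omega> g \<le> ennreal K * (weighted_modulus g k + ennreal (2 powr (- (real k * p))) * lp_energy p \<Omega> g)" if "k \<le> 6" for g k
  proof -
    have "weighted_modulus g 6 \<le> ennreal (2 powr (p * \<bar>real 6 - real k\<bar>)) * weighted_modulus g k" by (rule weighted_modulus_le)
    also have "\<dots> \<le> ennreal K * weighted_modulus g k"
      unfolding K_def using that p by (intro mult_right_mono ennreal_leI powr_mono) (auto simp: mult.commute)
    finally have 1: "weighted_modulus g 6 \<le> ennreal K * weighted_modulus g k" .
    have "1 \<le> K * 2 powr (- (real k * p))"
    proof -
      have "real k * p \<le> 6 * p" using that p by (intro mult_right_mono) auto
      then have "1 \<le> 2 powr (6 * p - real k * p)" by (intro ge_one_powr_ge_zero) auto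
      then show ?thesis by (simp add: K_def flip: powr_add)
    qed
    then have "ennreal 1 * lp_energy p \<Omega> g \<le> ennreal (K * 2 powr (- (real k * p))) * lp_energy p \<Omega> g"
      by (intro mult_right_mono ennreal_leI) auto
    then have 2: "lp_energy p \<Omega> g \<le> ennreal K * (ennreal (2 powr (- (real k * p))) * lp_energy p \<Omega> g)"
      using K by (simp add: ennreal_mult mult.assoc)
    show ?thesis unfolding distrib_left by (intro add_mono 1 2)
  qed
  show ?thesis
  proof (intro exI[of _ D] conjI ballI allI D(1))
    fix g :: "real^'n \<Rightarrow> real" assume g[measurable]: "g \<in> borel_measurable borel"
    have lp_k: "lp_energy p UNIV (extension g) \<le> ennreal (C1 * K) * (weighted_modulus g k + ennreal (2 powr (- (real k * p))) * lp_energy p \<Omega> g)" if "k \<le> 6" for k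
    proof -
      have "lp_energy p UNIV (extension g) \<le> ennreal C1 * (ennreal K * (weighted_modulus g k + ennreal (2 powr (- (real k * p))) * lp_energy p \<Omega> g))"
        by (rule order_trans[OF C1(2)[OF g]]) (intro mult_left_mono w6 that, simp)
      then show ?thesis using C1 K by (simp add: ennreal_mult mult.assoc)
    qed
    have "lp_energy p UNIV (extension g) \<le> ennreal (C1 * K) * (weighted_modulus g 0 + lp_energy p \<Omega> g)" using lp_k[of 0] by simp
    then show "lp_energy p UNIV (extension g) \<le> ennreal D * (weighted_modulus g 0 + lp_energy p \<Omega> g)"
      by (rule ennreal_le_add_mult) (use D in auto)
    fix k
    show "modulus_power p UNIV (extension g) (dyadic k) \<le> ennreal D * (weighted_modulus g k + ennreal (2 powr (- (real k * p))) * lp_energy p \<Omega> g)"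
      unfolding modulus_power_def
    proof (rule SUP_least)
      fix h :: "real^'n" assume "h \<in> {h. norm h \<le> dyadic k}"
      then have h: "norm h \<le> dyadic k" by simp
      show "increment_energy p UNIV (extension g) h \<le> ennreal D * (weighted_modulus g k + ennreal (2 powr (- (real k * p))) * lp_energy p \<Omega> g)"
      proof (cases "h = 0")
        case True
        then show ?thesis using p by (simp add: increment_energy_def)
      next
        case nz: False
        show ?thesis
        proof (cases "k \<le> 6")
          case True
          have "increment_energy p UNIV (extension g) h \<le> ennreal (2 powr p * 2) * lp_energy p UNIV (extension g)"
            by (rule increment_energy_le_lp) measurable
          also have "\<dots> \<le> ennreal (2 powr p * 2) * (ennreal (C1 * K) * (weighted_modulus g k + ennreal (2 powr (- (real k * p))) * lp_energy p \<Omega> g))"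
            by (intro mult_left_mono lp_k True) simp
          also have "\<dots> = ennreal (2 powr p * 2 * (C1 * K)) * (weighted_modulus g k + ennreal (2 powr (- (real k * p))) * lp_energy p \<Omega> g)"
            by (rule ennreal_mult_assoc) (use C1(1) K in auto)
          finally show ?thesis by (rule ennreal_le_add_mult) (use D in \<open>auto simp: mult.assoc\<close>)
        next
          case False
          let ?w = "ennreal (2 powr (- (real k * p)))"
          have "increment_energy p UNIV (extension g) h \<le> ennreal C2 * (weighted_modulus g k + ?w * (weighted_modulus g 6 + lp_energy p \<Omega> g))"
            using False by (intro C2(2) g nz h) simp
          also have "\<dots> \<le> ennreal C2 * (ennreal (1 + K) * (weighted_modulus g k + ?w * lp_energy p \<Omega> g))"
          proof (intro mult_left_mono)
            have "?w * weighted_modulus g 6 \<le> ?w * (ennreal (2 powr (p * \<bar>real 6 - real k\<bar>)) * weighted_modulus g k)"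
              by (intro mult_left_mono weighted_modulus_le) simp
            also have "\<dots> = ennreal (2 powr (- (real k * p)) * 2 powr (p * \<bar>real 6 - real k\<bar>)) * weighted_modulus g k"
              by (subst ennreal_mult) (auto simp: mult.assoc)
            also have "\<dots> \<le> ennreal K * weighted_modulus g k"
            proof (intro mult_right_mono ennreal_leI)
              have "- (real k * p) + p * \<bar>real 6 - real k\<bar> \<le> 6 * p"
                using False p by (simp add: algebra_simps abs_if)
              then show "2 powr (- (real k * p)) * 2 powr (p * \<bar>real 6 - real k\<bar>) \<le> K"
                unfolding K_def powr_add[symmetric] by (intro powr_mono) auto
            qed simp
            finally have "?w * weighted_modulus g 6 \<le> ennreal K * weighted_modulus g k" .
            then have "weighted_modulus g k + ?w * (weighted_modulus g 6 + lp_energy p \<Omega> g) \<le> weighted_modulus g k + (ennreal K * weighted_modulus g k + ?w * lp_energy p \<Omega> g)"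
              unfolding distrib_left by (intro add_mono) auto
            also have "\<dots> \<le> ennreal (1 + K) * weighted_modulus g k + ennreal (1 + K) * (?w * lp_energy p \<Omega> g)"
            proof -
              have "ennreal (1 + K) * weighted_modulus g k = weighted_modulus g k + ennreal K * weighted_modulus g k"
                using K by (simp add: ennreal_plus distrib_right)
              moreover have "ennreal 1 * (?w * lp_energy p \<Omega> g) \<le> ennreal (1 + K) * (?w * lp_energy p \<Omega> g)"
                using K by (intro mult_right_mono ennreal_leI) auto
              ultimately show ?thesis by (simp add: add.assoc add_left_mono)
            qed
            finally show "weighted_modulus g k + ?w * (weighted_modulus g 6 + lp_energy p \<Omega> g) \<le> ennreal (1 + K) * (weighted_modulus g k + ?w * lp_energy p \<Omega> g)"
              by (simp only: distrib_left)
          qed simp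
          also have "\<dots> = ennreal (C2 * (1 + K)) * (weighted_modulus g k + ?w * lp_energy p \<Omega> g)"
            by (rule ennreal_mult_assoc) (use C2(1) K in auto)
          finally show ?thesis by (rule ennreal_le_add_mult) (use D in auto)
        qed
      qed
    qed
  qed
qed

text \<open>After multiplication by \<open>2\<^sup>k\<^sup>s\<^sup>p\<close>, the weights decay in both directions, because the slopes of \<open>bent\<close> are
\<open>1 > s\<close> towards coarse scales and \<open>s/2 < s\<close> towards fine scales.\<close>

lemma extension_besov_norm:
  assumes q: "q > 0"
  shows "\<exists>C\<ge>0. \<forall>g\<in>borel_measurable borel. besov_norm s p q UNIV (extension g) \<le> ennreal C * besov_norm s p q \<Omega> g"
proof -
  \<comment> \<open>The decay rates towards coarse and fine scales.\<close>
  define \<eta> where "\<eta> = min ((1 - s) * p) (s / 2 * p)"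
  have \<eta>: "\<eta> > 0" "\<eta> \<le> (1 - s) * p" "\<eta> \<le> s / 2 * p" using s p by (auto simp: \<eta>_def)
  obtain C0 where C0: "C0 \<ge> 0" "\<And>g. g\<in>borel_measurable borel \<Longrightarrow> lp_energy p UNIV (extension g) \<le> ennreal C0 * (weighted_modulus g 0 + lp_energy p \<Omega> g)"
     "\<And>g k. g\<in>borel_measurable borel \<Longrightarrow> modulus_power p UNIV (extension g) (dyadic k) \<le> ennreal C0 * (weighted_modulus g k + ennreal (2 powr (- (real k * p))) * lp_energy p \<Omega> g)"
    using extension_modulus by blast
  obtain C1 where C1: "C1 \<ge> 0"
    "\<And>S (u::real^'n \<Rightarrow> real) Y.
       lp_energy p S u \<le> (\<Sum>l. ennreal (geom_kernel \<eta> 0 l) * Y l) \<Longrightarrow>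
       (\<And>k. ennreal (2 powr (real k * s * p)) * modulus_power p S u (dyadic k) \<le> (\<Sum>l. ennreal (geom_kernel \<eta> k l) * Y l)) \<Longrightarrow>
       besov_norm s p q S u \<le> ennreal C1 * seq_norm p q Y"
    using besov_norm_le_seq_norm[OF s(1) p q \<eta>(1)] by blast
  obtain C2 where C2: "C2 \<ge> 0"
    "\<And>S (u::real^'n \<Rightarrow> real). seq_norm p q (dyadic_energy s p S u) \<le> ennreal C2 * besov_norm s p q S u"
  proof -
    show thesis
    proof (rule seq_norm_dyadic_energy_le[where ?'n='n, OF s(1) p q], goal_cases)
      case (1 C)
      show ?case by (rule that[of C]) (fact 1)+
    qed
  qed
  \<comment> \<open>Scaling a sequence norm is used with a positive factor.\<close>
  define c where "c = C0 + 1"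
  have c: "c > 0" "C0 \<le> c" using C0 by (auto simp: c_def)
  show ?thesis
  proof (intro exI[of _ "C1 * c powr (1 / p) * C2"] conjI ballI)
    show "C1 * c powr (1 / p) * C2 \<ge> 0" using C1 C2 by simp
    fix g :: "real^'n \<Rightarrow> real" assume g: "g \<in> borel_measurable borel"
    define Y where "Y = dyadic_energy s p \<Omega> g"
    have key: "ennreal (2 powr (real k * s * p)) * (weighted_modulus g k + ennreal (2 powr (- (real k * p))) * lp_energy p \<Omega> g) \<le> (\<Sum>l. ennreal (geom_kernel \<eta> k l) * Y l)" for k
    proof -
      have "ennreal (2 powr (real k * s * p)) * weighted_modulus g k
        = (\<Sum>j. ennreal (2 powr (real k * s * p)) * (ennreal (scale_weight k (Suc j)) * modulus_power p \<Omega> g (dyadic (Suc j))))"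
        unfolding weighted_modulus_def by simp
      also have "\<dots> \<le> (\<Sum>j. ennreal (geom_kernel \<eta> k (Suc j)) * Y (Suc j))"
      proof (intro suminf_le summableI)
        fix j
        define t where "t = real (Suc j) - real k"
        have "real k * s * p + p * bent (s / 2) t \<le> - \<eta> * \<bar>t\<bar> + real (Suc j) * s * p"
        proof (cases "t \<le> 0")
          case True
          have "\<eta> * (- t) \<le> (1 - s) * p * (- t)" using \<eta> True by (intro mult_right_mono) auto
          then show ?thesis using True by (simp add: bent_def t_def algebra_simps)
        next
          case False
          have "\<eta> * t \<le> s / 2 * p * t" using \<eta> False by (intro mult_right_mono) auto
          then have "\<eta> * t + p * (s / 2 * t) \<le> s * p * t" by (simp add: field_simps)
          moreover have "real (Suc j) * s * p - real k * s * p = s * p * t" by (simp add: t_def algebra_simps)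
          ultimately show ?thesis using False by (simp add: bent_def)
        qed
        then have "2 powr (real k * s * p + p * bent (s / 2) t) \<le> (2::real) powr (- \<eta> * \<bar>t\<bar> + real (Suc j) * s * p)"
          by (intro powr_mono) auto
        then have "2 powr (real k * s * p) * scale_weight k (Suc j) \<le> geom_kernel \<eta> k (Suc j) * 2 powr (real (Suc j) * s * p)"
          unfolding powr_add by (simp add: scale_weight_def geom_kernel_def t_def abs_minus_commute)
        then have "ennreal (2 powr (real k * s * p) * scale_weight k (Suc j)) * modulus_power p \<Omega> g (dyadic (Suc j))
           \<le> ennreal (geom_kernel \<eta> k (Suc j) * 2 powr (real (Suc j) * s * p)) * modulus_power p \<Omega> g (dyadic (Suc j))"
          by (intro mult_right_mono ennreal_leI) auto
        moreover have "ennreal (geom_kernel \<eta> k (Suc j) * 2 powr (real (Suc j) * s * p)) * modulus_power p \<Omega> g (dyadic (Suc j))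
           = ennreal (geom_kernel \<eta> k (Suc j)) * Y (Suc j)"
          unfolding Y_def dyadic_energy_def by (subst ennreal_mult) (auto simp: mult.assoc)
        moreover have "ennreal (2 powr (real k * s * p) * scale_weight k (Suc j)) * modulus_power p \<Omega> g (dyadic (Suc j))
           = ennreal (2 powr (real k * s * p)) * (ennreal (scale_weight k (Suc j)) * modulus_power p \<Omega> g (dyadic (Suc j)))"
          by (subst ennreal_mult) (auto simp: mult.assoc)
        ultimately show "ennreal (2 powr (real k * s * p)) * (ennreal (scale_weight k (Suc j)) * modulus_power p \<Omega> g (dyadic (Suc j)))
          \<le> ennreal (geom_kernel \<eta> k (Suc j)) * Y (Suc j)" by simp
      qed
      finally have 1: "ennreal (2 powr (real k * s * p)) * weighted_modulus g k \<le> (\<Sum>j. ennreal (geom_kernel \<eta> k (Suc j)) * Y (Suc j))" .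
      have "2 powr (real k * s * p) * 2 powr (- (real k * p)) \<le> geom_kernel \<eta> k 0"
      proof -
        have "\<eta> * real k \<le> (1 - s) * p * real k" using \<eta> by (intro mult_right_mono) auto
        then show ?thesis unfolding powr_add[symmetric] geom_kernel_def by (intro powr_mono) (auto simp: algebra_simps)
      qed
      then have "ennreal (2 powr (real k * s * p) * 2 powr (- (real k * p))) * lp_energy p \<Omega> g \<le> ennreal (geom_kernel \<eta> k 0) * lp_energy p \<Omega> g"
        by (intro mult_right_mono ennreal_leI) auto
      then have 2: "ennreal (2 powr (real k * s * p)) * (ennreal (2 powr (- (real k * p))) * lp_energy p \<Omega> g) \<le> ennreal (geom_kernel \<eta> k 0) * Y 0"
        by (simp add: ennreal_mult mult.assoc Y_def dyadic_energy_def)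
      have "(\<Sum>l. ennreal (geom_kernel \<eta> k l) * Y l) = (\<Sum>l. ennreal (geom_kernel \<eta> k (l + 1)) * Y (l + 1)) + (\<Sum>l<1. ennreal (geom_kernel \<eta> k l) * Y l)"
        by (rule suminf_offset) (rule summableI)
      then have "(\<Sum>l. ennreal (geom_kernel \<eta> k l) * Y l) = (\<Sum>j. ennreal (geom_kernel \<eta> k (Suc j)) * Y (Suc j)) + ennreal (geom_kernel \<eta> k 0) * Y 0"
        by simp
      then show ?thesis unfolding distrib_left using add_mono[OF 1 2] by (simp only:)
    qed
    have scale: "(\<Sum>l. ennreal (geom_kernel \<eta> k l) * (ennreal c * Y l)) = ennreal c * (\<Sum>l. ennreal (geom_kernel \<eta> k l) * Y l)" for k
      by (simp only: mult.left_commute[of _ "ennreal c"] ennreal_suminf_cmult)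
    have "besov_norm s p q UNIV (extension g) \<le> ennreal C1 * seq_norm p q (\<lambda>l. ennreal c * Y l)"
    proof (rule C1(2))
      have "lp_energy p UNIV (extension g) \<le> ennreal C0 * (weighted_modulus g 0 + lp_energy p \<Omega> g)" by (rule C0(2)[OF g])
      also have "\<dots> \<le> ennreal c * (\<Sum>l. ennreal (geom_kernel \<eta> 0 l) * Y l)"
        using key[of 0] c by (intro mult_mono ennreal_leI) auto
      finally show "lp_energy p UNIV (extension g) \<le> (\<Sum>l. ennreal (geom_kernel \<eta> 0 l) * (ennreal c * Y l))"
        unfolding scale .
      fix k
      have "ennreal (2 powr (real k * s * p)) * modulus_power p UNIV (extension g) (dyadic k)
        \<le> ennreal (2 powr (real k * s * p)) * (ennreal C0 * (weighted_modulus g k + ennreal (2 powr (- (real k * p))) * lp_energy p \<Omega> g))"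
        by (intro mult_left_mono C0(3) g) simp
      also have "\<dots> = ennreal C0 * (ennreal (2 powr (real k * s * p)) * (weighted_modulus g k + ennreal (2 powr (- (real k * p))) * lp_energy p \<Omega> g))"
        by (rule mult.left_commute)
      also have "\<dots> \<le> ennreal c * (\<Sum>l. ennreal (geom_kernel \<eta> k l) * Y l)"
        using key[of k] c by (intro mult_mono ennreal_leI) auto
      finally show "ennreal (2 powr (real k * s * p)) * modulus_power p UNIV (extension g) (dyadic k) \<le> (\<Sum>l. ennreal (geom_kernel \<eta> k l) * (ennreal c * Y l))"
        unfolding scale .
    qed
    also have "\<dots> = ennreal C1 * (ennreal (c powr (1 / p)) * seq_norm p q Y)"
      using seq_norm_cmult[OF p q c(1), of Y] by simp
    also have "\<dots> \<le> ennreal C1 * (ennreal (c powr (1 / p)) * (ennreal C2 * besov_norm s p q \<Omega> g))"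
      unfolding Y_def by (intro mult_left_mono C2(2)) auto
    also have "\<dots> = ennreal (C1 * c powr (1 / p) * C2) * besov_norm s p q \<Omega> g"
      using C1 C2 by (simp add: ennreal_mult mult.assoc)
    finally show "besov_norm s p q UNIV (extension g) \<le> ennreal (C1 * c powr (1 / p) * C2) * besov_norm s p q \<Omega> g" .
  qed
qed

end

section \<open>The equivalence\<close>

text \<open>A Borel function that agrees with \<open>u\<close> almost everywhere on \<open>S\<close>. Since the choice depends only on the class
of \<open>u\<close> modulo null sets, every operator defined through it respects this identification, and Fubini's theorem
applies to Borel functions without passing to completions.\<close>

definition borel_rep :: "(real^'n) set \<Rightarrow> (real^'n \<Rightarrow> real) \<Rightarrow> (real^'n \<Rightarrow> real)" where
  "borel_rep S u = (SOME g. g \<in> borel_measurable borel \<and> (AE x in lebesgue. x \<in> S \<longrightarrow> g x = u x))"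

lemma borel_rep:
  assumes S: "S \<in> sets borel" and u: "u \<in> borel_measurable (lebesgue_on S)"
  shows "borel_rep S u \<in> borel_measurable borel" "AE x in lebesgue. x \<in> S \<longrightarrow> borel_rep S u x = u x"
proof -
  have "(\<lambda>x. if x \<in> S then u x else 0) \<in> borel_measurable lebesgue"
    using u S measurable_restrict_space_iff[of S lebesgue 0 borel u] by simp
  then obtain g where "g \<in> borel_measurable borel" "AE x in lebesgue. (if x \<in> S then u x else 0) = g x"
    by (rule borel_version)
  then have "\<exists>g. g \<in> borel_measurable borel \<and> (AE x in lebesgue. x \<in> S \<longrightarrow> g x = u x)"
    by (intro exI[of _ g] conjI) (auto elim!: eventually_mono)
  from someI_ex[OF this] show "borel_rep S u \<in> borel_measurable borel" "AE x in lebesgue. x \<in> S \<longrightarrow> borel_rep S u x = u x"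
    unfolding borel_rep_def by auto
qed

lemma borel_rep_cong_AE:
  assumes "AE x in lebesgue. x \<in> S \<longrightarrow> u x = v x"
  shows "borel_rep S u = borel_rep S v"
proof -
  have "(AE x in lebesgue. x \<in> S \<longrightarrow> g x = u x) \<longleftrightarrow> (AE x in lebesgue. x \<in> S \<longrightarrow> g x = v x)" for g
    using assms by (auto elim: eventually_elim2)
  then show ?thesis unfolding borel_rep_def by simp
qed

text \<open>A point at distance at most \<open>r/3\<close> from \<open>\<Omega>\<close> has a point of \<open>\<Omega>\<close> within \<open>3r/4\<close>, and the ball of radius \<open>r/4\<close>
around the latter lies in the ball of radius \<open>r\<close> around the former.\<close>

lemma measure_density_near:
  fixes \<Omega> :: "(real^'n) set"
  assumes "open \<Omega>" "\<Omega> \<noteq> {}" "measure_density_condition \<Omega>"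
  obtains \<kappa> where "\<kappa> > 0" "\<And>x r. 0 < r \<Longrightarrow> r \<le> 1 \<Longrightarrow> 3 * infdist x \<Omega> \<le> r \<Longrightarrow> \<kappa> * r ^ CARD('n) \<le> measure lborel (\<Omega> \<inter> ball x r)"
proof -
  let ?\<omega> = "unit_ball_vol (real CARD('n))"
  obtain c where c: "c > 0" "\<And>x r. x \<in> \<Omega> \<Longrightarrow> 0 < r \<Longrightarrow> r \<le> 1 \<Longrightarrow> c * measure lebesgue (ball x r) \<le> measure lebesgue (\<Omega> \<inter> ball x r)"
    using assms(3) unfolding measure_density_condition_def by blast
  show thesis
  proof (rule that[of "c * ?\<omega> / 4 ^ CARD('n)"])
    show "c * ?\<omega> / 4 ^ CARD('n) > 0" using c by simp
    fix x :: "real^'n" and r :: real assume r: "0 < r" "r \<le> 1" "3 * infdist x \<Omega> \<le> r"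
    then have "infdist x \<Omega> < 3 / 4 * r" by linarith
    then obtain z where z: "z \<in> \<Omega>" "dist x z < 3 / 4 * r"
      using cInf_lessD[of "dist x ` \<Omega>" "3 / 4 * r"] assms(2) by (auto simp: infdist_notempty)
    have "c * ?\<omega> / 4 ^ CARD('n) * r ^ CARD('n) = c * measure lebesgue (ball z (r / 4))"
      using r by (subst measure_ball_cart) (auto simp: power_divide)
    also have "\<dots> \<le> measure lebesgue (\<Omega> \<inter> ball z (r / 4))"
      using r z by (intro c) auto
    also have "\<dots> = measure lborel (\<Omega> \<inter> ball z (r / 4))"
      using assms by (intro measure_lebesgue_borel) auto
    also have "\<dots> \<le> measure lborel (\<Omega> \<inter> ball x r)"
    proof (intro measure_Int_ball_mono assms subsetI)
      fix y assume "y \<in> ball z (r / 4)"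
      then show "y \<in> ball x r" using z dist_triangle[of x y z] by simp
    qed
    finally show "c * ?\<omega> / 4 ^ CARD('n) * r ^ CARD('n) \<le> measure lborel (\<Omega> \<inter> ball x r)" .
  qed
qed

lemma SUP_zero_ennreal: "(SUP x\<in>A. 0) = (0::ennreal)"
  by (auto intro!: antisym SUP_least)

theorem measure_density_imp_extension:
  fixes \<Omega> :: "(real^'n) set"
  assumes \<Omega>: "open \<Omega>" and dens: "measure_density_condition \<Omega>" and s: "0 < s" "s < 1" and p: "p > 0" and q: "q > 0"
  shows "\<exists>E. bounded_extension_operator s p q \<Omega> E"
proof (cases "\<Omega> = {}")
  case True
  have zero: "besov_norm s p q UNIV (\<lambda>x::real^'n. 0) = 0"
  proof -
    have "smoothness_modulus p UNIV (\<lambda>x::real^'n. 0) t = 0" for t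
      using p by (simp add: smoothness_modulus_def SUP_zero_ennreal)
    then show ?thesis
      using p q by (simp add: besov_norm_def besov_seminorm_def lp_norm_def SUP_zero_ennreal)
  qed
  then show ?thesis
    by (intro exI[of _ "\<lambda>u x. 0"]) (auto simp: bounded_extension_operator_def besov_space_def True AE_lebesgue_on_iff)
next
  case False
  obtain \<kappa> where \<kappa>: "\<kappa> > 0" "\<And>x r. 0 < r \<Longrightarrow> r \<le> 1 \<Longrightarrow> 3 * infdist x \<Omega> \<le> r \<Longrightarrow> \<kappa> * r ^ CARD('n) \<le> measure lborel (\<Omega> \<inter> ball x r)"
    using measure_density_near[OF \<Omega> False dens] by blast
  interpret density_domain \<Omega> \<kappa> p s
    using \<Omega> False \<kappa> s p by unfold_locales auto
  obtain C where C: "C \<ge> 0" "\<And>g. g \<in> borel_measurable borel \<Longrightarrow> besov_norm s p q UNIV (extension g) \<le> ennreal C * besov_norm s p q \<Omega> g"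
    using extension_besov_norm[OF q] by blast
  define E where "E u = extension (borel_rep \<Omega> u)" for u
  have rep: "borel_rep \<Omega> u \<in> borel_measurable borel" "AE x in lebesgue. x \<in> \<Omega> \<longrightarrow> borel_rep \<Omega> u x = u x"
    if "u \<in> besov_space s p q \<Omega>" for u
    using borel_rep[OF domain_borel, of u] that by (auto simp: besov_space_def)
  have bound: "besov_norm s p q UNIV (E u) \<le> ennreal C * besov_norm s p q \<Omega> u" if "u \<in> besov_space s p q \<Omega>" for u
    using C(2)[OF rep(1)[OF that]] besov_norm_cong_AE[OF rep(2)[OF that], of s p q] by (simp add: E_def)
  have "bounded_extension_operator s p q \<Omega> E"
    unfolding bounded_extension_operator_def
  proof (intro conjI ballI impI)
    fix u assume u: "u \<in> besov_space s p q \<Omega>"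
    have "E u \<in> borel_measurable borel" unfolding E_def by (intro borel_measurable_extension rep u)
    then have "E u \<in> borel_measurable (lebesgue_on UNIV)"
      by (simp add: lebesgue_on_UNIV_eq measurable_completion)
    moreover have "besov_norm s p q UNIV (E u) < \<infinity>"
      by (rule le_less_trans[OF bound[OF u]]) (use u in \<open>auto simp: besov_space_def ennreal_mult_less_top\<close>)
    ultimately show "E u \<in> besov_space s p q UNIV" by (simp add: besov_space_def)
    show "AE x in lebesgue_on \<Omega>. E u x = u x"
      unfolding AE_lebesgue_on_iff[OF domain_borel]
      using rep(2)[OF u] by eventually_elim (simp add: E_def extension_eq_on_domain)
    fix v assume v: "v \<in> besov_space s p q \<Omega>" and "AE x in lebesgue_on \<Omega>. u x = v x"
    then have "borel_rep \<Omega> u = borel_rep \<Omega> v"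
      by (intro borel_rep_cong_AE) (simp add: AE_lebesgue_on_iff)
    then show "AE x in lebesgue. E u x = E v x" by (simp add: E_def)
  next
    show "\<exists>C\<ge>0. \<forall>u\<in>besov_space s p q \<Omega>. besov_norm s p q UNIV (E u) \<le> ennreal C * besov_norm s p q \<Omega> u"
      using C(1) bound by blast
  qed
  then show ?thesis by blast
qed

theorem theorem1p4:
  fixes \<Omega> :: "(real^'n) set"
  assumes "open \<Omega>" and "connected \<Omega>"
  shows "(measure_density_condition \<Omega> \<longleftrightarrow>
            (\<forall>(s::real) (p::real) (q::ennreal).
               0 < s \<and> s < 1 \<and> 0 < p \<and> 0 < q \<longrightarrow> besov_extension_domain s p q \<Omega>))
       \<and> ((\<forall>(s::real) (p::real) (q::ennreal).
               0 < s \<and> s < 1 \<and> 0 < p \<and> 0 < q \<longrightarrow> besov_extension_domain s p q \<Omega>) \<longleftrightarrow>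
            (\<exists>(s::real) (p::real) (q::ennreal).
               0 < s \<and> s < 1 \<and> 0 < p \<and> 0 < q \<and> besov_extension_domain s p q \<Omega>))"
    (is "(?density \<longleftrightarrow> ?all) \<and> (?all \<longleftrightarrow> ?some)")
proof -
  have "?all" if "?density"
    using measure_density_imp_extension[OF assms(1) that] assms by (auto simp: besov_extension_domain_def)
  moreover have "?some" if "?all"
  proof -
    have "besov_extension_domain (1/2) 1 1 \<Omega>" using that[rule_format, of "1/2" 1 1] by simp
    then show ?thesis by (intro exI[of _ "1/2::real"] exI[of _ "1::real"] exI[of _ "1::ennreal"]) simp
  qed
  moreover have "?density" if "?some"
    using that extension_imp_measure_density[OF assms] by (auto simp: besov_extension_domain_def)
  ultimately show ?thesis by blast
qed

end
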